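(* Let $F\in\mathbf F$ satisfy $\mathbf{HN^0}$, $\mathbf{H\mathcal A}$ and (I). Then: (i) If either $\mathbf{NA^r}$ holds, or both $\mathbf{NA^s}$ and $\mathbf{EF}$ hold, then $\mathcal D(F)\neq\emptyset$ and $A_T(F)$ is closed in probability. (ii) If $\mathcal D(F)\neq\emptyset$, then $\mathbf{NA^s}$ and $\mathbf{NA^r}$ hold.
   Context: Fix $T\in\mathbb N$, $\mathbb T=\{0,\dots,T\}$, $d\ge1$, a complete probability space $(\Omega,\mathcal F,\mathbb P)$ and a filtration $\mathbb H=(\mathcal H_t)_{t\in\mathbb T}$ with $\mathcal H_T\subset\mathcal F$ (no other relation between $\mathbb H$ and the other processes is assumed). Equalities and inequalities between random variables are understood $\mathbb P$-a.s. $\mathbb M^d$ denotes the real $d\times d$ matrices, $\mathbb M^d_+$ those with nonnegative entries, and $e_{ij}$ the matrix whose $(i,j)$ entry is $1$ and all other entries $0$. For $E\subset\mathbb M^d$ (or $E\subset\mathbb R^d$) and a $\sigma$-algebra $\mathcal G\subset\mathcal F$, $L^0(E;\mathcal G)$ is the set of $E$-valued $\mathcal G$-measurable random variables; $L^1(\mathbb R^d;\mathcal F)$ and $L^\infty(\mathbb R^d;\mathcal F)$ are the integrable, resp. bounded, elements of $L^0(\mathbb R^d;\mathcal F)$. A closed convex cone $\mathcal A\subset\mathbb M^d$ is fixed; $\mathbb L^0(\mathcal A;\mathbb H)$ denotes the set of $\mathcal A$-valued $\mathbb H$-adapted processes $(\eta_t)_{t\in\mathbb T}$. $\mathbb F$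 is the set of continuous maps $f:\mathbb M^d\to\mathbb R^d$ such that (HF1) $f(\lambda a)=\lambda f(a)$ for all $\lambda\ge0$, $a\in\mathbb M^d$; (HF2) $f(\lambda a+\beta a')-(\lambda f(a)+\beta f(a'))\in\mathbb R^d_+$ for all $\lambda,\beta\ge0$, $a,a'\in\mathcal A$. $\mathbf F$ is the set of sequences $F=(F_t)_{t\in\mathbb T}$ of $\mathcal F$-measurable random maps $F_t:\Omega\times\mathbb M^d\to\mathbb R^d$ with $F_t(\omega,\cdot)\in\mathbb F$ for a.e. $\omega$ (no adaptedness to $\mathbb H$ is assumed); for a random matrix $\eta$, $F_t(\eta)(\omega)=F_t(\omega,\eta(\omega))$. $N_t(F)=\{F_t(\eta):\eta\in L^0(\mathcal A;\mathcal H_t)\}$, $N^0_t(F)=N_t(F)\cap(-N_t(F))$. For a process $\xi=(\xi_t)_{t\in\mathbb T}$, "$\xi\in N(F)$" means $\xi_t\in N_t(F)$ for all $t$. $V_t(\xi)=\sum_{s=0}^t\xi_s$ and $A_t(F)=\{V_t(\xi)-r:\ \xi\in N(F),\ r\in L^0(\mathbb R^d_+;\mathcal F)\}$. Condition $\mathbf{HN^0}$: for all $t\in\mathbb T$ and $\eta\in L^0(\mathcal A;\mathcal H_t)$, $F_t(\eta)\in N^0_t(F)$ implies $F_t(-\eta)=-F_t(\eta)$ and $-\eta\in L^0(\mathcal A;\mathcal H_t)$. Condition $\mathbf{H\mathcal A}$: for every $t\in\mathbb T$: (1) $F_t(\delta e_{ij})=0$ whenever $\delta e_{ij}\notin\mathcal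 A$, $\delta\in\{-1,1\}$, $i,j\le d$; (2) for every $\eta\in L^0(\mathbb M^d;\mathcal F)$, $F_t(\eta)=\sum_{i,j\le d}(\eta^{ij})^+F_t(e_{ij})+(\eta^{ij})^-F_t(-e_{ij})$. Condition (I): $F_t(e_{ij}),F_t(-e_{ij})\in L^1(\mathbb R^d;\mathcal F)$ for all $i,j\le d$, $t\in\mathbb T$. Condition $\mathbf{NA^w}$ (for an element $G\in\mathbf F$): $A_T(G)\cap L^0(\mathbb R^d_+;\mathcal F)=\{0\}$. Condition $\mathbf{NA^s}$: $A_t(F)\cap\big(-N_t(F)+L^0(\mathbb R^d_+;\mathcal F)\big)\subset N^0_t(F)$ for all $t\in\mathbb T$. Condition $\mathbf{EF}$: $N^0_t(F)=\{0\}$ for all $t\in\mathbb T$. Condition $\mathbf{NA^r}$: there exists $G\in\mathbf F$ such that for all $\eta\in\mathbb L^0(\mathcal A;\mathbb H)$, $t\in\mathbb T$ and $i\le d$: (1) $G^i_t(\eta_t)\ge F^i_t(\eta_t)$; (2) if $F_t(\eta_t)\notin N^0_t(F)$ then the event $\{\exists k\le d: G^k_t(\eta_t)>F^k_t(\eta_t)\}$ has positive probability; (3) $\mathbf{NA^w}$ holds for $G$. For $Z\in L^\infty(\mathbb R^d;\mathcal F)$ and $\eta\in L^0(\mathcal A;\mathcal H_t)$, $\bar F_t(\eta;Z):=\mathbb E[Z\cdot F_t(\eta)\mid\mathcal H_t]$, which under $\mathbf{H\mathcal A}$ and (I) is understood as $\sum_{i,j}(\eta^{ij})^+\mathbb E[Z\cdot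 F_t(e_{ij})\mid\mathcal H_t]+(\eta^{ij})^-\mathbb E[Z\cdot F_t(-e_{ij})\mid\mathcal H_t]$ ($\cdot$ is the scalar product of $\mathbb R^d$). $\mathcal D(F)$ is the set of $Z\in L^\infty(\mathbb R^d;\mathcal F)$ with $Z^i>0$ a.s. for all $i\le d$ such that for all $\eta\in\mathbb L^0(\mathcal A;\mathbb H)$ and $t\in\mathbb T$: (D1) $\bar F_t(\eta_t;Z)\le0$; (D2) $F_t(\eta_t)\mathbf 1_{\{\bar F_t(\eta_t;Z)=0\}}\in N^0_t(F)$. *)

theory Defs
  imports "HOL-Analysis.Analysis" "HOL-Probability.Probability"
begin

type_synonym 'd mat = "real^'d^'d"

definition setting :: "'a measure \<Rightarrow> (nat \<Rightarrow> 'a measure) \<Rightarrow> nat \<Rightarrow> ('d::finite) mat set \<Rightarrow> bool" where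
  "setting M H T Acone \<longleftrightarrow>
     prob_space M \<and> complete_measure M \<and>
     (\<forall>t\<le>T. subalgebra M (H t)) \<and>
     (\<forall>s t. s \<le> t \<and> t \<le> T \<longrightarrow> sets (H s) \<subseteq> sets (H t)) \<and>
     closed Acone \<and> convex_cone Acone"

definition emat :: "'d::finite \<Rightarrow> 'd \<Rightarrow> 'd mat" where
  "emat i j = (\<chi> k l. if k = i \<and> l = j then 1 else 0)"

definition Fclass :: "('d::finite) mat set \<Rightarrow> ('d mat \<Rightarrow> real^'d) set" where
  "Fclass Acone = {f. continuous_on UNIV f \<and>
      (\<forall>l::real. \<forall>a. l \<ge> 0 \<longrightarrow> f (l *\<^sub>R a) = l *\<^sub>R f a) \<and>
      (\<forall>l::real. \<forall>b::real. \<forall>a\<in>Acone. \<forall>a'\<in>Acone. l \<ge> 0 \<longrightarrow> b \<ge> 0 \<longrightarrow>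
          (\<forall>i. (f (l *\<^sub>R a + b *\<^sub>R a') - (l *\<^sub>R f a + b *\<^sub>R f a')) $ i \<ge> 0))}"

definition Fseq :: "'a measure \<Rightarrow> nat \<Rightarrow> ('d::finite) mat set \<Rightarrow> (nat \<Rightarrow> 'a \<Rightarrow> 'd mat \<Rightarrow> real^'d) \<Rightarrow> bool" where
  "Fseq M T Acone F \<longleftrightarrow> (\<forall>t\<le>T.
      (\<lambda>p. F t (fst p) (snd p)) \<in> borel_measurable (M \<Otimes>\<^sub>M borel) \<and>
      (AE \<omega> in M. F t \<omega> \<in> Fclass Acone))"

definition L0 :: "'a measure \<Rightarrow> 'b::topological_space set \<Rightarrow> 'a measure \<Rightarrow> ('a \<Rightarrow> 'b) set" where
  "L0 M E G = {X. X \<in> borel_measurable G \<and> (AE \<omega> in M. X \<omega> \<in> E)}"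

definition nonneg_orthant :: "(real^'d::finite) set" where
  "nonneg_orthant = {x. \<forall>i. x $ i \<ge> 0}"

definition Nset :: "'a measure \<Rightarrow> (nat \<Rightarrow> 'a measure) \<Rightarrow> ('d::finite) mat set \<Rightarrow>
    (nat \<Rightarrow> 'a \<Rightarrow> 'd mat \<Rightarrow> real^'d) \<Rightarrow> nat \<Rightarrow> ('a \<Rightarrow> real^'d) set" where
  "Nset M H Acone F t = {X. \<exists>\<eta>\<in>L0 M Acone (H t). AE \<omega> in M. X \<omega> = F t \<omega> (\<eta> \<omega>)}"

definition N0set :: "'a measure \<Rightarrow> (nat \<Rightarrow> 'a measure) \<Rightarrow> ('d::finite) mat set \<Rightarrow>
    (nat \<Rightarrow> 'a \<Rightarrow> 'd mat \<Rightarrow> real^'d) \<Rightarrow> nat \<Rightarrow> ('a \<Rightarrow> real^'d) set" where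
  "N0set M H Acone F t = {X. X \<in> Nset M H Acone F t \<and> (\<lambda>\<omega>. - X \<omega>) \<in> Nset M H Acone F t}"

definition Aset :: "'a measure \<Rightarrow> (nat \<Rightarrow> 'a measure) \<Rightarrow> nat \<Rightarrow> ('d::finite) mat set \<Rightarrow>
    (nat \<Rightarrow> 'a \<Rightarrow> 'd mat \<Rightarrow> real^'d) \<Rightarrow> nat \<Rightarrow> ('a \<Rightarrow> real^'d) set" where
  "Aset M H T Acone F t = {X. \<exists>\<xi> r. (\<forall>s\<le>T. \<xi> s \<in> Nset M H Acone F s) \<and>
      r \<in> L0 M nonneg_orthant M \<and>
      (AE \<omega> in M. X \<omega> = (\<Sum>s\<le>t. \<xi> s \<omega>) - r \<omega>)}"

definition adapted :: "'a measure \<Rightarrow> (nat \<Rightarrow> 'a measure) \<Rightarrow> nat \<Rightarrow> ('d::finite) mat set \<Rightarrow>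
    (nat \<Rightarrow> 'a \<Rightarrow> 'd mat) set" where
  "adapted M H T Acone = {\<eta>. \<forall>t\<le>T. \<eta> t \<in> L0 M Acone (H t)}"

definition HN0 where
  "HN0 M H T Acone F \<longleftrightarrow> (\<forall>t\<le>T. \<forall>\<eta>\<in>L0 M Acone (H t).
      (\<lambda>\<omega>. F t \<omega> (\<eta> \<omega>)) \<in> N0set M H Acone F t \<longrightarrow>
      (AE \<omega> in M. F t \<omega> (- \<eta> \<omega>) = - F t \<omega> (\<eta> \<omega>)) \<and> (\<lambda>\<omega>. - \<eta> \<omega>) \<in> L0 M Acone (H t))"

definition HA where
  "HA M T Acone F \<longleftrightarrow> (\<forall>t\<le>T.
      (\<forall>i j. \<forall>\<delta>\<in>{-1, 1::real}. \<delta> *\<^sub>R emat i j \<notin> Acone \<longrightarrow>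
          (AE \<omega> in M. F t \<omega> (\<delta> *\<^sub>R emat i j) = 0)) \<and>
      (\<forall>\<eta>\<in>L0 M UNIV M. AE \<omega> in M. F t \<omega> (\<eta> \<omega>) =
          (\<Sum>i\<in>UNIV. \<Sum>j\<in>UNIV. max (\<eta> \<omega> $ i $ j) 0 *\<^sub>R F t \<omega> (emat i j)
                               + max (- (\<eta> \<omega> $ i $ j)) 0 *\<^sub>R F t \<omega> (- emat i j))))"

definition Cond_I where
  "Cond_I M T F \<longleftrightarrow> (\<forall>t\<le>T. \<forall>i j.
      integrable M (\<lambda>\<omega>. F t \<omega> (emat i j)) \<and> integrable M (\<lambda>\<omega>. F t \<omega> (- emat i j)))"

definition NAw where
  "NAw M H T Acone G \<longleftrightarrow> (\<forall>X\<in>Aset M H T Acone G T.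
      X \<in> L0 M nonneg_orthant M \<longrightarrow> (AE \<omega> in M. X \<omega> = 0))"

definition NAs where
  "NAs M H T Acone F \<longleftrightarrow> (\<forall>t\<le>T. \<forall>X. X \<in> Aset M H T Acone F t \<and>
      (\<exists>Y\<in>Nset M H Acone F t. \<exists>r\<in>L0 M nonneg_orthant M. AE \<omega> in M. X \<omega> = - Y \<omega> + r \<omega>)
      \<longrightarrow> X \<in> N0set M H Acone F t)"

definition EF where
  "EF M H T Acone F \<longleftrightarrow> (\<forall>t\<le>T. \<forall>X\<in>N0set M H Acone F t. AE \<omega> in M. X \<omega> = 0)"

definition NAr where
  "NAr M H T Acone F \<longleftrightarrow> (\<exists>G. Fseq M T Acone G \<and>
      (\<forall>\<eta>\<in>adapted M H T Acone. \<forall>t\<le>T.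
         (\<forall>i. AE \<omega> in M. G t \<omega> (\<eta> t \<omega>) $ i \<ge> F t \<omega> (\<eta> t \<omega>) $ i) \<and>
         ((\<lambda>\<omega>. F t \<omega> (\<eta> t \<omega>)) \<notin> N0set M H Acone F t \<longrightarrow>
            \<P>(\<omega> in M. \<exists>k. G t \<omega> (\<eta> t \<omega>) $ k > F t \<omega> (\<eta> t \<omega>) $ k) > 0)) \<and>
      NAw M H T Acone G)"

text \<open>\<bar>F_t(\<eta>;Z) = E[Z . F_t(\<eta>) | H_t], via the decomposition under HA and (I).\<close>
definition Fbar where
  "Fbar M H F t \<eta> Z = (\<lambda>\<omega>. \<Sum>i\<in>UNIV. \<Sum>j\<in>UNIV.
      max (\<eta> \<omega> $ i $ j) 0 * real_cond_exp M (H t) (\<lambda>x. Z x \<bullet> F t x (emat i j)) \<omega>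
    + max (- (\<eta> \<omega> $ i $ j)) 0 * real_cond_exp M (H t) (\<lambda>x. Z x \<bullet> F t x (- emat i j)) \<omega>)"

definition Dset where
  "Dset M H T Acone F = {Z. Z \<in> borel_measurable M \<and> (\<exists>C. AE \<omega> in M. norm (Z \<omega>) \<le> C) \<and>
      (\<forall>i. AE \<omega> in M. Z \<omega> $ i > 0) \<and>
      (\<forall>\<eta>\<in>adapted M H T Acone. \<forall>t\<le>T.
         (AE \<omega> in M. Fbar M H F t (\<eta> t) Z \<omega> \<le> 0) \<and>
         (\<lambda>\<omega>. if Fbar M H F t (\<eta> t) Z \<omega> = 0 then F t \<omega> (\<eta> t \<omega>) else 0)
            \<in> N0set M H Acone F t)}"

text \<open>Closedness in probability (sequential closedness for convergence in probability,
  the topology of L^0 being metrizable).\<close>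
definition closed_in_prob :: "'a measure \<Rightarrow> ('a \<Rightarrow> real^'d::finite) set \<Rightarrow> bool" where
  "closed_in_prob M S \<longleftrightarrow> (\<forall>X Y. (\<forall>n. X n \<in> S) \<and> Y \<in> borel_measurable M \<and>
      (\<forall>e>0. (\<lambda>n. \<P>(\<omega> in M. dist (X n \<omega>) (Y \<omega>) > e)) \<longlonglongrightarrow> 0) \<longrightarrow> Y \<in> S)"

end

theory Submission
  imports Defs
begin

text \<open>
  Either form of no-arbitrage says that a strategy with \<open>F\<^sub>0(\<eta>\<^sub>0) + \<dots> + F\<^sub>T(\<eta>\<^sub>T) \<ge> 0\<close> can only consist of
  exchanges in \<open>N\<^sup>0\<^sub>t(F)\<close>, which by \<open>HN\<^sup>0\<close> may be undone and hence subtracted from any other strategy.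
  This gives closedness by backward induction: along a random subsequence the strategies at the first date
  either converge or, after normalization, produce such a reversible strategy, whose multiples are
  subtracted until no coordinate is left that could diverge.

  Closedness allows separation: if \<open>- F\<^sub>t(1\<^sub>B e)\<close> is not hedgeable, for a signed unit matrix \<open>e\<close>, some dual
  element \<open>Z\<close> has \<open>E[Z \<sqdot> F\<^sub>t(1\<^sub>B e)] < 0\<close>, and if it is hedgeable then \<open>F\<^sub>t(1\<^sub>B e)\<close> lies in \<open>N\<^sup>0\<^sub>t(F)\<close>. Since
  \<open>F\<^sub>t\<close> is determined by the finitely many \<open>F\<^sub>t(e)\<close>, exhaustion and a finite sum yield \<open>Z \<in> D(F)\<close>.

  Conversely, \<open>Z \<in> D(F)\<close> makes \<open>Z \<sqdot> (F\<^sub>0(\<eta>\<^sub>0) + \<dots> + F\<^sub>T(\<eta>\<^sub>T))\<close> a generalized supermartingale increment: if it is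
  nonnegative it vanishes together with all conditional prices. For \<open>NA\<^sup>r\<close> one takes linear exchange
  functions \<open>G\<^sub>t\<close> above \<open>F\<^sub>t\<close> for which all conditional prices under \<open>Z\<close> are zero.
\<close>

section \<open>Separation in \<open>L\<^sup>1\<close>\<close>

text \<open>The gains \<open>F t w (\<eta> w)\<close> need not be measurable at time
  \<open>t\<close>. In the closedness proof only the strategies may therefore select the
  subsequence, by indices known at the first trading date, and the induction runs over arbitrary
  claims hedged at the dates \<open>k..T\<close>. No-arbitrage enters it only through the pathwise
  assumption \<open>kernel\<close>. One dual element has to serve uncountably many strategies. The
  conditional price of a strategy is a combination, with nonnegative weights, of finitely many
  nonpositive prices of signed units, and it vanishes only termwise. Thus reversibility reduces to
  units, and adding dual elements never loses strictness already gained. In the converse the gains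
  are bounded below only in total, so the single terms cannot simply be integrated; weights known at
  each date make them integrable one after another. The linear dominating market exists because,
  wherever entries of both signs occur in the cone, a round trip cannot gain: F_t(e) + F_t(-e) \<le>
  0. Where only one sign occurs, the rate is constrained from one side only.\<close>

lemma norm_midpoint_gap:
  fixes p q :: "'a::real_inner"
  assumes p: "1 \<le> norm p" and q: "1 \<le> norm q"
  shows "norm ((1/2) *\<^sub>R (p + q)) \<le> (norm p + norm q) / 2 - (norm (sgn p - sgn q))\<^sup>2 / 8"
proof -
  define a b D where "a = norm p" and "b = norm q" and "D = (norm (sgn p - sgn q))\<^sup>2"
  have ab: "1 \<le> a" "1 \<le> b" using p q by (auto simp: a_def b_def)
  have "norm p \<noteq> 0" "norm q \<noteq> 0" using p q by linarith+
  then have pp: "p = a *\<^sub>R sgn p" "q = b *\<^sub>R sgn q"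
    by (simp_all add: a_def b_def sgn_div_norm)
  have n1: "norm (sgn p) = 1" "norm (sgn q) = 1" using ab by (auto simp: norm_sgn a_def b_def)
  have D: "D = 2 - 2 * (sgn p \<bullet> sgn q)"
    unfolding D_def power2_norm_eq_inner
    using n1 by (simp add: inner_diff_left inner_diff_right norm_eq_1 inner_commute)
  have Dle: "D \<le> 4"
  proof -
    have "norm (sgn p - sgn q) \<le> 2" using norm_triangle_ineq4[of "sgn p" "sgn q"] n1 by simp
    then have "(norm (sgn p - sgn q))\<^sup>2 \<le> 2\<^sup>2" by (intro power_mono) auto
    then show ?thesis by (simp add: D_def)
  qed
  have "(norm (p + q))\<^sup>2 = a\<^sup>2 + b\<^sup>2 + 2 * (p \<bullet> q)"
    unfolding power2_norm_eq_inner a_def b_def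
    by (simp add: inner_add_left inner_add_right inner_commute)
  also have "p \<bullet> q = a * b * (sgn p \<bullet> sgn q)"
    by (subst (1) pp(1), subst (1) pp(2)) simp
  finally have e: "(norm (p + q))\<^sup>2 = (a + b)\<^sup>2 - a * b * D"
    unfolding D by (simp add: power2_eq_square algebra_simps)
  \<comment> \<open>Since \<open>|p + q|^2 = (a + b)^2 - a b D\<close> is to be compared with
    \<open>(a + b - D/4)^2\<close>, it suffices that \<open>a b\<close> dominates
    \<open>(a + b)/2\<close>. This is where the norms must be at least 1: the gap does not scale
    with \<open>p\<close> and \<open>q\<close>, so the inequality fails for short vectors.\<close>
  have "0 \<le> (a - 1) * (b - 1)" using ab by simp
  then have "(a + b) / 2 \<le> a * b" using ab by (auto simp: algebra_simps)
  then have "(a + b) / 2 - D / 16 \<le> a * b" using D_def by (smt (verit) zero_le_power2 divide_nonneg_pos)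
  then have "D * ((a + b) / 2 - D / 16) \<le> D * (a * b)"
    by (intro mult_left_mono) (auto simp: D_def)
  then have "(norm (p + q))\<^sup>2 \<le> (a + b - D / 4)\<^sup>2"
    unfolding e by (simp add: power2_eq_square algebra_simps)
  moreover have "0 \<le> a + b - D / 4" using ab Dle by linarith
  ultimately have "norm (p + q) \<le> a + b - D / 4" by (rule power2_le_imp_le)
  then have "norm (p + q) / 2 \<le> (a + b) / 2 - D / 8" by (simp add: add_divide_distrib)
  then show ?thesis unfolding norm_scaleR a_def b_def D_def by simp
qed

text \<open>By Tonelli the telescoping series of increments converges absolutely almost
  everywhere.\<close>

lemma AE_convergent_of_summable_L1_increments:
  fixes s :: "nat \<Rightarrow> 'a \<Rightarrow> 'b::{banach, second_countable_topology}"
  assumes s[measurable]: "\<And>n. s n \<in> borel_measurable M"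
    and i: "\<And>n. integrable M (\<lambda>w. norm (s (Suc n) w - s n w))"
    and b: "summable (\<lambda>n. \<integral>w. norm (s (Suc n) w - s n w) \<partial>M)"
  shows "AE w in M. convergent (\<lambda>n. s n w)"
proof -
  let ?D = "\<lambda>n w. norm (s (Suc n) w - s n w)"
  have "(\<integral>\<^sup>+ w. (\<Sum>n. ennreal (?D n w)) \<partial>M) = (\<Sum>n. \<integral>\<^sup>+ w. ennreal (?D n w) \<partial>M)"
    by (rule nn_integral_suminf) auto
  also have "\<dots> = (\<Sum>n. ennreal (\<integral>w. ?D n w \<partial>M))"
    by (subst nn_integral_eq_integral[OF i]) auto
  also have "\<dots> \<noteq> \<infinity>" using b by (subst suminf_ennreal_eq[OF _ summable_sums]) auto
  finally have "AE w in M. (\<Sum>n. ennreal (?D n w)) \<noteq> \<infinity>"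
    by (intro nn_integral_noteq_infinite) auto
  then show ?thesis
  proof eventually_elim
    case (elim w)
    then have "summable (\<lambda>n. ?D n w)" by (intro summable_suminf_not_top) auto
    then have "summable (\<lambda>n. s (Suc n) w - s n w)" by (rule summable_norm_cancel)
    then have "convergent (\<lambda>n. \<Sum>k<n. s (Suc k) w - s k w)" by (simp add: summable_iff_convergent)
    then have "convergent (\<lambda>n. s n w - s 0 w)"
      by (simp add: sum_lessThan_telescope[of "\<lambda>n. s n w"])
    then have "convergent (\<lambda>n. (s n w - s 0 w) + s 0 w)"
      by (intro convergent_add convergent_const)
    then show ?case by simp
  qed
qed

text \<open>The members are functions, not classes, and may be non-integrable. A constant sequence
  in the last clause makes membership invariant under almost sure equality.\<close>

definition closed_cone :: "'a measure \<Rightarrow> ('a \<Rightarrow> 'b::real_normed_vector) set \<Rightarrow> bool" where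
  "closed_cone M A \<longleftrightarrow> (\<lambda>_. 0) \<in> A \<and>
     (\<forall>X\<in>A. \<forall>X'\<in>A. \<forall>a\<ge>0. \<forall>b\<ge>0. (\<lambda>w. a *\<^sub>R X w + b *\<^sub>R X' w) \<in> A) \<and>
     (\<forall>Xn X. (\<forall>n::nat. Xn n \<in> A) \<longrightarrow> (AE w in M. (\<lambda>n. Xn n w) \<longlonglongrightarrow> X w) \<longrightarrow> X \<in> A)"

text \<open>A substitute for Hahn-Banach separation in \<open>L\<^sup>1\<close>: the functional \<open>X \<mapsto> E \<bar>(1, Y - X)\<bar>\<close> attains its minimum
  on the cone, because by the midpoint gap the normalized vectors \<open>(1, Y - X\<^sub>n)\<close> of a fast minimizing
  sequence converge almost surely. Its gradient at the minimizer is bounded by \<open>1\<close> and separates.\<close>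

lemma (in prob_space) L1_separation:
  fixes A :: "('a \<Rightarrow> 'b::euclidean_space) set" and Y :: "'a \<Rightarrow> 'b"
  assumes A: "closed_cone M A"
    and Y[measurable]: "integrable M Y" and YA: "Y \<notin> A"
  shows "\<exists>Z\<in>borel_measurable M. (\<forall>w. norm (Z w) \<le> 1) \<and>
           (\<forall>X\<in>A. integrable M X \<longrightarrow> (\<integral>w. Z w \<bullet> X w \<partial>M) \<le> 0) \<and> 0 < (\<integral>w. Z w \<bullet> Y w \<partial>M)"
proof -
  have zero: "(\<lambda>_. 0) \<in> A" using A by (simp add: closed_cone_def)
  have comb: "(\<lambda>w. a *\<^sub>R X w + b *\<^sub>R X' w) \<in> A" if "X \<in> A" "X' \<in> A" "0 \<le> a" "0 \<le> b" for X X' a b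
    using A that by (simp add: closed_cone_def)
  have lim: "X \<in> A" if "\<And>n::nat. Xn n \<in> A" "AE w in M. (\<lambda>n. Xn n w) \<longlonglongrightarrow> X w" for Xn X
    using A that unfolding closed_cone_def by blast
  have [measurable]: "Y \<in> borel_measurable M" using Y by auto
  \<comment> \<open>The extra coordinate 1 turns \<open>sq x\<close> into sqrt(1 + |x|^2), which is
    smooth and convex with bounded gradient, and keeps \<open>(1, x)\<close> of norm at least 1, as
    the midpoint gap requires.\<close>
  define sq where "sq = (\<lambda>x::'b. norm (1::real, x))"
  have sq_ge1: "1 \<le> sq x" for x by (simp add: sq_def norm_Pair)
  have sq_pos[simp]: "0 < sq x" for x using sq_ge1[of x] by linarith
  have sq_le: "sq x \<le> 1 + norm x" for x unfolding sq_def
    using norm_Pair_le[of "1::real" x] by simp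
  have norm_le_sq: "norm x \<le> sq x" for x
    unfolding sq_def norm_Pair by (rule real_le_rsqrt) simp
  have sq_cont: "continuous_on UNIV sq" unfolding sq_def by (intro continuous_intros)
  have sq_meas[measurable]: "sq \<in> borel_measurable borel" by (rule borel_measurable_continuous_onI[OF sq_cont])
  have sq_int: "integrable M (\<lambda>w. sq (X w))" if X: "integrable M X" for X
  proof (rule Bochner_Integration.integrable_bound[of M "\<lambda>w. 1 + norm (X w)"])
    show "integrable M (\<lambda>w. 1 + norm (X w))" using X by simp
    show "(\<lambda>w. sq (X w)) \<in> borel_measurable M" using borel_measurable_integrable[OF X] by simp
    show "AE w in M. norm (sq (X w)) \<le> norm (1 + norm (X w))"
      using sq_le sq_pos by (intro AE_I2) (metis add_nonneg_nonneg norm_ge_zero norm_of_real of_real_eq_id id_apply abs_of_nonneg less_eq_real_def real_norm_def zero_le_one)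
  qed
  define J where "J = (\<lambda>X. \<integral>w. sq (Y w - X w) \<partial>M)"
  define S where "S = J ` {X\<in>A. integrable M X}"
  define c where "c = Inf S"
  have S_ne: "S \<noteq> {}" using zero by (auto simp: S_def)
  have S_bdd: "bdd_below S"
    unfolding S_def J_def by (intro bdd_belowI[of _ 0]) (auto intro!: Bochner_Integration.integral_nonneg simp: less_imp_le)
  have c_le: "c \<le> J X" if "X \<in> A" "integrable M X" for X
    unfolding c_def by (rule cInf_lower[OF _ S_bdd]) (use that in \<open>auto simp: S_def\<close>)
  \<comment> \<open>Accuracy \<open>(1/4)^n\<close> bounds the mean squared increments of the
    normalized vectors by a multiple of \<open>(1/4)^n\<close>, hence the mean increments by a
    multiple of \<open>(1/2)^n\<close>, which is summable.\<close>
  have "\<exists>X. X \<in> A \<and> integrable M X \<and> J X < c + (1/4)^n" for n :: nat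
  proof -
    have "Inf S < c + (1/4)^n" by (simp add: c_def)
    then obtain s where "s \<in> S" "s < c + (1/4)^n" using cInf_lessD[OF S_ne] by blast
    then show ?thesis by (auto simp: S_def)
  qed
  then obtain Xn where Xn: "\<And>n. Xn n \<in> A" "\<And>n. integrable M (Xn n)" "\<And>n. J (Xn n) < c + (1/4)^n"
    by metis
  have [measurable]: "Xn n \<in> borel_measurable M" for n using Xn(2)[of n] by auto
  define P where "P = (\<lambda>n w. (1::real, Y w - Xn n w))"
  have P_meas[measurable]: "P n \<in> borel_measurable M" for n unfolding P_def by simp
  have nP: "norm (P n w) = sq (Y w - Xn n w)" for n w by (simp add: P_def sq_def)
  have P_int: "integrable M (\<lambda>w. norm (P n w))" for n
    unfolding nP by (rule sq_int) (use Y Xn(2) in auto)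
  have P_J: "(\<integral>w. norm (P n w) \<partial>M) = J (Xn n)" for n by (simp add: nP J_def)
  have sgn_meas[measurable]: "(\<lambda>w. sgn (P n w)) \<in> borel_measurable M" for n
    unfolding sgn_div_norm by measurable
  define D where "D = (\<lambda>n w. norm (sgn (P (Suc n) w) - sgn (P n w)))"
  have D_meas[measurable]: "D n \<in> borel_measurable M" for n unfolding D_def by simp
  have nsgn: "norm (sgn (P n w)) = 1" for n w by (simp add: norm_sgn P_def zero_prod_def)
  have D_bd: "\<bar>D n w\<bar> \<le> 2" for n w unfolding D_def
    using norm_triangle_ineq4[of "sgn (P (Suc n) w)" "sgn (P n w)"] nsgn by simp
  have D_int: "integrable M (D n)" for n
    by (rule integrable_const_bound[of _ 2]) (use D_bd in auto)
  have D2_int: "integrable M (\<lambda>w. (D n w)\<^sup>2)" for n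
  proof (rule integrable_const_bound[of _ 4])
    have "(D n w)\<^sup>2 \<le> 4" for w using abs_le_square_iff[of "D n w" 2] D_bd[of n w] by simp
    then show "AE w in M. norm ((D n w)\<^sup>2) \<le> 4" by simp
  qed simp
  have D2_le: "(\<integral>w. (D n w)\<^sup>2 \<partial>M) \<le> 8 * (1/4)^n" for n
  proof -
    \<comment> \<open>The midpoint of two members stays in the cone, so its value is at least
      \<open>c\<close>; the gap in the midpoint inequality cannot exceed the error of the two
      approximations.\<close>
    define Xm where "Xm = (\<lambda>w. (1/2) *\<^sub>R Xn (Suc n) w + (1/2) *\<^sub>R Xn n w)"
    have XmA: "Xm \<in> A" unfolding Xm_def by (intro comb Xn) auto
    have Xmi: "integrable M Xm" unfolding Xm_def using Xn by auto
    have mid: "norm ((1/2) *\<^sub>R (P (Suc n) w + P n w)) = sq (Y w - Xm w)" for w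
    proof -
      have "(1/2) *\<^sub>R (P (Suc n) w + P n w) = (1, Y w - Xm w)"
        unfolding P_def Xm_def
        by (auto simp: algebra_simps scaleR_add_left[symmetric] simp flip: scaleR_left_distrib)
      then show ?thesis by (simp add: sq_def)
    qed
    have "(D n w)\<^sup>2 / 8 \<le> (norm (P (Suc n) w) + norm (P n w)) / 2 - sq (Y w - Xm w)" for w
      using norm_midpoint_gap[of "P (Suc n) w" "P n w"] sq_ge1[of "Y w - Xn (Suc n) w"] sq_ge1[of "Y w - Xn n w"] unfolding mid D_def nP by linarith
    then have "(\<integral>w. (D n w)\<^sup>2 / 8 \<partial>M) \<le> (\<integral>w. (norm (P (Suc n) w) + norm (P n w)) / 2 - sq (Y w - Xm w) \<partial>M)"
      using D2_int P_int Xmi Y by (intro integral_mono) (auto intro!: sq_int Bochner_Integration.integrable_diff)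
    also have "\<dots> = (\<integral>w. (norm (P (Suc n) w) + norm (P n w)) / 2 \<partial>M) - (\<integral>w. sq (Y w - Xm w) \<partial>M)"
      using P_int Xmi Y by (intro Bochner_Integration.integral_diff) (auto intro!: sq_int)
    also have "\<dots> = (J (Xn (Suc n)) + J (Xn n)) / 2 - J Xm"
      using P_int by (simp add: P_J fun_cong[OF J_def, of Xm])
    also have "\<dots> \<le> (1/4)^n"
    proof -
      have "(1/4::real)^(Suc n) \<le> (1/4)^n" by simp
      moreover have "(J (Xn (Suc n)) + J (Xn n)) / 2 - J Xm = (1/2) * J (Xn (Suc n)) + (1/2) * J (Xn n) - J Xm" by simp
      ultimately show ?thesis using Xn(3)[of n] Xn(3)[of "Suc n"] c_le[OF XmA Xmi] by linarith
    qed
    finally show ?thesis by simp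
  qed
  have D1_le: "(\<integral>w. D n w \<partial>M) \<le> 5 * (1/2)^n" for n
  proof -
    \<comment> \<open>Young's inequality with weight \<open>2^n\<close>, chosen so that both terms
      are of order \<open>(1/2)^n\<close> after integration; their constants add up to
      \<open>(8 + 1) / 2\<close>.\<close>
    have "D n w \<le> (2^n * (D n w)\<^sup>2 + (1/2)^n) / 2" for w
    proof -
      have "0 \<le> (2^n * D n w - 1)\<^sup>2" by simp
      then have "2 * 2^n * D n w \<le> 2^n * 2^n * (D n w)\<^sup>2 + 1" by (simp add: power2_eq_square algebra_simps)
      then have "(1/2)^n * (2 * 2^n * D n w) \<le> (1/2)^n * (2^n * 2^n * (D n w)\<^sup>2 + 1)"
        by (intro mult_left_mono) auto
      then show ?thesis by (simp add: algebra_simps power_divide)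
    qed
    then have "(\<integral>w. D n w \<partial>M) \<le> (\<integral>w. (2^n * (D n w)\<^sup>2 + (1/2)^n) / 2 \<partial>M)"
      using D_int D2_int by (intro integral_mono) auto
    also have "\<dots> = (2^n * (\<integral>w. (D n w)\<^sup>2 \<partial>M) + (1/2)^n) / 2"
      using D2_int by (simp add: prob_space)
    also have "\<dots> \<le> (2^n * (8 * (1/4)^n) + (1/2)^n) / 2" using D2_le by simp
    also have "\<dots> = 9/2 * (1/2)^n"
    proof -
      have "(2::real)^n * (1/4)^n = (1/2)^n" by (simp flip: power_mult_distrib)
      then show ?thesis by (simp add: algebra_simps)
    qed
    also have "\<dots> \<le> 5 * (1/2)^n" by simp
    finally show ?thesis .
  qed
  have "AE w in M. convergent (\<lambda>n. sgn (P n w))"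
  proof (rule AE_convergent_of_summable_L1_increments)
    show "summable (\<lambda>n. \<integral>w. norm (sgn (P (Suc n) w) - sgn (P n w)) \<partial>M)"
    proof (rule summable_comparison_test)
      show "summable (\<lambda>n. 5 * (1/2)^n :: real)" by (intro summable_mult summable_geometric) auto
      show "\<exists>N. \<forall>n\<ge>N. norm (\<integral>w. norm (sgn (P (Suc n) w) - sgn (P n w)) \<partial>M) \<le> 5 * (1/2)^n"
        using D1_le by (auto simp: D_def)
    qed
  qed (use D_int in \<open>auto simp: D_def\<close>)
  moreover define L where "L = (\<lambda>w. lim (\<lambda>n. sgn (P n w)))"
  ultimately have L: "AE w in M. (\<lambda>n. sgn (P n w)) \<longlonglongrightarrow> L w"
    by (auto simp: convergent_LIMSEQ_iff)
  have [measurable]: "L \<in> borel_measurable M" unfolding L_def by (rule borel_measurable_lim_metric) simp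
  \<comment> \<open>The first coordinate of \<open>sgn (P n w)\<close> is
    \<open>1 / norm (P n w)\<close>, the second is \<open>Y w - Xn n w\<close> over the same norm.
    The quotient of their limits is the limit of \<open>Y w - Xn n w\<close>, provided the norms do
    not blow up.\<close>
  define W where "W = (\<lambda>w. snd (L w) /\<^sub>R fst (L w))"
  have [measurable]: "(\<lambda>w. fst (L w)) \<in> borel_measurable M" "(\<lambda>w. snd (L w)) \<in> borel_measurable M"
    by (auto intro!: borel_measurable_continuous_on[OF _ \<open>L \<in> borel_measurable M\<close>] continuous_intros)
  have [measurable]: "W \<in> borel_measurable M" unfolding W_def by measurable
  have J_lim: "(\<lambda>n. J (Xn n)) \<longlonglongrightarrow> c"
  proof (rule tendsto_sandwich[of "\<lambda>_. c" _ _ "\<lambda>n. c + (1/4)^n"])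
    show "(\<lambda>n. c + (1/4)^n) \<longlonglongrightarrow> c"
      using tendsto_add[OF tendsto_const LIMSEQ_realpow_zero[of "1/4"], of c] by simp
  qed (use c_le Xn in \<open>auto intro!: always_eventually less_imp_le\<close>)
  have fatou: "(\<integral>\<^sup>+w. liminf (\<lambda>n. ennreal (norm (P n w))) \<partial>M) \<le> ennreal c"
  proof -
    have "(\<integral>\<^sup>+w. liminf (\<lambda>n. ennreal (norm (P n w))) \<partial>M) \<le> liminf (\<lambda>n. \<integral>\<^sup>+w. ennreal (norm (P n w)) \<partial>M)"
      by (rule nn_integral_liminf) simp
    also have "(\<lambda>n. \<integral>\<^sup>+w. ennreal (norm (P n w)) \<partial>M) = (\<lambda>n. ennreal (J (Xn n)))"
      using P_int by (subst nn_integral_eq_integral) (auto simp: P_J)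
    also have "liminf \<dots> = ennreal c"
      using J_lim by (intro lim_imp_Liminf tendsto_ennrealI) auto
    finally show ?thesis .
  qed
  then have "AE w in M. liminf (\<lambda>n. ennreal (norm (P n w))) \<noteq> \<infinity>"
    by (intro nn_integral_noteq_infinite) (auto simp: top_unique)
  with L have conv: "AE w in M. (\<lambda>n. norm (P n w)) \<longlonglongrightarrow> sq (W w) \<and> (\<lambda>n. Xn n w) \<longlonglongrightarrow> Y w - W w"
  proof eventually_elim
    case (elim w)
    have f: "fst (sgn (P n w)) = inverse (norm (P n w))" for n
      by (simp add: sgn_div_norm P_def)
    have s: "norm (P n w) *\<^sub>R snd (sgn (P n w)) = Y w - Xn n w" for n
      using less_imp_neq[OF sq_pos[of "Y w - Xn n w"]] unfolding sgn_div_norm nP by (simp add: P_def)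
    have lf: "(\<lambda>n. inverse (norm (P n w))) \<longlonglongrightarrow> fst (L w)"
      using tendsto_fst[OF elim(1)] by (simp add: f)
    \<comment> \<open>A vanishing first coordinate would force the norms to infinity at
      \<open>w\<close>; Fatou's lemma has excluded this almost surely, because the minimizing values
      converge to the finite \<open>c\<close>.\<close>
    have ne: "fst (L w) \<noteq> 0"
    proof
      assume "fst (L w) = 0"
      then have "filterlim (\<lambda>n. inverse (inverse (norm (P n w)))) at_top sequentially"
        using lf sq_pos by (intro filterlim_inverse_at_top) (auto simp: nP)
      then have "(\<lambda>n. ennreal (norm (P n w))) \<longlonglongrightarrow> \<infinity>"
        by (simp add: ennreal_tendsto_top_eq_at_top infinity_ennreal_def)
      then have "liminf (\<lambda>n. ennreal (norm (P n w))) = \<infinity>" by (intro lim_imp_Liminf) auto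
      with elim(2) show False by simp
    qed
    have ln: "(\<lambda>n. norm (P n w)) \<longlonglongrightarrow> inverse (fst (L w))"
      using tendsto_inverse[OF lf ne] by simp
    have lW: "(\<lambda>n. Y w - Xn n w) \<longlonglongrightarrow> W w"
      using tendsto_scaleR[OF ln tendsto_snd[OF elim(1)]] by (simp add: s W_def)
    have "(\<lambda>n. Y w - (Y w - Xn n w)) \<longlonglongrightarrow> Y w - W w"
      by (intro tendsto_diff tendsto_const lW)
    moreover have "(\<lambda>n. sq (Y w - Xn n w)) \<longlonglongrightarrow> sq (W w)"
      unfolding sq_def by (intro tendsto_intros lW)
    ultimately show ?case by (simp add: nP)
  qed
  have sqW: "(\<integral>\<^sup>+w. ennreal (sq (W w)) \<partial>M) \<le> ennreal c"
  proof -
    have "(\<integral>\<^sup>+w. ennreal (sq (W w)) \<partial>M) = (\<integral>\<^sup>+w. liminf (\<lambda>n. ennreal (norm (P n w))) \<partial>M)"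
      using conv by (intro nn_integral_cong_AE)
        (auto elim!: eventually_mono intro!: lim_imp_Liminf[symmetric] tendsto_ennrealI)
    with fatou show ?thesis by simp
  qed
  have c0: "0 \<le> c" unfolding c_def
    using S_ne by (intro cInf_greatest) (auto simp: S_def J_def less_imp_le intro!: Bochner_Integration.integral_nonneg)
  have iW1: "integrable M (\<lambda>w. sq (W w))"
  proof (rule integrableI_bounded)
    have "(\<integral>\<^sup>+w. ennreal (norm (sq (W w))) \<partial>M) \<le> ennreal c" using sqW by (simp add: less_imp_le)
    then show "(\<integral>\<^sup>+w. ennreal (norm (sq (W w))) \<partial>M) < \<infinity>" by (rule le_less_trans) simp
  qed simp
  have iW: "integrable M W"
    by (rule Bochner_Integration.integrable_bound[OF iW1])
       (use norm_le_sq sq_pos in \<open>auto simp: less_imp_le\<close>)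
  have JW: "(\<integral>w. sq (W w) \<partial>M) \<le> c"
    using sqW c0 sq_pos by (subst (asm) nn_integral_eq_integral[OF iW1]) (auto simp: less_imp_le)
  define X0 where "X0 = (\<lambda>w. Y w - W w)"
  have X0A: "X0 \<in> A"
  proof (rule lim[of Xn])
    show "AE w in M. (\<lambda>n. Xn n w) \<longlonglongrightarrow> X0 w" using conv by eventually_elim (simp add: X0_def)
  qed (rule Xn)
  have X0i: "integrable M X0" unfolding X0_def using Y iW by simp
  define \<psi> where "\<psi> = (\<lambda>x::'b. x /\<^sub>R sq x)"
  have \<psi>_cont: "continuous_on UNIV \<psi>" unfolding \<psi>_def
    using sq_pos by (intro continuous_intros sq_cont) (metis less_irrefl)
  have [measurable]: "\<psi> \<in> borel_measurable borel" by (rule borel_measurable_continuous_onI[OF \<psi>_cont])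
  have \<psi>_le: "norm (\<psi> x) \<le> 1" for x
    using norm_le_sq[of x] sq_pos[of x] by (simp add: \<psi>_def abs_of_pos divide_inverse_commute[symmetric] divide_le_eq_1)
  \<comment> \<open>Convexity of \<open>sq\<close> with gradient \<open>\<psi>\<close>, read off
    from Cauchy-Schwarz for \<open>(1, b)\<close> and \<open>(1, a)\<close>.\<close>
  have tangent: "sq b + \<psi> b \<bullet> (a - b) \<le> sq a" for a b
  proof -
    have "1 + b \<bullet> a \<le> sq b * sq a"
      using norm_cauchy_schwarz[of "(1::real, b)" "(1::real, a)"] by (simp add: sq_def)
    moreover have "sq b * sq b = 1 + b \<bullet> b"
      by (simp add: sq_def norm_Pair power2_norm_eq_inner[symmetric])
    ultimately have "sq b * sq b + b \<bullet> (a - b) \<le> sq b * sq a" by (simp add: inner_diff_right)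
    then have "(sq b * sq b + b \<bullet> (a - b)) / sq b \<le> sq a" using sq_pos[of b] by (simp add: field_simps)
    moreover have "(sq b * sq b + b \<bullet> (a - b)) / sq b = sq b + \<psi> b \<bullet> (a - b)"
      using less_imp_neq[OF sq_pos[of b]] by (simp add: \<psi>_def field_simps)
    ultimately show ?thesis by simp
  qed
  have bdd_int: "integrable M (\<lambda>w. \<psi> (V w) \<bullet> X w)" if "V \<in> borel_measurable M" "integrable M X" for V X
  proof (rule Bochner_Integration.integrable_bound[OF integrable_norm[OF that(2)]])
    show "(\<lambda>w. \<psi> (V w) \<bullet> X w) \<in> borel_measurable M" using that by measurable
    show "AE w in M. norm (\<psi> (V w) \<bullet> X w) \<le> norm (norm (X w))"
      using \<psi>_le by (intro AE_I2) (auto intro!: order_trans[OF Cauchy_Schwarz_ineq2] mult_left_le_one_le)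
  qed
  \<comment> \<open>One-sided first-order condition at the minimizer. Taking the tangent at the
    shifted point \<open>V n\<close> gives the sign for every \<open>n\<close>; since the gradient
    is bounded by 1, dominated convergence carries it to the limit.\<close>
  have foc: "(\<integral>w. \<psi> (W w) \<bullet> X w \<partial>M) \<le> 0"
    if X: "integrable M X" and XA: "\<And>n::nat. (\<lambda>w. X0 w + (1 / real (Suc n)) *\<^sub>R X w) \<in> A" for X
  proof -
    have [measurable]: "X \<in> borel_measurable M" using X by auto
    define V where "V = (\<lambda>n w. W w - (1 / real (Suc n)) *\<^sub>R X w)"
    have Vi: "integrable M (V n)" for n unfolding V_def using X iW by auto
    have [measurable]: "V n \<in> borel_measurable M" for n using Vi[of n] by auto
    have le: "(\<integral>w. \<psi> (V n w) \<bullet> X w \<partial>M) \<le> 0" for n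
    proof -
      let ?e = "1 / real (Suc n)"
      have "c \<le> J (\<lambda>w. X0 w + ?e *\<^sub>R X w)" using X X0i by (intro c_le XA) auto
      also have "\<dots> = (\<integral>w. sq (V n w) \<partial>M)" by (simp add: J_def X0_def V_def algebra_simps)
      finally have "c \<le> (\<integral>w. sq (V n w) \<partial>M)" .
      moreover have "(\<integral>w. sq (V n w) + ?e * (\<psi> (V n w) \<bullet> X w) \<partial>M) \<le> (\<integral>w. sq (W w) \<partial>M)"
      proof (rule integral_mono)
        show "sq (V n w) + ?e * (\<psi> (V n w) \<bullet> X w) \<le> sq (W w)" for w
          using tangent[of "V n w" "W w"] by (simp add: V_def)
      qed (auto intro!: Bochner_Integration.integrable_add sq_int Vi bdd_int X iW1 integrable_mult_right)
      moreover have "(\<integral>w. sq (V n w) + ?e * (\<psi> (V n w) \<bullet> X w) \<partial>M) = (\<integral>w. sq (V n w) \<partial>M) + ?e * (\<integral>w. \<psi> (V n w) \<bullet> X w \<partial>M)"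
        using sq_int[OF Vi, of n] bdd_int[of "V n" X] X by (subst Bochner_Integration.integral_add) auto
      ultimately have "?e * (\<integral>w. \<psi> (V n w) \<bullet> X w \<partial>M) \<le> 0" using JW by linarith
      then show ?thesis by (simp add: mult_le_0_iff divide_le_0_iff)
    qed
    have "(\<lambda>n. \<integral>w. \<psi> (V n w) \<bullet> X w \<partial>M) \<longlonglongrightarrow> (\<integral>w. \<psi> (W w) \<bullet> X w \<partial>M)"
    proof (rule integral_dominated_convergence[where w = "\<lambda>w. norm (X w)"])
      show "AE w in M. (\<lambda>n. \<psi> (V n w) \<bullet> X w) \<longlonglongrightarrow> \<psi> (W w) \<bullet> X w"
      proof (intro AE_I2 tendsto_inner tendsto_const)
        fix w
        have "(\<lambda>n. W w - (1 / real (Suc n)) *\<^sub>R X w) \<longlonglongrightarrow> W w - 0 *\<^sub>R X w"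
          by (intro tendsto_intros LIMSEQ_Suc[OF lim_1_over_n])
        then show "(\<lambda>n. \<psi> (V n w)) \<longlonglongrightarrow> \<psi> (W w)"
          using \<psi>_cont by (auto simp: V_def intro!: continuous_on_tendsto_compose[OF \<psi>_cont])
      qed
      show "\<And>n. AE w in M. norm (\<psi> (V n w) \<bullet> X w) \<le> norm (X w)"
        using \<psi>_le by (intro AE_I2) (auto intro!: order_trans[OF Cauchy_Schwarz_ineq2] mult_left_le_one_le)
    qed (use X in auto)
    then show ?thesis by (rule LIMSEQ_le_const2) (use le in auto)
  qed
  define Z where "Z = (\<lambda>w. \<psi> (W w))"
  have 1: "(\<integral>w. Z w \<bullet> X w \<partial>M) \<le> 0" if "X \<in> A" "integrable M X" for X
    unfolding Z_def using comb[OF X0A that(1), of 1] by (intro foc that) auto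
  \<comment> \<open>In a cone \<open>X0\<close> may also be shrunk, so the functional is nonnegative
    at \<open>X0\<close>. Its strictly positive value at \<open>Y = X0 + W\<close> comes from
    \<open>W\<close>, which cannot vanish almost surely as \<open>Y\<close> is outside the
    cone.\<close>
  have "(\<integral>w. \<psi> (W w) \<bullet> (- X0 w) \<partial>M) \<le> 0"
  proof (rule foc)
    show "(\<lambda>w. X0 w + (1 / real (Suc n)) *\<^sub>R - X0 w) \<in> A" for n
      using comb[OF X0A X0A, of "1 - 1 / real (Suc n)" 0] by (simp add: algebra_simps)
  qed (use X0i in auto)
  then have 2: "0 \<le> (\<integral>w. Z w \<bullet> X0 w \<partial>M)" by (simp add: Z_def)
  have WZ: "Z w \<bullet> W w = (W w \<bullet> W w) / sq (W w)" for w
    by (simp add: Z_def \<psi>_def divide_inverse_commute)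
  have WZ_nn: "0 \<le> Z w \<bullet> W w" for w using less_imp_le[OF sq_pos[of "W w"]] by (simp add: WZ)
  have iWZ: "integrable M (\<lambda>w. Z w \<bullet> W w)" unfolding Z_def by (rule bdd_int) (auto simp: iW)
  have "(\<integral>w. Z w \<bullet> W w \<partial>M) \<noteq> 0"
  proof
    assume "(\<integral>w. Z w \<bullet> W w \<partial>M) = 0"
    then have "AE w in M. Z w \<bullet> W w = 0"
      using integral_nonneg_eq_0_iff_AE[OF iWZ] WZ_nn by auto
    then have "AE w in M. X0 w = Y w"
    proof eventually_elim
      case (elim w)
      then show ?case using sq_pos[of "W w"] by (simp add: WZ X0_def)
    qed
    then have "AE w in M. (\<lambda>n::nat. X0 w) \<longlonglongrightarrow> Y w" by eventually_elim simp
    then have "Y \<in> A" by (rule lim[OF X0A])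
    with YA show False by simp
  qed
  then have 3: "0 < (\<integral>w. Z w \<bullet> W w \<partial>M)" using Bochner_Integration.integral_nonneg[of M "\<lambda>w. Z w \<bullet> W w", OF WZ_nn] by linarith
  have "(\<integral>w. Z w \<bullet> Y w \<partial>M) = (\<integral>w. Z w \<bullet> X0 w + Z w \<bullet> W w \<partial>M)"
    by (simp add: X0_def inner_diff_right)
  also have "\<dots> = (\<integral>w. Z w \<bullet> X0 w \<partial>M) + (\<integral>w. Z w \<bullet> W w \<partial>M)"
    by (rule Bochner_Integration.integral_add[OF _ iWZ]) (unfold Z_def, rule bdd_int[OF _ X0i], measurable)
  finally have "0 < (\<integral>w. Z w \<bullet> Y w \<partial>M)" using 2 3 by linarith
  moreover have "norm (Z w) \<le> 1" for w unfolding Z_def by (rule \<psi>_le)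
  moreover have "Z \<in> borel_measurable M" unfolding Z_def by measurable
  ultimately show ?thesis using 1 by blast
qed

section \<open>Random subsequences\<close>

lemma measurable_random_index:
  fixes \<tau> :: "'a \<Rightarrow> nat"
  assumes "\<And>n. f n \<in> borel_measurable G" "\<tau> \<in> measurable G (count_space UNIV)"
  shows "(\<lambda>w. f (\<tau> w) w) \<in> borel_measurable G"
  by (rule measurable_compose_countable[of f, OF assms])

text \<open>\<open>\<tau> m\<close> is the least \<open>n \<ge> m\<close> at which the sequence is
  within \<open>1 / (m + 1)\<close> of its liminf; a least index with a measurable property is
  measurable. The indices may fail to increase, but \<open>m \<le> \<tau> m w\<close> makes them
  tend to infinity.\<close>

lemma random_subseq_to_liminf:
  fixes x :: "nat \<Rightarrow> 'a \<Rightarrow> real"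
  assumes x[measurable]: "\<And>n. x n \<in> borel_measurable G"
    and fin: "\<And>w. w \<in> space G \<Longrightarrow> \<bar>liminf (\<lambda>n. ereal (x n w))\<bar> \<noteq> \<infinity>"
  shows "\<exists>\<tau>::nat \<Rightarrow> 'a \<Rightarrow> nat. (\<forall>m. \<tau> m \<in> measurable G (count_space UNIV)) \<and>
    (\<forall>w\<in>space G. (\<forall>m. m \<le> \<tau> m w) \<and> convergent (\<lambda>m. x (\<tau> m w) w))"
proof -
  define z where "z = (\<lambda>w. real_of_ereal (liminf (\<lambda>n. ereal (x n w))))"
  have [measurable]: "z \<in> borel_measurable G" unfolding z_def by measurable
  define P where "P = (\<lambda>m n w. m \<le> n \<and> \<bar>x n w - z w\<bar> < 1 / real (Suc m))"
  have [measurable]: "Measurable.pred G (P m n)" for m n unfolding P_def by measurable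
  define \<tau> where "\<tau> = (\<lambda>m w. LEAST n. P m n w)"
  have \<tau>_meas: "\<tau> m \<in> measurable G (count_space UNIV)" for m
    unfolding \<tau>_def by measurable
  have ex: "\<exists>n. P m n w" if w: "w \<in> space G" for m w
  proof -
    obtain r where r: "strict_mono r" and lim: "((\<lambda>n. ereal (x n w)) \<circ> r) \<longlonglongrightarrow> liminf (\<lambda>n. ereal (x n w))"
      using liminf_subseq_lim[of "\<lambda>n. ereal (x n w)"] by auto
    have "(\<lambda>k. ereal (x (r k) w)) \<longlonglongrightarrow> ereal (z w)"
      using lim fin[OF w] by (simp add: z_def ereal_real comp_def)
    then have "(\<lambda>k. x (r k) w) \<longlonglongrightarrow> z w" by simp
    then have "\<forall>\<^sub>F k in sequentially. dist (x (r k) w) (z w) < 1 / real (Suc m)"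
      by (rule tendstoD) simp
    then have "\<forall>\<^sub>F k in sequentially. P m (r k) w"
      using eventually_ge_at_top[of m]
    proof eventually_elim
      case (elim k)
      then show ?case using seq_suble[OF r, of k] by (simp add: P_def dist_real_def)
    qed
    then show ?thesis by (meson eventually_happens' sequentially_bot)
  qed
  have \<tau>P: "P m (\<tau> m w) w" if "w \<in> space G" for m w
    unfolding \<tau>_def using ex[OF that] by (rule LeastI_ex)
  have "(\<lambda>m. x (\<tau> m w) w) \<longlonglongrightarrow> z w" if "w \<in> space G" for w
  proof (rule LIM_zero_cancel, rule Lim_null_comparison)
    show "\<forall>\<^sub>F m in sequentially. norm (x (\<tau> m w) w - z w) \<le> 1 / real (Suc m)"
      using \<tau>P[OF that] by (auto simp: P_def less_imp_le intro!: always_eventually)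
    show "(\<lambda>m. 1 / real (Suc m)) \<longlonglongrightarrow> 0" by (rule LIMSEQ_Suc[OF lim_1_over_n])
  qed
  then show ?thesis using \<tau>_meas \<tau>P by (intro exI[of _ \<tau>]) (auto simp: P_def convergent_def)
qed

lemma liminf_ereal_finite_of_bounded:
  fixes y :: "nat \<Rightarrow> real"
  assumes "\<And>n. \<bar>y n\<bar> \<le> K"
  shows "\<bar>liminf (\<lambda>n. ereal (y n))\<bar> \<noteq> \<infinity>"
proof -
  have "ereal (- K) \<le> liminf (\<lambda>n. ereal (y n))"
    using assms by (intro Liminf_bounded always_eventually) (auto simp: abs_le_iff minus_le_iff)
  moreover have "liminf (\<lambda>n. ereal (y n)) \<le> ereal K"
  proof -
    have "liminf (\<lambda>n. ereal (y n)) \<le> limsup (\<lambda>n. ereal (y n))" by (rule Liminf_le_Limsup) simp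
    also have "\<dots> \<le> ereal K"
      using assms by (intro Limsup_bounded always_eventually) (auto simp: abs_le_iff)
    finally show ?thesis .
  qed
  ultimately show ?thesis by auto
qed

text \<open>Not escaping to infinity means that the liminf of the norms is finite. A random
  subsequence with convergent norms is bounded at each point, and its coordinates can then be made
  convergent one by one.\<close>

lemma random_convergent_subseq:
  fixes \<eta> :: "nat \<Rightarrow> 'a \<Rightarrow> 'b::euclidean_space"
  assumes \<eta>[measurable]: "\<And>n. \<eta> n \<in> borel_measurable G"
    and fin: "\<And>w. w \<in> space G \<Longrightarrow> \<not> filterlim (\<lambda>n. norm (\<eta> n w)) at_top sequentially"
  shows "\<exists>\<tau>::nat \<Rightarrow> 'a \<Rightarrow> nat. (\<forall>m. \<tau> m \<in> measurable G (count_space UNIV)) \<and>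
    (\<forall>w\<in>space G. (\<forall>m. m \<le> \<tau> m w) \<and> convergent (\<lambda>m. \<eta> (\<tau> m w) w))"
proof -
  have "\<exists>\<tau>::nat \<Rightarrow> 'a \<Rightarrow> nat. (\<forall>m. \<tau> m \<in> measurable G (count_space UNIV)) \<and>
    (\<forall>w\<in>space G. (\<forall>m. m \<le> \<tau> m w) \<and> convergent (\<lambda>m. norm (\<eta> (\<tau> m w) w)))"
  proof (rule random_subseq_to_liminf)
    fix w assume w: "w \<in> space G"
    have 0: "0 \<le> liminf (\<lambda>n. ereal (norm (\<eta> n w)))"
      by (intro Liminf_bounded always_eventually) auto
    have "liminf (\<lambda>n. ereal (norm (\<eta> n w))) \<noteq> \<infinity>"
    proof
      assume "liminf (\<lambda>n. ereal (norm (\<eta> n w))) = \<infinity>"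
      then have "(\<lambda>n. ereal (norm (\<eta> n w))) \<longlonglongrightarrow> \<infinity>"
        using Liminf_le_Limsup[of sequentially "\<lambda>n. ereal (norm (\<eta> n w))"]
        by (intro Liminf_eq_Limsup) auto
      then have "filterlim (\<lambda>n. norm (\<eta> n w)) at_top sequentially"
        by (simp add: tendsto_PInfty_eq_at_top)
      with fin[OF w] show False by simp
    qed
    with 0 show "\<bar>liminf (\<lambda>n. ereal (norm (\<eta> n w)))\<bar> \<noteq> \<infinity>" by auto
  qed simp
  then obtain \<tau>0 :: "nat \<Rightarrow> 'a \<Rightarrow> nat"
    where \<tau>0: "\<And>m. \<tau>0 m \<in> measurable G (count_space UNIV)"
      "\<And>w m. w \<in> space G \<Longrightarrow> m \<le> \<tau>0 m w"
      "\<And>w. w \<in> space G \<Longrightarrow> convergent (\<lambda>m. norm (\<eta> (\<tau>0 m w) w))"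
    by blast
  have bdd: "\<exists>K. \<forall>m. norm (\<eta> (\<tau>0 m w) w) \<le> K" if "w \<in> space G" for w
    using convergent_imp_Bseq[OF \<tau>0(3)[OF that]] by (auto simp: Bseq_def)
  have "\<exists>\<tau>::nat \<Rightarrow> 'a \<Rightarrow> nat. (\<forall>m. \<tau> m \<in> measurable G (count_space UNIV)) \<and>
    (\<forall>w\<in>space G. (\<forall>m. m \<le> \<tau> m w) \<and> (\<forall>b\<in>S. convergent (\<lambda>m. \<eta> (\<tau>0 (\<tau> m w) w) w \<bullet> b)))"
    if "finite S" for S :: "'b set"
    using that
  proof induction
    case empty
    show ?case by (intro exI[of _ "\<lambda>m _. m"]) auto
  next
    case (insert b S)
    then obtain \<tau> :: "nat \<Rightarrow> 'a \<Rightarrow> nat"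
      where \<tau>: "\<And>m. \<tau> m \<in> measurable G (count_space UNIV)"
        "\<And>w m. w \<in> space G \<Longrightarrow> m \<le> \<tau> m w"
        "\<And>w b. w \<in> space G \<Longrightarrow> b \<in> S \<Longrightarrow> convergent (\<lambda>m. \<eta> (\<tau>0 (\<tau> m w) w) w \<bullet> b)"
      by blast
    have m0: "(\<lambda>w. \<eta> (\<tau>0 n w) w) \<in> borel_measurable G" for n
      by (rule measurable_random_index[OF \<eta> \<tau>0(1)])
    have m1: "(\<lambda>w. \<eta> (\<tau>0 (\<tau> n w) w) w) \<in> borel_measurable G" for n
      by (rule measurable_random_index[OF m0 \<tau>(1)])
    have "\<exists>\<sigma>::nat \<Rightarrow> 'a \<Rightarrow> nat. (\<forall>m. \<sigma> m \<in> measurable G (count_space UNIV)) \<and>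
      (\<forall>w\<in>space G. (\<forall>m. m \<le> \<sigma> m w) \<and> convergent (\<lambda>m. \<eta> (\<tau>0 (\<tau> (\<sigma> m w) w) w) w \<bullet> b))"
    proof (rule random_subseq_to_liminf[where x="\<lambda>m w. \<eta> (\<tau>0 (\<tau> m w) w) w \<bullet> b"])
      fix w assume "w \<in> space G"
      then obtain K where K: "\<And>m. norm (\<eta> (\<tau>0 m w) w) \<le> K" using bdd by blast
      show "\<bar>liminf (\<lambda>n. ereal (\<eta> (\<tau>0 (\<tau> n w) w) w \<bullet> b))\<bar> \<noteq> \<infinity>"
      proof (rule liminf_ereal_finite_of_bounded)
        show "\<bar>\<eta> (\<tau>0 (\<tau> n w) w) w \<bullet> b\<bar> \<le> K * norm b" for n
          by (rule order_trans[OF Cauchy_Schwarz_ineq2 mult_right_mono[OF K]]) simp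
      qed
    qed (use m1 in measurable)
    then obtain \<sigma> :: "nat \<Rightarrow> 'a \<Rightarrow> nat"
      where \<sigma>: "\<And>m. \<sigma> m \<in> measurable G (count_space UNIV)"
        "\<And>w m. w \<in> space G \<Longrightarrow> m \<le> \<sigma> m w"
        "\<And>w. w \<in> space G \<Longrightarrow> convergent (\<lambda>m. \<eta> (\<tau>0 (\<tau> (\<sigma> m w) w) w) w \<bullet> b)"
      by blast
    show ?case
    proof (intro exI[of _ "\<lambda>m w. \<tau> (\<sigma> m w) w"] conjI allI ballI)
      show "(\<lambda>w. \<tau> (\<sigma> m w) w) \<in> measurable G (count_space UNIV)" for m
        by (rule measurable_compose_countable[OF \<tau>(1) \<sigma>(1)])
      show "m \<le> \<tau> (\<sigma> m w) w" if "w \<in> space G" for m w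
        using \<tau>(2)[OF that] \<sigma>(2)[OF that] by (meson order_trans)
      fix w b' assume w: "w \<in> space G" and b': "b' \<in> insert b S"
      show "convergent (\<lambda>m. \<eta> (\<tau>0 (\<tau> (\<sigma> m w) w) w) w \<bullet> b')"
      proof (cases "b' = b")
        case True
        then show ?thesis using \<sigma>(3)[OF w] by simp
      next
        case False
        then obtain l where l: "(\<lambda>m. \<eta> (\<tau>0 (\<tau> m w) w) w \<bullet> b') \<longlonglongrightarrow> l"
          using \<tau>(3)[OF w] b' by (auto simp: convergent_def)
        \<comment> \<open>The new indices tend to infinity, so the limits of the coordinates treated
          before survive the refinement.\<close>
        have "filterlim (\<lambda>m. \<sigma> m w) sequentially sequentially"
          using \<sigma>(2)[OF w] by (intro filterlim_at_top_mono[OF filterlim_ident]) auto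
        from filterlim_compose[OF l this] show ?thesis by (auto simp: convergent_def)
      qed
    qed
  qed
  from this[OF finite_Basis] obtain \<tau> :: "nat \<Rightarrow> 'a \<Rightarrow> nat"
    where \<tau>: "\<And>m. \<tau> m \<in> measurable G (count_space UNIV)"
      "\<And>w m. w \<in> space G \<Longrightarrow> m \<le> \<tau> m w"
      "\<And>w b. w \<in> space G \<Longrightarrow> b \<in> Basis \<Longrightarrow> convergent (\<lambda>m. \<eta> (\<tau>0 (\<tau> m w) w) w \<bullet> b)"
    by blast
  show ?thesis
  proof (intro exI[of _ "\<lambda>m w. \<tau>0 (\<tau> m w) w"] conjI allI ballI)
    show "(\<lambda>w. \<tau>0 (\<tau> m w) w) \<in> measurable G (count_space UNIV)" for m
      by (rule measurable_compose_countable[OF \<tau>0(1) \<tau>(1)])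
    show "m \<le> \<tau>0 (\<tau> m w) w" if "w \<in> space G" for m w
      using \<tau>(2)[OF that] \<tau>0(2)[OF that] by (meson order_trans)
    fix w assume w: "w \<in> space G"
    obtain l where l: "\<And>b. b \<in> Basis \<Longrightarrow> (\<lambda>m. \<eta> (\<tau>0 (\<tau> m w) w) w \<bullet> b) \<longlonglongrightarrow> l b"
      using \<tau>(3)[OF w] unfolding convergent_def by metis
    have "(\<lambda>m. \<Sum>b\<in>Basis. (\<eta> (\<tau>0 (\<tau> m w) w) w \<bullet> b) *\<^sub>R b) \<longlonglongrightarrow> (\<Sum>b\<in>Basis. l b *\<^sub>R b)"
      by (intro tendsto_sum tendsto_scaleR l tendsto_const)
    then show "convergent (\<lambda>m. \<eta> (\<tau>0 (\<tau> m w) w) w)"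
      by (auto simp: convergent_def euclidean_representation)
  qed
qed

section \<open>Conditional expectations of non-integrable functions\<close>

text \<open>A gain \<open>F\<^sub>t(\<eta>)\<close> with unbounded \<open>\<eta>\<close> need not be integrable; it becomes so after multiplication
  with a strictly positive weight that is measurable at time \<open>t\<close>.\<close>

definition cond_exp_weight :: "'a measure \<Rightarrow> 'a measure \<Rightarrow> ('a \<Rightarrow> real) \<Rightarrow> ('a \<Rightarrow> real) \<Rightarrow> ('a \<Rightarrow> real) \<Rightarrow> bool" where
  "cond_exp_weight M G U u h \<longleftrightarrow> h \<in> borel_measurable G \<and> (\<forall>w. 0 < h w \<and> h w \<le> 1) \<and>
     integrable M (\<lambda>w. h w * U w) \<and> (AE w in M. real_cond_exp M G (\<lambda>w. h w * U w) w = h w * u w)"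

lemma cond_exp_weightD:
  assumes "cond_exp_weight M G U u h"
  shows "h \<in> borel_measurable G" "0 < h w" "h w \<le> 1" "integrable M (\<lambda>w. h w * U w)"
    "AE w in M. real_cond_exp M G (\<lambda>w. h w * U w) w = h w * u w"
  using assms by (auto simp: cond_exp_weight_def)

text \<open>This is the generalized conditional expectation of a function that is sigma-integrable
  with respect to \<open>G\<close>.\<close>

definition has_cond_exp :: "'a measure \<Rightarrow> 'a measure \<Rightarrow> ('a \<Rightarrow> real) \<Rightarrow> ('a \<Rightarrow> real) \<Rightarrow> bool" where
  "has_cond_exp M G U u \<longleftrightarrow> U \<in> borel_measurable M \<and> u \<in> borel_measurable G \<and> (\<exists>h. cond_exp_weight M G U u h)"

context
  fixes M G :: "'a measure"
  assumes prob: "prob_space M" and sub: "subalgebra M G"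
begin

lemma sigma_finite_sub: "sigma_finite_subalgebra M G"
proof -
  interpret prob_space M by (rule prob)
  show ?thesis by (rule finite_measure_subalgebra_is_sigma_finite) (unfold_locales, rule sub)
qed

interpretation sigma_finite_subalgebra M G by (rule sigma_finite_sub)

text \<open>The quotient \<open>k / h\<close> is bounded and \<open>G\<close>-measurable, so it can
  be pulled out of the conditional expectation. This permits passing to smaller weights, for
  instance to one common to two functions.\<close>

lemma has_cond_exp_weight:
  assumes w: "cond_exp_weight M G U u h"
    and k[measurable]: "k \<in> borel_measurable G" and kh: "\<And>w. \<bar>k w\<bar> \<le> C * h w"
  shows "integrable M (\<lambda>w. k w * U w)"
    and "AE w in M. real_cond_exp M G (\<lambda>w. k w * U w) w = k w * u w"
proof -
  note h[measurable] = cond_exp_weightD(1)[OF w] and h01 = cond_exp_weightD(2)[OF w]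
    and int = cond_exp_weightD(4)[OF w] and ce = cond_exp_weightD(5)[OF w]
  define q where "q = (\<lambda>w. k w / h w)"
  have [measurable]: "q \<in> borel_measurable G" unfolding q_def by measurable
  have qM[measurable]: "q \<in> borel_measurable M" by (rule measurable_from_subalg[OF subalg]) measurable
  have hUm[measurable]: "(\<lambda>w. h w * U w) \<in> borel_measurable M" using int by auto
  have eq: "k w * U w = q w * (h w * U w)" for w using h01[of w] by (simp add: q_def)
  have qC: "\<bar>q w\<bar> \<le> C" for w using h01[of w] kh[of w] by (simp add: q_def abs_divide pos_divide_le_eq)
  have int2: "integrable M (\<lambda>w. q w * (h w * U w))"
  proof (rule Bochner_Integration.integrable_bound[of M "\<lambda>w. C * (h w * U w)"])
    show "AE w in M. norm (q w * (h w * U w)) \<le> norm (C * (h w * U w))"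
    proof (intro AE_I2)
      fix w
      have "\<bar>q w\<bar> \<le> \<bar>C\<bar>" using qC[of w] by linarith
      then show "norm (q w * (h w * U w)) \<le> norm (C * (h w * U w))"
        by (simp add: abs_mult mult_right_mono)
    qed
  qed (use int in auto)
  then show "integrable M (\<lambda>w. k w * U w)" by (simp add: eq)
  have "AE w in M. real_cond_exp M G (\<lambda>w. q w * (h w * U w)) w = q w * real_cond_exp M G (\<lambda>w. h w * U w) w"
    by (rule real_cond_exp_mult[OF _ _ int2]) auto
  with ce show "AE w in M. real_cond_exp M G (\<lambda>w. k w * U w) w = k w * u w"
  proof eventually_elim
    case (elim w)
    then show ?case using h01[of w] by (simp add: eq q_def)
  qed
qed

lemma has_cond_exp_integrable:
  assumes "integrable M U"
  shows "has_cond_exp M G U (real_cond_exp M G U)"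
  unfolding has_cond_exp_def cond_exp_weight_def using assms by (auto intro!: exI[of _ "\<lambda>_. 1"])

lemma has_cond_exp_mult:
  assumes U: "has_cond_exp M G U u" and k[measurable]: "k \<in> borel_measurable G"
  shows "has_cond_exp M G (\<lambda>w. k w * U w) (\<lambda>w. k w * u w)"
proof -
  obtain h where w: "cond_exp_weight M G U u h"
    and m[measurable]: "U \<in> borel_measurable M" "u \<in> borel_measurable G"
    using U unfolding has_cond_exp_def by blast
  note h[measurable] = cond_exp_weightD(1)[OF w] and h01 = cond_exp_weightD(2,3)[OF w]
    and int = cond_exp_weightD(4)[OF w] and ce = cond_exp_weightD(5)[OF w]
  have [measurable]: "k \<in> borel_measurable M" by (rule measurable_from_subalg[OF subalg k])
  \<comment> \<open>Dividing by \<open>1 + |k|\<close> keeps the weight positive and makes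
    \<open>l * k\<close> dominated by \<open>h\<close>.\<close>
  define l where "l = (\<lambda>w. h w / (1 + \<bar>k w\<bar>))"
  have [measurable]: "l \<in> borel_measurable G" unfolding l_def by measurable
  have l01: "0 < l w" "l w \<le> 1" for w
    using h01[of w] by (auto simp: l_def add_pos_nonneg pos_divide_le_eq)
  have "\<bar>l w * k w\<bar> \<le> 1 * h w" for w
  proof -
    have "h w * \<bar>k w\<bar> \<le> h w * (1 + \<bar>k w\<bar>)" using h01[of w] by (intro mult_left_mono) auto
    then show ?thesis using h01[of w] by (simp add: l_def abs_mult abs_divide add_pos_nonneg pos_divide_le_eq)
  qed
  from has_cond_exp_weight[OF w _ this]
  have "integrable M (\<lambda>w. l w * k w * U w)"
    "AE w in M. real_cond_exp M G (\<lambda>w. l w * k w * U w) w = l w * k w * u w" by auto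
  then show ?thesis unfolding has_cond_exp_def cond_exp_weight_def using l01
    by (auto intro!: exI[of _ l] simp: mult.assoc)
qed

lemma has_cond_exp_add:
  assumes U: "has_cond_exp M G U u" and V: "has_cond_exp M G V v"
  shows "has_cond_exp M G (\<lambda>w. U w + V w) (\<lambda>w. u w + v w)"
proof -
  obtain h where w: "cond_exp_weight M G U u h"
    and m[measurable]: "U \<in> borel_measurable M" "u \<in> borel_measurable G"
    using U unfolding has_cond_exp_def by blast
  note h[measurable] = cond_exp_weightD(1)[OF w] and h01 = cond_exp_weightD(2,3)[OF w]
    and int = cond_exp_weightD(4)[OF w] and ce = cond_exp_weightD(5)[OF w]
  obtain h' where w': "cond_exp_weight M G V v h'"
    and m'[measurable]: "V \<in> borel_measurable M" "v \<in> borel_measurable G"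
    using V unfolding has_cond_exp_def by blast
  note h'[measurable] = cond_exp_weightD(1)[OF w'] and h'01 = cond_exp_weightD(2,3)[OF w']
  define l where "l = (\<lambda>w. min (h w) (h' w))"
  have [measurable]: "l \<in> borel_measurable G" unfolding l_def by measurable
  have l01: "0 < l w" "l w \<le> 1" for w using h01[of w] h'01[of w] by (auto simp: l_def)
  have lh: "\<bar>l w\<bar> \<le> 1 * h w" "\<bar>l w\<bar> \<le> 1 * h' w" for w
    using h01[of w] h'01[of w] by (auto simp: l_def)
  note 1 = has_cond_exp_weight[OF w _ lh(1)] has_cond_exp_weight[OF w' _ lh(2)]
  have i: "integrable M (\<lambda>w. l w * U w)" "integrable M (\<lambda>w. l w * V w)" using 1 by auto
  have "AE w in M. real_cond_exp M G (\<lambda>w. l w * U w + l w * V w) w = l w * (u w + v w)"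
    using real_cond_exp_add[OF i] 1(2,4) by (auto simp: algebra_simps)
  then show ?thesis unfolding has_cond_exp_def cond_exp_weight_def using l01 i
    by (auto intro!: exI[of _ l] simp: distrib_left)
qed

lemma has_cond_exp_cong:
  assumes U: "has_cond_exp M G U u" and V[measurable]: "V \<in> borel_measurable M"
    and ae: "AE w in M. V w = U w"
  shows "has_cond_exp M G V u"
proof -
  obtain h where w: "cond_exp_weight M G U u h"
    and m[measurable]: "U \<in> borel_measurable M" "u \<in> borel_measurable G"
    using U unfolding has_cond_exp_def by blast
  note h[measurable] = cond_exp_weightD(1)[OF w] and h01 = cond_exp_weightD(2,3)[OF w]
    and int = cond_exp_weightD(4)[OF w] and ce = cond_exp_weightD(5)[OF w]
  have [measurable]: "h \<in> borel_measurable M" by (rule measurable_from_subalg[OF subalg h])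
  have ae': "AE w in M. h w * V w = h w * U w" using ae by eventually_elim simp
  have "integrable M (\<lambda>w. h w * V w)"
    using int by (rule integrable_cong_AE_imp) (use ae' in auto)
  moreover have "AE w in M. real_cond_exp M G (\<lambda>w. h w * V w) w = h w * u w"
    using real_cond_exp_cong[OF ae'] ce by auto
  ultimately show ?thesis unfolding has_cond_exp_def cond_exp_weight_def using h01 by (auto intro!: exI[of _ h])
qed

lemma has_cond_exp_sum:
  assumes "finite I" and "\<And>i. i \<in> I \<Longrightarrow> has_cond_exp M G (U i) (u i)"
  shows "has_cond_exp M G (\<lambda>w. \<Sum>i\<in>I. U i w) (\<lambda>w. \<Sum>i\<in>I. u i w)"
  using assms
proof induction
  case empty
  have "has_cond_exp M G (\<lambda>_. 0) (\<lambda>_. 0)"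
    unfolding has_cond_exp_def cond_exp_weight_def by (auto intro!: exI[of _ "\<lambda>_. 1"] real_cond_exp_F_meas)
  then show ?case by simp
next
  case (insert i I)
  then show ?case using has_cond_exp_add[of "U i" "u i" "\<lambda>w. \<Sum>i\<in>I. U i w"] by simp
qed

text \<open>After subtraction, the conditional expectation of 0 equals \<open>h * (u - v)\<close>
  with a positive weight \<open>h\<close>.\<close>

lemma has_cond_exp_unique:
  assumes U: "has_cond_exp M G U u" and V: "has_cond_exp M G U v"
  shows "AE w in M. u w = v w"
proof -
  have "has_cond_exp M G (\<lambda>w. U w + (-1) * U w) (\<lambda>w. u w + (-1) * v w)"
    by (intro has_cond_exp_add has_cond_exp_mult U V) simp
  then obtain h where h: "h \<in> borel_measurable G" and h01: "\<And>w. 0 < h w"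
    and ce: "AE w in M. real_cond_exp M G (\<lambda>w. 0) w = h w * (u w - v w)"
    unfolding has_cond_exp_def cond_exp_weight_def by auto
  have "AE w in M. real_cond_exp M G (\<lambda>w. 0) w = 0" by (rule real_cond_exp_F_meas) auto
  with ce show ?thesis
  proof eventually_elim
    case (elim w)
    then show ?case using h01[of w] by simp
  qed
qed

text \<open>The form in which weights are used later: the multipliers dominated by \<open>h\<close>
  include \<open>h\<close> itself and its truncations \<open>min 1 (n * h)\<close>, which increase
  to 1.\<close>

lemma has_cond_exp_bounded_weight:
  assumes U: "has_cond_exp M G U u"
  shows "\<exists>h\<in>borel_measurable G. (\<forall>w. 0 < h w \<and> h w \<le> 1) \<and>
    (\<forall>k C. k \<in> borel_measurable G \<longrightarrow> (\<forall>w. \<bar>k w\<bar> \<le> C * h w) \<longrightarrow>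
       integrable M (\<lambda>w. k w * U w) \<and> integrable M (\<lambda>w. k w * u w) \<and>
       (\<integral>w. k w * U w \<partial>M) = (\<integral>w. k w * u w \<partial>M))"
proof -
  obtain h where w: "cond_exp_weight M G U u h"
    and m[measurable]: "U \<in> borel_measurable M" "u \<in> borel_measurable G"
    using U unfolding has_cond_exp_def by blast
  note h[measurable] = cond_exp_weightD(1)[OF w] and h01 = cond_exp_weightD(2,3)[OF w]
    and int = cond_exp_weightD(4)[OF w] and ce = cond_exp_weightD(5)[OF w]
  show ?thesis
  proof (intro bexI[of _ h] conjI allI impI h h01)
    fix k C assume k: "k \<in> borel_measurable G" and kC: "\<forall>w. \<bar>k w\<bar> \<le> C * h w"
    note w = has_cond_exp_weight[OF w k, of C]
    show i: "integrable M (\<lambda>w. k w * U w)" using w(1) kC by simp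
    have ae: "AE w in M. real_cond_exp M G (\<lambda>w. k w * U w) w = k w * u w" using w(2) kC by simp
    have mm: "(\<lambda>w. k w * u w) \<in> borel_measurable M"
      by (rule measurable_from_subalg[OF subalg]) (use k m in measurable)
    show "integrable M (\<lambda>w. k w * u w)"
      using real_cond_exp_int(1)[OF i] by (rule integrable_cong_AE_imp) (use ae mm in auto)
    show "(\<integral>w. k w * U w \<partial>M) = (\<integral>w. k w * u w \<partial>M)"
      unfolding real_cond_exp_int(2)[OF i, symmetric] using ae mm by (intro integral_cong_AE) auto
  qed
qed

end

text \<open>A generalized supermartingale bounded below at the end by an integrable function is
  integrable there, with nonpositive mean. The induction splits off the earliest summand. The bound
  \<open>W\<close> has to be general even if 0 is the bound of interest, since the remaining
  summands are bounded below only up to the one removed.\<close>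

lemma (in prob_space) sum_has_cond_exp_nonpos:
  fixes U u :: "nat \<Rightarrow> 'a \<Rightarrow> real"
  assumes "\<And>i. subalgebra M (G i)" and "\<And>i j. i \<le> j \<Longrightarrow> sets (G i) \<subseteq> sets (G j)"
    and "\<And>i. i < m \<Longrightarrow> has_cond_exp M (G i) (U i) (u i)"
    and "\<And>i. i < m \<Longrightarrow> AE w in M. u i w \<le> 0"
    and "integrable M W" and "AE w in M. - W w \<le> (\<Sum>i<m. U i w)"
  shows "integrable M (\<lambda>w. \<Sum>i<m. U i w) \<and> (\<integral>w. (\<Sum>i<m. U i w) \<partial>M) \<le> 0"
  using assms
proof (induction m arbitrary: G U u W)
  case 0
  then show ?case by simp
next
  case (Suc m)
  note sub = Suc.prems(1) and mono = Suc.prems(2)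
  have U0: "has_cond_exp M (G 0) (U 0) (u 0)" and u0: "AE w in M. u 0 w \<le> 0" using Suc.prems(3,4) by auto
  obtain h where h[measurable]: "h \<in> borel_measurable (G 0)" and h01: "\<And>w. 0 < h w" "\<And>w. h w \<le> 1"
    and hk: "\<And>k C. k \<in> borel_measurable (G 0) \<Longrightarrow> (\<And>w. \<bar>k w\<bar> \<le> C * h w) \<Longrightarrow>
       integrable M (\<lambda>w. k w * U 0 w) \<and> integrable M (\<lambda>w. k w * u 0 w) \<and>
       (\<integral>w. k w * U 0 w \<partial>M) = (\<integral>w. k w * u 0 w \<partial>M)"
    using has_cond_exp_bounded_weight[OF prob_space_axioms sub U0] by blast
  \<comment> \<open>The truncation makes the first summand integrable, is measurable for every
    \<open>G i\<close>, and equals 1 for all large \<open>n\<close> because \<open>h\<close> is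
    strictly positive.\<close>
  define k where "k = (\<lambda>n::nat. \<lambda>w. min 1 (real n * h w))"
  have kG[measurable]: "k n \<in> borel_measurable (G 0)" for n unfolding k_def by measurable
  have kM[measurable]: "k n \<in> borel_measurable M" for n by (rule measurable_from_subalg[OF sub kG])
  have kGi: "k n \<in> borel_measurable (G i)" for n i
    by (rule measurable_from_subalg[OF _ kG])
       (use mono[of 0 i] sub[of 0] sub[of i] in \<open>auto simp: subalgebra_def\<close>)
  have k01: "0 \<le> k n w" "k n w \<le> 1" for n w using h01[of w] by (auto simp: k_def)
  have kh: "\<bar>k n w\<bar> \<le> real n * h w" for n w using h01(1)[of w] by (auto simp: k_def abs_of_nonneg)
  define S where "S = (\<lambda>w. \<Sum>i<Suc m. U i w)"
  define S' where "S' = (\<lambda>w. \<Sum>i<m. U (Suc i) w)"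
  have SS': "S w = U 0 w + S' w" for w unfolding S_def S'_def by (rule sum.lessThan_Suc_shift)
  have Sm[measurable]: "S \<in> borel_measurable M" unfolding S_def
    using Suc.prems(3) by (intro borel_measurable_sum) (auto simp: has_cond_exp_def)
  have W: "integrable M W" and SW: "AE w in M. - W w \<le> S w" using Suc.prems(5,6) by (auto simp: S_def)
  have [measurable]: "W \<in> borel_measurable M" using W by auto
  have step: "integrable M (\<lambda>w. k n w * S w) \<and> (\<integral>w. k n w * S w \<partial>M) \<le> 0" for n
  proof -
    note hkn = hk[OF kG kh, of n]
    have neg: "(\<integral>w. k n w * U 0 w \<partial>M) \<le> 0"
    proof -
      have "AE w in M. k n w * u 0 w \<le> 0" using u0 by eventually_elim (simp add: k01 mult_nonneg_nonpos)
      then have "(\<integral>w. k n w * u 0 w \<partial>M) \<le> (\<integral>w. 0 \<partial>M)" using hkn by (intro integral_mono_AE) auto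
      then show ?thesis using hkn by simp
    qed
    have "integrable M (\<lambda>w. \<Sum>i<m. k n w * U (Suc i) w) \<and> (\<integral>w. (\<Sum>i<m. k n w * U (Suc i) w) \<partial>M) \<le> 0"
    proof (rule Suc.IH[of "\<lambda>i. G (Suc i)" "\<lambda>i w. k n w * U (Suc i) w" "\<lambda>i w. k n w * u (Suc i) w"
          "\<lambda>w. \<bar>W w\<bar> + \<bar>k n w * U 0 w\<bar>"])
      show "has_cond_exp M (G (Suc i)) (\<lambda>w. k n w * U (Suc i) w) (\<lambda>w. k n w * u (Suc i) w)" if "i < m" for i
        using that by (intro has_cond_exp_mult[OF prob_space_axioms sub] Suc.prems(3) kGi) auto
      show "AE w in M. k n w * u (Suc i) w \<le> 0" if "i < m" for i
      proof -
        have "AE w in M. u (Suc i) w \<le> 0" using that Suc.prems(4) by auto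
        then show ?thesis by eventually_elim (simp add: k01 mult_nonneg_nonpos)
      qed
      show "AE w in M. - (\<bar>W w\<bar> + \<bar>k n w * U 0 w\<bar>) \<le> (\<Sum>i<m. k n w * U (Suc i) w)"
        using SW
      proof eventually_elim
        case (elim w)
        have "k n w * - W w \<le> k n w * S w" using elim k01 by (intro mult_left_mono) auto
        moreover have "\<bar>k n w * W w\<bar> \<le> \<bar>W w\<bar>"
          using k01[of n w] by (simp add: abs_mult mult_left_le_one_le)
        moreover have "(\<Sum>i<m. k n w * U (Suc i) w) = k n w * S w - k n w * U 0 w"
          by (simp add: SS' S'_def sum_distrib_left algebra_simps)
        ultimately show ?case by linarith
      qed
    qed (use W hkn sub mono in auto)
    moreover have "k n w * S w = k n w * U 0 w + (\<Sum>i<m. k n w * U (Suc i) w)" for w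
      by (simp add: SS' S'_def sum_distrib_left algebra_simps)
    ultimately show ?thesis using hkn neg by simp
  qed
  have conv: "(\<lambda>n. k n w) \<longlonglongrightarrow> 1" for w
  proof (rule tendsto_eventually)
    obtain N :: nat where N: "1 \<le> real N * h w"
      using reals_Archimedean3[OF h01(1)[of w]] by (meson less_imp_le)
    show "\<forall>\<^sub>F n in sequentially. k n w = 1"
      using eventually_ge_at_top[of N]
    proof eventually_elim
      case (elim n)
      then have "real N * h w \<le> real n * h w" using h01(1)[of w] by (intro mult_right_mono) auto
      then show ?case using N by (simp add: k_def)
    qed
  qed
  \<comment> \<open>Fatou applies to \<open>S + W\<close>, which is nonnegative almost surely; its
    truncated integrals are at most that of \<open>|W|\<close>, because those of \<open>S\<close>
    are nonpositive. Only with this integrability can \<open>|S|\<close> serve as a dominating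
    function.\<close>
  have Sint: "integrable M (\<lambda>w. S w + W w)"
  proof -
    have "(\<integral>\<^sup>+w. ennreal (norm (S w + W w)) \<partial>M) = (\<integral>\<^sup>+w. liminf (\<lambda>n. ennreal (norm (k n w * (S w + W w)))) \<partial>M)"
    proof (rule nn_integral_cong)
      fix w
      have "(\<lambda>n. ennreal (norm (k n w * (S w + W w)))) \<longlonglongrightarrow> ennreal (norm (1 * (S w + W w)))"
        by (intro tendsto_ennrealI tendsto_norm tendsto_mult conv tendsto_const)
      then show "ennreal (norm (S w + W w)) = liminf (\<lambda>n. ennreal (norm (k n w * (S w + W w))))"
        using lim_imp_Liminf[OF sequentially_bot] by fastforce
    qed
    also have "\<dots> \<le> liminf (\<lambda>n. \<integral>\<^sup>+w. ennreal (norm (k n w * (S w + W w))) \<partial>M)"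
      by (rule nn_integral_liminf) measurable
    also have "\<dots> \<le> liminf (\<lambda>n. ennreal (\<integral>w. \<bar>W w\<bar> \<partial>M))"
    proof (rule Liminf_mono, rule always_eventually, rule allI)
      fix n
      have kW: "integrable M (\<lambda>w. k n w * W w)"
        by (rule Bochner_Integration.integrable_bound[OF W])
           (auto simp: abs_mult k01 intro!: AE_I2 mult_left_le_one_le)
      have i: "integrable M (\<lambda>w. k n w * (S w + W w))"
        using step[of n] kW by (simp add: distrib_left)
      have "(\<integral>\<^sup>+w. ennreal (norm (k n w * (S w + W w))) \<partial>M) = (\<integral>\<^sup>+w. ennreal (k n w * (S w + W w)) \<partial>M)"
        using SW by (intro nn_integral_cong_AE) (auto elim!: eventually_mono simp: abs_of_nonneg k01)
      also have "\<dots> = ennreal (\<integral>w. k n w * (S w + W w) \<partial>M)"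
        using SW by (intro nn_integral_eq_integral[OF i]) (auto elim!: eventually_mono simp: k01)
      also have "(\<integral>w. k n w * (S w + W w) \<partial>M) = (\<integral>w. k n w * S w \<partial>M) + (\<integral>w. k n w * W w \<partial>M)"
        using step[of n] kW by (simp add: distrib_left)
      also have "\<dots> \<le> 0 + (\<integral>w. \<bar>W w\<bar> \<partial>M)"
      proof (intro add_mono integral_mono)
        show "k n w * W w \<le> \<bar>W w\<bar>" for w
        proof -
          have "\<bar>k n w * W w\<bar> \<le> \<bar>W w\<bar>" using k01[of n w] by (simp add: abs_mult mult_left_le_one_le)
          then show ?thesis by linarith
        qed
      qed (use step[of n] kW W in auto)
      finally show "(\<integral>\<^sup>+w. ennreal (norm (k n w * (S w + W w))) \<partial>M) \<le> ennreal (\<integral>w. \<bar>W w\<bar> \<partial>M)"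
        by (simp add: ennreal_leI)
    qed
    also have "\<dots> < \<infinity>" by (simp add: Liminf_const)
    finally show ?thesis by (intro integrableI_bounded) measurable
  qed
  have "integrable M (\<lambda>w. S w + W w - W w)" by (intro Bochner_Integration.integrable_diff Sint W)
  then have Si: "integrable M S" by simp
  have "(\<lambda>n. \<integral>w. k n w * S w \<partial>M) \<longlonglongrightarrow> (\<integral>w. S w \<partial>M)"
  proof (rule integral_dominated_convergence[where w="\<lambda>w. \<bar>S w\<bar>"])
    show "AE w in M. (\<lambda>n. k n w * S w) \<longlonglongrightarrow> S w"
    proof (rule AE_I2)
      fix w
      show "(\<lambda>n. k n w * S w) \<longlonglongrightarrow> S w" using tendsto_mult[OF conv[of w] tendsto_const[of "S w"]] by simp
    qed
  qed (use Si in \<open>auto simp: abs_mult k01 intro!: AE_I2 mult_left_le_one_le\<close>)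
  then have "(\<integral>w. S w \<partial>M) \<le> 0" by (rule LIMSEQ_le_const2) (use step in auto)
  with Si show ?case by (simp add: S_def)
qed

text \<open>The multipliers \<open>h\<close> and \<open>1 - h\<close> split the sum into two parts
  with nonpositive integrals adding up to 0, so both integrals vanish. In the \<open>h\<close>-part
  the first summand is integrable, and again two nonpositive integrals add up to 0; hence
  \<open>h * u 0\<close> vanishes and the later dates follow by induction.\<close>

lemma (in prob_space) sum_has_cond_exp_eq_0:
  fixes U u :: "nat \<Rightarrow> 'a \<Rightarrow> real"
  assumes "\<And>i. subalgebra M (G i)" and "\<And>i j. i \<le> j \<Longrightarrow> sets (G i) \<subseteq> sets (G j)"
    and "\<And>i. i < m \<Longrightarrow> has_cond_exp M (G i) (U i) (u i)"
    and "\<And>i. i < m \<Longrightarrow> AE w in M. u i w \<le> 0"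
    and "integrable M W" and "AE w in M. - W w \<le> (\<Sum>i<m. U i w)"
    and "(\<integral>w. (\<Sum>i<m. U i w) \<partial>M) = 0" and "j < m"
  shows "AE w in M. u j w = 0"
  using assms
proof (induction m arbitrary: G U u W j)
  case 0
  then show ?case by simp
next
  case (Suc m)
  note sub = Suc.prems(1) and mono = Suc.prems(2)
  have U0: "has_cond_exp M (G 0) (U 0) (u 0)" and u0: "AE w in M. u 0 w \<le> 0" using Suc.prems(3,4) by auto
  obtain h where h[measurable]: "h \<in> borel_measurable (G 0)" and h01: "\<And>w. 0 < h w" "\<And>w. h w \<le> 1"
    and hk: "\<And>k C. k \<in> borel_measurable (G 0) \<Longrightarrow> (\<And>w. \<bar>k w\<bar> \<le> C * h w) \<Longrightarrow>
       integrable M (\<lambda>w. k w * U 0 w) \<and> integrable M (\<lambda>w. k w * u 0 w) \<and>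
       (\<integral>w. k w * U 0 w \<partial>M) = (\<integral>w. k w * u 0 w \<partial>M)"
    using has_cond_exp_bounded_weight[OF prob_space_axioms sub U0] by blast
  have hi: "integrable M (\<lambda>w. h w * U 0 w)" "integrable M (\<lambda>w. h w * u 0 w)"
    "(\<integral>w. h w * U 0 w \<partial>M) = (\<integral>w. h w * u 0 w \<partial>M)"
    using hk[OF h, of 1] h01(1) by (auto simp: abs_of_pos)
  have hGi: "h \<in> borel_measurable (G i)" for i
    by (rule measurable_from_subalg[OF _ h])
       (use mono[of 0 i] sub[of 0] sub[of i] in \<open>auto simp: subalgebra_def\<close>)
  define S' where "S' = (\<lambda>w. \<Sum>i<m. h w * U (Suc i) w)"
  define S where "S = (\<lambda>w. \<Sum>i<Suc m. U i w)"
  have S': "h w * S w = h w * U 0 w + S' w" for w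
    unfolding S_def S'_def sum.lessThan_Suc_shift by (simp add: sum_distrib_left distrib_left)
  have W: "integrable M W" and SW: "AE w in M. - W w \<le> S w" and S0: "(\<integral>w. S w \<partial>M) = 0"
    using Suc.prems(5-7) by (auto simp: S_def)
  have scaled: "integrable M (\<lambda>w. k w * S w) \<and> (\<integral>w. k w * S w \<partial>M) \<le> 0"
    if k: "\<And>i. k \<in> borel_measurable (G i)" and k01: "\<And>w. 0 \<le> k w" "\<And>w. k w \<le> 1" for k
  proof -
    have eq: "k w * S w = (\<Sum>i<Suc m. k w * U i w)" for w by (simp only: S_def sum_distrib_left)
    show ?thesis unfolding eq
    proof (rule sum_has_cond_exp_nonpos[of G "Suc m" "\<lambda>i w. k w * U i w" "\<lambda>i w. k w * u i w" "\<lambda>w. \<bar>W w\<bar>"])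
      show "has_cond_exp M (G i) (\<lambda>w. k w * U i w) (\<lambda>w. k w * u i w)" if "i < Suc m" for i
        by (intro has_cond_exp_mult[OF prob_space_axioms sub] Suc.prems(3) k that)
      show "AE w in M. k w * u i w \<le> 0" if "i < Suc m" for i
        using Suc.prems(4)[OF that] by eventually_elim (simp add: k01 mult_nonneg_nonpos)
      show "AE w in M. - \<bar>W w\<bar> \<le> (\<Sum>i<Suc m. k w * U i w)"
        using SW
      proof eventually_elim
        case (elim w)
        have "k w * - W w \<le> k w * S w" using elim k01 by (intro mult_left_mono) auto
        moreover have "\<bar>k w * W w\<bar> \<le> \<bar>W w\<bar>" using k01[of w] by (simp add: abs_mult mult_left_le_one_le)
        ultimately show ?case unfolding eq[symmetric] by linarith
      qed
    qed (use W sub mono in auto)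
  qed
  have h_S: "integrable M (\<lambda>w. h w * S w)" "(\<integral>w. h w * S w \<partial>M) = 0"
  proof -
    have 1: "integrable M (\<lambda>w. h w * S w) \<and> (\<integral>w. h w * S w \<partial>M) \<le> 0"
      by (rule scaled) (use hGi h01 in \<open>auto simp: less_imp_le\<close>)
    have 2: "integrable M (\<lambda>w. (1 - h w) * S w) \<and> (\<integral>w. (1 - h w) * S w \<partial>M) \<le> 0"
      by (rule scaled) (use hGi h01 in \<open>auto simp: less_imp_le\<close>)
    have "(\<integral>w. S w \<partial>M) = (\<integral>w. h w * S w + (1 - h w) * S w \<partial>M)" by (simp add: algebra_simps)
    also have "\<dots> = (\<integral>w. h w * S w \<partial>M) + (\<integral>w. (1 - h w) * S w \<partial>M)"
      using 1 2 by (intro Bochner_Integration.integral_add) auto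
    finally show "integrable M (\<lambda>w. h w * S w)" "(\<integral>w. h w * S w \<partial>M) = 0" using 1 2 S0 by auto
  qed
  have ce: "has_cond_exp M (G (Suc i)) (\<lambda>w. h w * U (Suc i) w) (\<lambda>w. h w * u (Suc i) w)" if "i < m" for i
    using that by (intro has_cond_exp_mult[OF prob_space_axioms sub] Suc.prems(3) hGi) auto
  have neg: "AE w in M. h w * u (Suc i) w \<le> 0" if "i < m" for i
  proof -
    have "AE w in M. u (Suc i) w \<le> 0" using that Suc.prems(4) by auto
    then show ?thesis by eventually_elim (simp add: h01 less_imp_le mult_nonneg_nonpos)
  qed
  have S'i: "integrable M S' \<and> (\<integral>w. S' w \<partial>M) \<le> 0"
  proof -
    have low: "AE w in M. - (\<bar>h w * S w\<bar> + \<bar>h w * U 0 w\<bar>) \<le> (\<Sum>i<m. h w * U (Suc i) w)"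
    proof (rule AE_I2)
      fix w
      show "- (\<bar>h w * S w\<bar> + \<bar>h w * U 0 w\<bar>) \<le> (\<Sum>i<m. h w * U (Suc i) w)"
        using S'[of w] unfolding S'_def by linarith
    qed
    show ?thesis unfolding S'_def
      by (rule sum_has_cond_exp_nonpos[of "\<lambda>i. G (Suc i)" m "\<lambda>i w. h w * U (Suc i) w" "\<lambda>i w. h w * u (Suc i) w", OF _ _ _ _ _ low])
         (use ce neg hi h_S sub mono in auto)
  qed
  have hu: "AE w in M. 0 \<le> - (h w * u 0 w)"
    using u0 by eventually_elim (simp add: h01 less_imp_le mult_nonneg_nonpos)
  have "0 \<le> (\<integral>w. - (h w * u 0 w) \<partial>M)" using hu by (rule integral_nonneg_AE)
  then have "(\<integral>w. h w * U 0 w \<partial>M) \<le> 0" using hi by simp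
  moreover have "(\<integral>w. h w * U 0 w \<partial>M) + (\<integral>w. S' w \<partial>M) = 0"
    using h_S(2) S'i hi unfolding S' by simp
  ultimately have z0: "(\<integral>w. h w * U 0 w \<partial>M) = 0" "(\<integral>w. S' w \<partial>M) = 0" using S'i by auto
  then have "(\<integral>w. - (h w * u 0 w) \<partial>M) = 0" using hi by simp
  then have "AE w in M. - (h w * u 0 w) = 0"
    using integral_nonneg_eq_0_iff_AE[of M "\<lambda>w. - (h w * u 0 w)"] hi(2) hu by simp
  then have z: "AE w in M. u 0 w = 0"
  proof eventually_elim
    case (elim w)
    then show ?case using h01(1)[of w] by simp
  qed
  show ?case
  proof (cases j)
    case 0
    then show ?thesis using z by simp
  next
    case (Suc i)
    have low: "AE w in M. - \<bar>S' w\<bar> \<le> (\<Sum>i<m. h w * U (Suc i) w)"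
      unfolding S'_def by (intro AE_I2) linarith
    have "AE w in M. h w * u (Suc i) w = 0"
      by (rule Suc.IH[of "\<lambda>i. G (Suc i)" "\<lambda>i w. h w * U (Suc i) w" "\<lambda>i w. h w * u (Suc i) w", OF _ _ _ _ _ low])
         (use ce neg S'i z0 sub mono Suc Suc.prems(8) in \<open>auto simp: S'_def\<close>)
    then have "AE w in M. u (Suc i) w = 0"
    proof eventually_elim
      case (elim w)
      then show ?case using h01(1)[of w] by simp
    qed
    then show ?thesis using Suc by simp
  qed
qed

section \<open>Closedness of the set of hedgeable claims\<close>

lemma Fclass_scale: "f \<in> Fclass A \<Longrightarrow> 0 \<le> l \<Longrightarrow> f (l *\<^sub>R a) = l *\<^sub>R f a"
  by (simp add: Fclass_def)

lemma Fclass_0: "f \<in> Fclass A \<Longrightarrow> f 0 = 0"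
  using Fclass_scale[of f A 0 0] by simp

lemma Fclass_superadd:
  assumes "f \<in> Fclass A" "a \<in> A" "b \<in> A" "0 \<le> l" "0 \<le> m"
  shows "l *\<^sub>R f a + m *\<^sub>R f b \<le> f (l *\<^sub>R a + m *\<^sub>R b)"
  using assms unfolding Fclass_def less_eq_vec_def by auto

lemma Fclass_add:
  assumes "f \<in> Fclass A" "a \<in> A" "b \<in> A"
  shows "f a + f b \<le> f (a + b)"
  using Fclass_superadd[OF assms, of 1 1] by simp

lemma Fclass_tendsto: "f \<in> Fclass A \<Longrightarrow> (x \<longlongrightarrow> a) G \<Longrightarrow> ((\<lambda>n. f (x n)) \<longlongrightarrow> f a) G"
  by (rule continuous_on_tendsto_compose[of UNIV f]) (auto simp: Fclass_def)

lemma convex_cone_scaleR: "convex_cone A \<Longrightarrow> a \<in> A \<Longrightarrow> 0 \<le> l \<Longrightarrow> l *\<^sub>R a \<in> A"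
  by (simp add: convex_cone_def conic_def)

lemma convex_cone_plus: "convex_cone A \<Longrightarrow> a \<in> A \<Longrightarrow> b \<in> A \<Longrightarrow> a + b \<in> A"
  by (simp add: convex_cone_add)

lemma convex_cone_zero: "convex_cone A \<Longrightarrow> 0 \<in> A"
  by (simp add: convex_cone_contains_0)

text \<open>Homogeneity and \<open>f (- b) = - f b\<close> make \<open>f\<close> linear on the line
  through \<open>b\<close>; superadditivity then allows subtracting any multiple of
  \<open>b\<close>, whatever the sign of \<open>\<beta>\<close>.\<close>

lemma Fclass_minus_kernel:
  assumes A: "convex_cone A" and f: "f \<in> Fclass A" and a: "a \<in> A" and b: "b \<in> A" "- b \<in> A"
    and k: "f (- b) = - f b"
  shows "a - \<beta> *\<^sub>R b \<in> A" and "f a - \<beta> *\<^sub>R f b \<le> f (a - \<beta> *\<^sub>R b)"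
proof -
  have "- (\<beta> *\<^sub>R b) \<in> A \<and> f (- (\<beta> *\<^sub>R b)) = - (\<beta> *\<^sub>R f b)"
  proof (cases "0 \<le> \<beta>")
    case True
    then show ?thesis using convex_cone_scaleR[OF A b(2), of \<beta>] Fclass_scale[OF f, of \<beta> "- b"] k by simp
  next
    case False
    then show ?thesis using convex_cone_scaleR[OF A b(1), of "- \<beta>"] Fclass_scale[OF f, of "- \<beta>" b] by simp
  qed
  then show "a - \<beta> *\<^sub>R b \<in> A" "f a - \<beta> *\<^sub>R f b \<le> f (a - \<beta> *\<^sub>R b)"
    using convex_cone_plus[OF A a, of "- (\<beta> *\<^sub>R b)"] Fclass_add[OF f a, of "- (\<beta> *\<^sub>R b)"] by auto
qed

section \<open>Claims hedged by trading from a given date on\<close>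

locale market =
  fixes M :: "'a measure" and H :: "nat \<Rightarrow> 'a measure" and T :: nat
    and Acone :: "('d::finite) mat set" and F :: "nat \<Rightarrow> 'a \<Rightarrow> 'd mat \<Rightarrow> real^'d"
  assumes setting: "setting M H T Acone" and Fseq: "Fseq M T Acone F"
begin

sublocale prob_space M using setting by (simp add: setting_def)

lemma complete_M: "complete_measure M" using setting by (simp add: setting_def)

lemma sub: "t \<le> T \<Longrightarrow> subalgebra M (H t)" using setting by (simp add: setting_def)

lemma space_H: "t \<le> T \<Longrightarrow> space (H t) = space M" using sub by (simp add: subalgebra_def)

lemma sub_mono: "s \<le> t \<Longrightarrow> t \<le> T \<Longrightarrow> subalgebra (H t) (H s)"
  using setting sub[of s] sub[of t] unfolding setting_def subalgebra_def by auto

lemma closed_A: "closed Acone" and cone_A: "convex_cone Acone"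
  using setting by (auto simp: setting_def)

lemma AE_F_class: "t \<le> T \<Longrightarrow> AE w in M. F t w \<in> Fclass Acone"
  using Fseq by (simp add: Fseq_def)

lemma measurable_H_mono: "f \<in> measurable (H s) N \<Longrightarrow> s \<le> t \<Longrightarrow> t \<le> T \<Longrightarrow> f \<in> measurable (H t) N"
  by (rule measurable_from_subalg[OF sub_mono])

lemma measurable_H_M: "f \<in> measurable (H s) N \<Longrightarrow> s \<le> T \<Longrightarrow> f \<in> measurable M N"
  by (rule measurable_from_subalg[OF sub])

lemma F_measurable:
  assumes "t \<le> T" and \<eta>: "\<eta> \<in> borel_measurable M"
  shows "(\<lambda>w. F t w (\<eta> w)) \<in> borel_measurable M"
proof -
  have "(\<lambda>p. F t (fst p) (snd p)) \<in> borel_measurable (M \<Otimes>\<^sub>M borel)" using Fseq assms by (simp add: Fseq_def)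
  from measurable_compose[OF _ this, of "\<lambda>w. (w, \<eta> w)" M] show ?thesis using \<eta> by simp
qed

abbreviation strat :: "nat \<Rightarrow> ('a \<Rightarrow> 'd mat) set" where
  "strat t \<equiv> L0 M Acone (H t)"

lemma L0_measurable: "\<eta> \<in> strat t \<Longrightarrow> \<eta> \<in> borel_measurable (H t)"
  and L0_AE: "\<eta> \<in> strat t \<Longrightarrow> AE w in M. \<eta> w \<in> Acone"
  by (auto simp: L0_def)

lemma F_L0_measurable: "t \<le> T \<Longrightarrow> \<eta> \<in> strat t \<Longrightarrow> (\<lambda>w. F t w (\<eta> w)) \<in> borel_measurable M"
  by (intro F_measurable measurable_H_M[OF L0_measurable])

lemma L0_scale:
  assumes v: "v \<in> borel_measurable (H t)" "AE w in M. 0 \<le> v w" and \<eta>: "\<eta> \<in> strat t"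
  shows "(\<lambda>w. v w *\<^sub>R \<eta> w) \<in> strat t"
proof -
  have "AE w in M. v w *\<^sub>R \<eta> w \<in> Acone"
    using v(2) L0_AE[OF \<eta>] by eventually_elim (rule convex_cone_scaleR[OF cone_A])
  then show ?thesis using v(1) L0_measurable[OF \<eta>] by (auto simp: L0_def)
qed

lemma L0_add:
  assumes \<eta>: "\<eta> \<in> strat t" and \<eta>': "\<eta>' \<in> strat t"
  shows "(\<lambda>w. \<eta> w + \<eta>' w) \<in> strat t"
proof -
  have "AE w in M. \<eta> w + \<eta>' w \<in> Acone"
    using L0_AE[OF \<eta>] L0_AE[OF \<eta>'] by eventually_elim (rule convex_cone_plus[OF cone_A])
  then show ?thesis using L0_measurable[OF \<eta>] L0_measurable[OF \<eta>'] by (auto simp: L0_def)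
qed

lemma L0_zero: "(\<lambda>_. 0) \<in> strat t"
  using convex_cone_zero[OF cone_A] by (auto simp: L0_def)

lemma L0_const: "a \<in> Acone \<Longrightarrow> (\<lambda>_. a) \<in> strat t"
  by (auto simp: L0_def)

abbreviation gain :: "nat \<Rightarrow> (nat \<Rightarrow> 'a \<Rightarrow> 'd mat) \<Rightarrow> 'a \<Rightarrow> real^'d" where
  "gain k \<eta> w \<equiv> \<Sum>s\<in>{k..T}. F s w (\<eta> s w)"

text \<open>The disposal \<open>r\<close> of \<open>Aset\<close> is absorbed into the inequality,
  and \<open>X\<close> may be any function, so claims reduced by gains that are not adapted fit in.
  For \<open>k > T\<close> the sum is empty and only nonpositive claims are hedged.\<close>

definition hedged :: "nat \<Rightarrow> ('a \<Rightarrow> real^'d) \<Rightarrow> bool" where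
  "hedged k X \<longleftrightarrow> (\<exists>\<eta>. (\<forall>s\<in>{k..T}. \<eta> s \<in> strat s) \<and>
     (AE w in M. X w \<le> gain k \<eta> w))"

lemma hedgedE:
  assumes "hedged k X"
  obtains \<eta> where "\<And>s. s \<in> {k..T} \<Longrightarrow> \<eta> s \<in> strat s" "AE w in M. X w \<le> gain k \<eta> w"
  using assms unfolding hedged_def by blast

lemmas Fclass_A_0 = Fclass_0[where A = Acone] and Fclass_A_scale = Fclass_scale[where A = Acone]

lemma AE_Fclass: "AE w in M. \<forall>s\<in>{k..T}. F s w \<in> Fclass Acone"
  using AE_F_class by (intro AE_finite_allI) auto

lemma hedged_mono: "hedged k X \<Longrightarrow> AE w in M. Y w \<le> X w \<Longrightarrow> hedged k Y"
  unfolding hedged_def by (elim exE conjE, intro exI conjI, assumption) (auto elim!: eventually_elim2)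

lemma hedged_zero: "hedged k (\<lambda>_. 0)"
  unfolding hedged_def
proof (intro exI conjI ballI)
  show "(\<lambda>_. 0) \<in> strat s" for s by (rule L0_zero)
  show "AE w in M. 0 \<le> (\<Sum>s\<in>{k..T}. F s w 0)"
    using AE_Fclass[of k] by eventually_elim (auto intro!: sum_nonneg simp: Fclass_A_0)
qed

lemma hedged_add:
  assumes "hedged k X" "hedged k Y"
  shows "hedged k (\<lambda>w. X w + Y w)"
proof -
  obtain \<eta> where \<eta>: "\<And>s. s \<in> {k..T} \<Longrightarrow> \<eta> s \<in> strat s" "AE w in M. X w \<le> gain k \<eta> w"
    using assms(1) by (rule hedgedE) blast
  obtain \<theta> where \<theta>: "\<And>s. s \<in> {k..T} \<Longrightarrow> \<theta> s \<in> strat s" "AE w in M. Y w \<le> gain k \<theta> w"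
    using assms(2) by (rule hedgedE) blast
  have "AE w in M. \<forall>s\<in>{k..T}. \<eta> s w \<in> Acone" "AE w in M. \<forall>s\<in>{k..T}. \<theta> s w \<in> Acone"
    using L0_AE[OF \<eta>(1)] L0_AE[OF \<theta>(1)] by (auto intro!: AE_finite_allI)
  with AE_Fclass[of k] \<eta>(2) \<theta>(2)
  have "AE w in M. X w + Y w \<le> (\<Sum>s\<in>{k..T}. F s w (\<eta> s w + \<theta> s w))"
  proof eventually_elim
    case (elim w)
    have "X w + Y w \<le> gain k \<eta> w + gain k \<theta> w"
      using elim by (intro add_mono) auto
    also have "\<dots> = (\<Sum>s\<in>{k..T}. F s w (\<eta> s w) + F s w (\<theta> s w))" by (simp add: sum.distrib)
    also have "\<dots> \<le> (\<Sum>s\<in>{k..T}. F s w (\<eta> s w + \<theta> s w))"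
      using elim by (intro sum_mono Fclass_add) auto
    finally show ?case .
  qed
  then show ?thesis unfolding hedged_def using L0_add \<eta>(1) \<theta>(1)
    by (intro exI[of _ "\<lambda>s w. \<eta> s w + \<theta> s w"]) auto
qed

text \<open>Positive homogeneity; a multiplier known at date \<open>k\<close> is known at all later
  dates too.\<close>

lemma hedged_scale:
  assumes "hedged k X" and v: "v \<in> borel_measurable (H k)" "\<And>w. 0 \<le> v w"
  shows "hedged k (\<lambda>w. v w *\<^sub>R X w)"
proof -
  obtain \<eta> where \<eta>: "\<And>s. s \<in> {k..T} \<Longrightarrow> \<eta> s \<in> strat s" "AE w in M. X w \<le> gain k \<eta> w"
    using assms(1) by (rule hedgedE) blast
  from AE_Fclass[of k] \<eta>(2)
  have "AE w in M. v w *\<^sub>R X w \<le> (\<Sum>s\<in>{k..T}. F s w (v w *\<^sub>R \<eta> s w))"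
  proof eventually_elim
    case (elim w)
    have "v w *\<^sub>R X w \<le> v w *\<^sub>R gain k \<eta> w"
      using elim v by (intro scaleR_left_mono) auto
    also have "\<dots> = (\<Sum>s\<in>{k..T}. F s w (v w *\<^sub>R \<eta> s w))"
      using elim v by (simp add: scaleR_sum_right Fclass_A_scale)
    finally show ?case .
  qed
  then show ?thesis unfolding hedged_def using \<eta>(1) v
    by (intro exI[of _ "\<lambda>s w. v w *\<^sub>R \<eta> s w"]) (auto intro!: L0_scale measurable_H_mono[of v k])
qed

lemma hedged_UN:
  assumes "finite I" and "\<And>i. i \<in> I \<Longrightarrow> B i \<in> sets (H k)"
    and "\<And>i. i \<in> I \<Longrightarrow> hedged k (\<lambda>w. indicator (B i) w *\<^sub>R X w)"
  shows "hedged k (\<lambda>w. indicator (\<Union>i\<in>I. B i) w *\<^sub>R X w)"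
  using assms
proof induction
  case empty
  then show ?case using hedged_zero by simp
next
  case (insert i I)
  let ?C = "\<Union>i\<in>I. B i"
  have [measurable]: "B i \<in> sets (H k)" "?C \<in> sets (H k)" using insert by auto
  \<comment> \<open>The sets may overlap and \<open>X\<close> has no sign, so only the part of
    \<open>B i\<close> outside \<open>?C\<close> is added.\<close>
  have "hedged k (\<lambda>w. indicator (B i - ?C) w *\<^sub>R (indicator (B i) w *\<^sub>R X w))"
    by (rule hedged_scale) (use insert in auto)
  with insert have "hedged k (\<lambda>w. indicator ?C w *\<^sub>R X w + indicator (B i - ?C) w *\<^sub>R (indicator (B i) w *\<^sub>R X w))"
    by (intro hedged_add) auto
  then show ?case
  proof (rule hedged_mono, intro AE_I2)
    fix w
    show "indicator (\<Union>i\<in>insert i I. B i) w *\<^sub>R X w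
        \<le> indicator ?C w *\<^sub>R X w + indicator (B i - ?C) w *\<^sub>R (indicator (B i) w *\<^sub>R X w)"
      by (cases "w \<in> ?C"; cases "w \<in> B i") auto
  qed
qed

definition closed_from :: "nat \<Rightarrow> bool" where
  "closed_from k \<longleftrightarrow> (\<forall>Xn X. (\<forall>n::nat. hedged k (Xn n)) \<longrightarrow> (AE w in M. (\<lambda>n. Xn n w) \<longlonglongrightarrow> X w) \<longrightarrow> hedged k X)"

lemma closed_fromD:
  assumes "closed_from k" "\<And>n. hedged k (Xn n)" "AE w in M. (\<lambda>n. Xn n w) \<longlonglongrightarrow> X w"
  shows "hedged k X"
  using assms(1)[unfolded closed_from_def, rule_format, of Xn X] assms(2,3) by blast

text \<open>Along a random subsequence the strategies of date \<open>k\<close> converge. Subtracting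
  their gains, convergent by continuity, leaves claims hedged from the next date on, where
  closedness is assumed. The last conclusion keeps \<open>\<theta> k\<close> as a pointwise cluster
  value, from which its norm and its zero entries are read off later.\<close>

lemma hedged_limit_of_nonescaping:
  assumes k: "k \<le> T" and cl: "closed_from (Suc k)"
    and \<eta>: "\<And>n s. s \<in> {k..T} \<Longrightarrow> \<eta> n s \<in> strat s"
    and dom: "\<And>n. AE w in M. Xn n w \<le> (\<Sum>s\<in>{k..T}. F s w (\<eta> n s w))"
    and lim: "AE w in M. (\<lambda>n. Xn n w) \<longlonglongrightarrow> X w"
    and ne: "\<And>w. w \<in> space M \<Longrightarrow> \<not> filterlim (\<lambda>n. norm (\<eta> n k w)) at_top sequentially"
  shows "\<exists>\<theta>. (\<forall>s\<in>{k..T}. \<theta> s \<in> strat s) \<and>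
      (AE w in M. X w \<le> gain k \<theta> w) \<and>
      (\<forall>w\<in>space M. \<exists>r::nat \<Rightarrow> nat. filterlim r sequentially sequentially \<and> (\<lambda>m. \<eta> (r m) k w) \<longlonglongrightarrow> \<theta> k w)"
proof -
  have \<eta>k: "\<eta> n k \<in> borel_measurable (H k)" for n using \<eta>[of k n] k by (auto intro: L0_measurable)
  obtain \<tau> :: "nat \<Rightarrow> 'a \<Rightarrow> nat" where \<tau>: "\<And>m. \<tau> m \<in> measurable (H k) (count_space UNIV)"
      "\<And>w m. w \<in> space M \<Longrightarrow> m \<le> \<tau> m w"
      "\<And>w. w \<in> space M \<Longrightarrow> convergent (\<lambda>m. \<eta> (\<tau> m w) k w)"
  proof -
    have "\<exists>\<tau>::nat \<Rightarrow> 'a \<Rightarrow> nat. (\<forall>m. \<tau> m \<in> measurable (H k) (count_space UNIV)) \<and>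
      (\<forall>w\<in>space (H k). (\<forall>m. m \<le> \<tau> m w) \<and> convergent (\<lambda>m. \<eta> (\<tau> m w) k w))"
      by (rule random_convergent_subseq[OF \<eta>k]) (use ne space_H[OF k] in auto)
    then show ?thesis using that unfolding space_H[OF k] by blast
  qed
  have \<tau>lim: "filterlim (\<lambda>m. \<tau> m w) sequentially sequentially" if "w \<in> space M" for w
    using \<tau>(2)[OF that] by (intro filterlim_at_top_mono[OF filterlim_ident]) auto
  \<comment> \<open>The index is measurable at date \<open>k\<close>, hence at every later date, so
    selecting strategies by it preserves adaptedness.\<close>
  have \<eta>\<tau>: "(\<lambda>w. \<eta> (\<tau> m w) s w) \<in> strat s" if s: "s \<in> {k..T}" for s m
  proof -
    have "AE w in M. \<forall>n. \<eta> n s w \<in> Acone" using L0_AE[OF \<eta>[OF s]] by (simp add: AE_all_countable)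
    then have "AE w in M. \<eta> (\<tau> m w) s w \<in> Acone" by eventually_elim simp
    moreover have "(\<lambda>w. \<eta> (\<tau> m w) s w) \<in> borel_measurable (H s)"
    proof (rule measurable_random_index[of "\<lambda>n. \<eta> n s"])
      show "\<eta> n s \<in> borel_measurable (H s)" for n using \<eta>[OF s] by (rule L0_measurable)
      show "\<tau> m \<in> measurable (H s) (count_space UNIV)" by (rule measurable_H_mono[OF \<tau>(1)]) (use s in auto)
    qed
    ultimately show ?thesis by (simp add: L0_def)
  qed
  define \<zeta> where "\<zeta> = (\<lambda>w. lim (\<lambda>m. \<eta> (\<tau> m w) k w))"
  have \<zeta>lim: "(\<lambda>m. \<eta> (\<tau> m w) k w) \<longlonglongrightarrow> \<zeta> w" if "w \<in> space M" for w
    using \<tau>(3)[OF that] by (simp add: \<zeta>_def convergent_LIMSEQ_iff)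
  have \<zeta>L: "\<zeta> \<in> strat k"
  proof -
    have "\<zeta> \<in> borel_measurable (H k)" unfolding \<zeta>_def
      using \<eta>\<tau>[of k] k by (intro borel_measurable_lim_metric L0_measurable) auto
    moreover have "AE w in M. \<forall>m. \<eta> (\<tau> m w) k w \<in> Acone" using L0_AE[OF \<eta>\<tau>[of k]] k by (simp add: AE_all_countable)
    then have "AE w in M. \<zeta> w \<in> Acone"
      using AE_space
    proof eventually_elim
      case (elim w)
      then show ?case by (intro closed_sequentially[OF closed_A _ \<zeta>lim]) auto
    qed
    ultimately show ?thesis by (simp add: L0_def)
  qed
  have split: "(\<Sum>s\<in>{k..T}. f s) = f k + (\<Sum>s\<in>{Suc k..T}. f s)" for f :: "nat \<Rightarrow> real^'d"
    using k by (simp add: sum.atLeast_Suc_atMost)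
  define Y where "Y = (\<lambda>m w. Xn (\<tau> m w) w - F k w (\<eta> (\<tau> m w) k w))"
  have "hedged (Suc k) (Y m)" for m
    unfolding hedged_def
  proof (intro exI[of _ "\<lambda>s w. \<eta> (\<tau> m w) s w"] conjI ballI \<eta>\<tau>)
    have "AE w in M. \<forall>n. Xn n w \<le> (\<Sum>s\<in>{k..T}. F s w (\<eta> n s w))" using dom by (simp add: AE_all_countable)
    then show "AE w in M. Y m w \<le> (\<Sum>s\<in>{Suc k..T}. F s w (\<eta> (\<tau> m w) s w))"
    proof eventually_elim
      case (elim w)
      then have "Xn (\<tau> m w) w \<le> F k w (\<eta> (\<tau> m w) k w) + (\<Sum>s\<in>{Suc k..T}. F s w (\<eta> (\<tau> m w) s w))"
        unfolding split by blast
      then show ?case by (simp add: Y_def diff_le_eq add.commute)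
    qed
  qed auto
  moreover have "AE w in M. (\<lambda>m. Y m w) \<longlonglongrightarrow> X w - F k w (\<zeta> w)"
    using lim AE_F_class[OF k] AE_space
  proof eventually_elim
    case (elim w)
    show ?case unfolding Y_def
      using filterlim_compose[OF elim(1) \<tau>lim[OF elim(3)]] Fclass_tendsto[OF elim(2) \<zeta>lim[OF elim(3)]]
      by (intro tendsto_diff) auto
  qed
  ultimately have "hedged (Suc k) (\<lambda>w. X w - F k w (\<zeta> w))" by (rule closed_fromD[OF cl])
  then obtain \<theta> where \<theta>: "\<And>s. s \<in> {Suc k..T} \<Longrightarrow> \<theta> s \<in> strat s"
      "AE w in M. X w - F k w (\<zeta> w) \<le> gain (Suc k) \<theta> w"
    by (rule hedgedE) blast
  show ?thesis
  proof (intro exI[of _ "\<theta>(k := \<zeta>)"] conjI ballI)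
    show "(\<theta>(k := \<zeta>)) s \<in> strat s" if "s \<in> {k..T}" for s
      using that \<theta>(1)[of s] \<zeta>L by auto
    show "AE w in M. X w \<le> (\<Sum>s\<in>{k..T}. F s w ((\<theta>(k := \<zeta>)) s w))"
      using \<theta>(2)
    proof eventually_elim
      case (elim w)
      have "(\<Sum>s\<in>{Suc k..T}. F s w ((\<theta>(k := \<zeta>)) s w)) = gain (Suc k) \<theta> w"
        by (intro sum.cong) auto
      then show ?case using elim unfolding split by (simp add: diff_le_eq add.commute)
    qed
    show "\<exists>r. filterlim r sequentially sequentially \<and> (\<lambda>m. \<eta> (r m) k w) \<longlonglongrightarrow> (\<theta>(k := \<zeta>)) k w" if "w \<in> space M" for w
      using \<tau>lim[OF that] \<zeta>lim[OF that] by auto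
  qed
qed

end

text \<open>The common consequence of both no-arbitrage alternatives. Reversibility is stated
  pathwise and not through \<open>N0set\<close>, because the closedness proof subtracts random
  multiples of reversible strategies at each \<open>w\<close>.\<close>

locale arbitrage_free_market = market M H T Acone F
  for M :: "'a measure" and H :: "nat \<Rightarrow> 'a measure" and T :: nat
    and Acone :: "('d::finite) mat set" and F :: "nat \<Rightarrow> 'a \<Rightarrow> 'd mat \<Rightarrow> real^'d" +
  assumes kernel: "\<And>\<eta>. (\<And>s. s \<le> T \<Longrightarrow> \<eta> s \<in> strat s) \<Longrightarrow>
      AE w in M. 0 \<le> (\<Sum>s\<le>T. F s w (\<eta> s w)) \<Longrightarrow>
      (AE w in M. (\<Sum>s\<le>T. F s w (\<eta> s w)) = 0) \<and>
      (\<forall>s\<le>T. AE w in M. - \<eta> s w \<in> Acone \<and> F s w (- \<eta> s w) = - F s w (\<eta> s w))"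
begin

text \<open>The strategy is extended by 0 to the dates before \<open>k\<close>.\<close>

lemma kernel_from:
  assumes \<eta>: "\<And>s. s \<in> {k..T} \<Longrightarrow> \<eta> s \<in> strat s"
    and nn: "AE w in M. 0 \<le> gain k \<eta> w"
  shows "AE w in M. gain k \<eta> w = 0"
    and "s \<in> {k..T} \<Longrightarrow> AE w in M. - \<eta> s w \<in> Acone \<and> F s w (- \<eta> s w) = - F s w (\<eta> s w)"
proof -
  define \<theta> where "\<theta> = (\<lambda>s. if k \<le> s then \<eta> s else (\<lambda>_. 0))"
  have \<theta>L: "\<theta> s \<in> strat s" if "s \<le> T" for s using \<eta>[of s] that L0_zero by (auto simp: \<theta>_def)
  have eq: "AE w in M. (\<Sum>s\<le>T. F s w (\<theta> s w)) = gain k \<eta> w"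
    using AE_Fclass[of 0]
  proof eventually_elim
    case (elim w)
    show ?case using elim by (intro sum.mono_neutral_cong_right) (auto simp: \<theta>_def Fclass_A_0)
  qed
  have "AE w in M. 0 \<le> (\<Sum>s\<le>T. F s w (\<theta> s w))" using eq nn by eventually_elim simp
  from kernel[of \<theta>, OF \<theta>L this] have K: "AE w in M. (\<Sum>s\<le>T. F s w (\<theta> s w)) = 0"
    "\<And>s. s \<le> T \<Longrightarrow> AE w in M. - \<theta> s w \<in> Acone \<and> F s w (- \<theta> s w) = - F s w (\<theta> s w)" by blast+
  show "AE w in M. gain k \<eta> w = 0" using K(1) eq by eventually_elim simp
  show "AE w in M. - \<eta> s w \<in> Acone \<and> F s w (- \<eta> s w) = - F s w (\<eta> s w)" if "s \<in> {k..T}"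
    using K(2)[of s] that by (auto simp: \<theta>_def)
qed

text \<open>Induction on the set \<open>J\<close> of coordinates in which the strategies at time \<open>k\<close> may be nonzero: where the
  strategies escape to infinity, their normalized limit lies in the kernel and can be used to
  cancel one more coordinate.\<close>

lemma hedged_limit_coordinates:
  assumes k: "k \<le> T" and cl: "closed_from (Suc k)"
  shows "\<lbrakk>finite J; \<And>n s. s \<in> {k..T} \<Longrightarrow> \<eta> n s \<in> strat s;
    \<And>n. AE w in M. Xn n w \<le> (\<Sum>s\<in>{k..T}. F s w (\<eta> n s w));
    AE w in M. (\<lambda>n. Xn n w) \<longlonglongrightarrow> X w;
    \<And>n w i j. w \<in> space M \<Longrightarrow> (i, j) \<notin> J \<Longrightarrow> \<eta> n k w $ i $ j = 0\<rbrakk> \<Longrightarrow> hedged k X"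
proof (induction J arbitrary: \<eta> Xn X rule: finite_psubset_induct)
  case (psubset J)
  note \<eta> = psubset.prems(1) and dom = psubset.prems(2) and lim = psubset.prems(3) and co = psubset.prems(4)
  have kT: "k \<in> {k..T}" using k by simp
  have \<eta>k[measurable]: "\<eta> n k \<in> borel_measurable (H k)" for n using \<eta>[OF kT] by (rule L0_measurable)
  \<comment> \<open>The event on which the strategies of date \<open>k\<close> escape to infinity;
    restricting the bounds to natural numbers makes it measurable.\<close>
  define O1 where "O1 = {w \<in> space (H k). \<forall>K::nat. \<exists>N. \<forall>n\<ge>N. real K \<le> norm (\<eta> n k w)}"
  have O1_sets[measurable]: "O1 \<in> sets (H k)" unfolding O1_def by measurable
  have O1_iff: "w \<in> O1 \<longleftrightarrow> filterlim (\<lambda>n. norm (\<eta> n k w)) at_top sequentially" if "w \<in> space M" for w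
  proof
    assume "w \<in> O1"
    then have "\<forall>\<^sub>F n in sequentially. real K \<le> norm (\<eta> n k w)" for K
      by (auto simp: O1_def eventually_sequentially)
    then show "filterlim (\<lambda>n. norm (\<eta> n k w)) at_top sequentially"
      unfolding filterlim_at_top
      by (meson eventually_mono order_trans real_arch_simple)
  next
    assume "filterlim (\<lambda>n. norm (\<eta> n k w)) at_top sequentially"
    then show "w \<in> O1" using that space_H[OF k]
      by (auto simp: O1_def filterlim_at_top eventually_sequentially)
  qed
  define O0 where "O0 = space (H k) - O1"
  have O0_sets[measurable]: "O0 \<in> sets (H k)" unfolding O0_def by measurable
  have scaled: "\<And>n s. s \<in> {k..T} \<Longrightarrow> (\<lambda>w. v n w *\<^sub>R \<eta> n s w) \<in> strat s"
    "\<And>n. AE w in M. v n w *\<^sub>R Xn n w \<le> (\<Sum>s\<in>{k..T}. F s w (v n w *\<^sub>R \<eta> n s w))"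
    if v: "\<And>n. v n \<in> borel_measurable (H k)" "\<And>n w. 0 \<le> v n w" for v :: "nat \<Rightarrow> 'a \<Rightarrow> real"
  proof -
    show "(\<lambda>w. v n w *\<^sub>R \<eta> n s w) \<in> strat s" if "s \<in> {k..T}" for n s
      using that v by (intro L0_scale \<eta> measurable_H_mono[OF v(1)]) auto
    show "AE w in M. v n w *\<^sub>R Xn n w \<le> (\<Sum>s\<in>{k..T}. F s w (v n w *\<^sub>R \<eta> n s w))" for n
      using dom[of n] AE_Fclass[of k]
    proof eventually_elim
      case (elim w)
      have "v n w *\<^sub>R Xn n w \<le> v n w *\<^sub>R (\<Sum>s\<in>{k..T}. F s w (\<eta> n s w))"
        using elim v by (intro scaleR_left_mono) auto
      also have "\<dots> = (\<Sum>s\<in>{k..T}. F s w (v n w *\<^sub>R \<eta> n s w))"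
        using elim v by (simp add: scaleR_sum_right Fclass_A_scale)
      finally show ?case .
    qed
  qed
  have hedged_O0: "hedged k (\<lambda>w. indicator O0 w *\<^sub>R X w)"
  proof -
    note sc = scaled[of "\<lambda>n. indicator O0"]
    have "\<exists>\<theta>. (\<forall>s\<in>{k..T}. \<theta> s \<in> strat s) \<and>
      (AE w in M. indicator O0 w *\<^sub>R X w \<le> gain k \<theta> w) \<and>
      (\<forall>w\<in>space M. \<exists>r::nat \<Rightarrow> nat. filterlim r sequentially sequentially \<and> (\<lambda>m. indicator O0 w *\<^sub>R \<eta> (r m) k w) \<longlonglongrightarrow> \<theta> k w)"
    proof (rule hedged_limit_of_nonescaping[OF k cl, of "\<lambda>n s w. indicator O0 w *\<^sub>R \<eta> n s w" "\<lambda>n w. indicator O0 w *\<^sub>R Xn n w"])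
      show "AE w in M. (\<lambda>n. indicator O0 w *\<^sub>R Xn n w) \<longlonglongrightarrow> indicator O0 w *\<^sub>R X w"
        using lim by eventually_elim (intro tendsto_intros)
      fix w assume w: "w \<in> space M"
      show "\<not> filterlim (\<lambda>n. norm (indicator O0 w *\<^sub>R \<eta> n k w)) at_top sequentially"
      proof (cases "w \<in> O0")
        case True
        then show ?thesis using O1_iff[OF w] by (simp add: O0_def)
      next
        case False
        have "\<not> filterlim (\<lambda>n::nat. 0::real) at_top sequentially"
          by (simp add: filterlim_at_top_gt[of _ _ 0] exI[of _ 1])
        with False show ?thesis by simp
      qed
    qed (use sc in auto)
    then show ?thesis unfolding hedged_def by blast
  qed
  \<comment> \<open>On \<open>O1\<close> the norms eventually exceed 1, so \<open>max 1\<close>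
    affects only finitely many indices at each \<open>w\<close> and guards against division by
    0.\<close>
  define v where "v = (\<lambda>n w. indicator O1 w / max 1 (norm (\<eta> n k w)))"
  have w_meas: "v n \<in> borel_measurable (H k)" for n unfolding v_def by measurable
  have w_nn: "0 \<le> v n w" for n w by (simp add: v_def)
  have w_le: "norm (v n w *\<^sub>R \<eta> n k w) \<le> 1" for n w
    by (cases "w \<in> O1") (auto simp: v_def divide_le_eq max_def)
  have O1_ev: "\<forall>\<^sub>F n in sequentially. K \<le> norm (\<eta> n k w)" if "w \<in> space M" "w \<in> O1" for w K
    using O1_iff[OF that(1)] that(2) by (simp add: filterlim_at_top)
  \<comment> \<open>The rescaled claims tend to 0 while the rescaled strategies of date
    \<open>k\<close> stay in the unit ball. Their limit therefore hedges 0, which makes it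
    reversible with zero total gain.\<close>
  have "\<exists>\<theta>. (\<forall>s\<in>{k..T}. \<theta> s \<in> strat s) \<and>
    (AE w in M. 0 \<le> gain k \<theta> w) \<and>
    (\<forall>w\<in>space M. \<exists>r::nat \<Rightarrow> nat. filterlim r sequentially sequentially \<and> (\<lambda>m. v (r m) w *\<^sub>R \<eta> (r m) k w) \<longlonglongrightarrow> \<theta> k w)"
  proof (rule hedged_limit_of_nonescaping[OF k cl, of "\<lambda>n s w. v n w *\<^sub>R \<eta> n s w" "\<lambda>n w. v n w *\<^sub>R Xn n w"])
    show "AE w in M. (\<lambda>n. v n w *\<^sub>R Xn n w) \<longlonglongrightarrow> 0"
      using lim AE_space
    proof eventually_elim
      case (elim w)
      have "(\<lambda>n. v n w) \<longlonglongrightarrow> 0"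
      proof (cases "w \<in> O1")
        case True
        have "filterlim (\<lambda>n. max 1 (norm (\<eta> n k w))) at_top sequentially"
          by (rule filterlim_at_top_mono[of "\<lambda>n. norm (\<eta> n k w)"]) (use O1_iff[OF elim(2)] True in auto)
        then have "(\<lambda>n. inverse (max 1 (norm (\<eta> n k w)))) \<longlonglongrightarrow> 0" by (rule tendsto_inverse_0_at_top)
        then show ?thesis using True by (simp add: v_def inverse_eq_divide)
      qed (simp add: v_def)
      from tendsto_scaleR[OF this elim(1)] show ?case by simp
    qed
    fix w assume "w \<in> space M"
    show "\<not> filterlim (\<lambda>n. norm (v n w *\<^sub>R \<eta> n k w)) at_top sequentially"
    proof
      assume "filterlim (\<lambda>n. norm (v n w *\<^sub>R \<eta> n k w)) at_top sequentially"
      then have "\<forall>\<^sub>F n in sequentially. 2 \<le> norm (v n w *\<^sub>R \<eta> n k w)" unfolding filterlim_at_top by blast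
      then obtain n where "2 \<le> norm (v n w *\<^sub>R \<eta> n k w)" using eventually_happens'[OF sequentially_bot] by blast
      with w_le[of n w] show False by linarith
    qed
  qed (use scaled[of v] w_meas w_nn in auto)
  then obtain \<theta> where \<theta>: "\<And>s. s \<in> {k..T} \<Longrightarrow> \<theta> s \<in> strat s"
    and \<theta>nn: "AE w in M. 0 \<le> gain k \<theta> w"
    and \<theta>lim: "\<forall>w\<in>space M. \<exists>r::nat \<Rightarrow> nat. filterlim r sequentially sequentially \<and> (\<lambda>m. v (r m) w *\<^sub>R \<eta> (r m) k w) \<longlonglongrightarrow> \<theta> k w"
    by blast
  have [measurable]: "\<theta> k \<in> borel_measurable (H k)" using \<theta>[OF kT] by (rule L0_measurable)
  have \<theta>J: "\<theta> k w $ i $ j = 0" if w: "w \<in> space M" "(i, j) \<notin> J" for w i j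
  proof -
    obtain r where "(\<lambda>m. v (r m) w *\<^sub>R \<eta> (r m) k w) \<longlonglongrightarrow> \<theta> k w" using bspec[OF \<theta>lim w(1)] by blast
    then have "(\<lambda>m. (v (r m) w *\<^sub>R \<eta> (r m) k w) $ i $ j) \<longlonglongrightarrow> \<theta> k w $ i $ j" by (intro tendsto_vec_nth)
    then show ?thesis using co[OF w] by (simp add: LIMSEQ_const_iff)
  qed
  have \<theta>1: "norm (\<theta> k w) = 1" if w: "w \<in> space M" "w \<in> O1" for w
  proof -
    obtain r :: "nat \<Rightarrow> nat" where r: "filterlim r sequentially sequentially" "(\<lambda>m. v (r m) w *\<^sub>R \<eta> (r m) k w) \<longlonglongrightarrow> \<theta> k w"
      using bspec[OF \<theta>lim w(1)] by blast
    have "\<forall>\<^sub>F n in sequentially. norm (v n w *\<^sub>R \<eta> n k w) = 1"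
      using O1_ev[OF w, of 1] by eventually_elim (use w in \<open>auto simp: v_def max_def\<close>)
    then have "\<forall>\<^sub>F m in sequentially. norm (v (r m) w *\<^sub>R \<eta> (r m) k w) = 1"
      by (rule eventually_compose_filterlim[OF _ r(1)])
    then have "(\<lambda>m. norm (v (r m) w *\<^sub>R \<eta> (r m) k w)) \<longlonglongrightarrow> 1" by (rule tendsto_eventually)
    then show ?thesis using tendsto_norm[OF r(2)] LIMSEQ_unique by blast
  qed
  have K0: "AE w in M. gain k \<theta> w = 0" by (rule kernel_from(1)[OF \<theta> \<theta>nn])
  have K1: "AE w in M. \<forall>s\<in>{k..T}. - \<theta> s w \<in> Acone \<and> F s w (- \<theta> s w) = - F s w (\<theta> s w)"
    using kernel_from(2)[OF \<theta> \<theta>nn] by (intro AE_finite_allI) auto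
  have K2: "AE w in M. \<forall>s\<in>{k..T}. \<theta> s w \<in> Acone" using \<theta> by (intro AE_finite_allI L0_AE) auto
  define B where "B = (\<lambda>(i, j). {w \<in> O1. \<theta> k w $ i $ j \<noteq> 0})"
  have comp[measurable]: "(\<lambda>w. f w $ i $ j) \<in> borel_measurable (H k)" if "f \<in> borel_measurable (H k)" for f and i j
    by (rule borel_measurable_continuous_on[OF _ that]) (intro continuous_intros)
  have B_sets: "B p \<in> sets (H k)" for p
  proof (cases p)
    case (Pair i j)
    have "B p = {w \<in> space (H k). \<theta> k w $ i $ j \<noteq> 0} \<inter> O1"
      using sets.sets_into_space[OF O1_sets] by (auto simp: B_def Pair)
    also have "\<dots> \<in> sets (H k)" using comp[of "\<theta> k" i j] by (intro sets.Int) measurable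
    finally show ?thesis .
  qed
  have hedged_B: "hedged k (\<lambda>w. indicator (B p) w *\<^sub>R X w)" if p: "p \<in> J" for p
  proof -
    obtain i j where ij: "p = (i, j)" by (cases p)
    \<comment> \<open>The multiple of \<open>\<theta>\<close> that cancels entry
      \<open>(i, j)\<close> of \<open>\<eta> n k\<close> on \<open>B p\<close>. It is measurable at
      date \<open>k\<close>, so the same multiple may be subtracted at all later dates.\<close>
    define \<beta> where "\<beta> = (\<lambda>n w. \<eta> n k w $ i $ j / \<theta> k w $ i $ j)"
    have \<beta>_meas: "\<beta> n \<in> borel_measurable (H k)" for n
      unfolding \<beta>_def by (intro borel_measurable_divide comp) auto
    define \<eta>' where "\<eta>' = (\<lambda>n s w. indicator (B p) w *\<^sub>R (\<eta> n s w - \<beta> n w *\<^sub>R \<theta> s w))"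
    show ?thesis
    proof (rule psubset.IH[of "J - {p}" \<eta>' "\<lambda>n w. indicator (B p) w *\<^sub>R Xn n w"])
      show "J - {p} \<subset> J" using p by auto
      show "AE w in M. (\<lambda>n. indicator (B p) w *\<^sub>R Xn n w) \<longlonglongrightarrow> indicator (B p) w *\<^sub>R X w"
        using lim by eventually_elim (intro tendsto_intros)
      show "\<eta>' n s \<in> strat s" if s: "s \<in> {k..T}" for n s
      proof -
        have "AE w in M. \<eta>' n s w \<in> Acone"
          using K1 K2 AE_Fclass[of k] L0_AE[OF \<eta>[OF s, of n]]
        proof eventually_elim
          case (elim w)
          show ?case unfolding \<eta>'_def using elim s
            by (intro convex_cone_scaleR[OF cone_A] Fclass_minus_kernel(1)[OF cone_A, of "F s w"]) auto
        qed
        moreover have "\<eta>' n s \<in> borel_measurable (H s)"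
        proof -
          have [measurable]: "\<beta> n \<in> borel_measurable (H s)" "B p \<in> sets (H s)" "\<eta> n s \<in> borel_measurable (H s)" "\<theta> s \<in> borel_measurable (H s)"
            using s \<eta> \<theta> B_sets[of p] sub_mono[of k s] by (auto intro!: L0_measurable measurable_H_mono[OF \<beta>_meas] simp: subalgebra_def)
          show ?thesis unfolding \<eta>'_def by measurable
        qed
        ultimately show ?thesis by (simp add: L0_def)
      qed
      show "AE w in M. indicator (B p) w *\<^sub>R Xn n w \<le> (\<Sum>s\<in>{k..T}. F s w (\<eta>' n s w))" for n
      proof -
        have "AE w in M. \<forall>s\<in>{k..T}. \<eta> n s w \<in> Acone" using \<eta> by (intro AE_finite_allI L0_AE) auto
        with dom[of n] K0 K1 K2 AE_Fclass[of k] show ?thesis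
        proof eventually_elim
          case (elim w)
          let ?b = "indicator (B p) w :: real"
          \<comment> \<open>The total gain of \<open>\<theta>\<close> is 0, so subtracting a
            multiple of it costs nothing.\<close>
          have "Xn n w \<le> (\<Sum>s\<in>{k..T}. F s w (\<eta> n s w)) - \<beta> n w *\<^sub>R gain k \<theta> w"
            using elim(1,2) by simp
          also have "\<dots> = (\<Sum>s\<in>{k..T}. F s w (\<eta> n s w) - \<beta> n w *\<^sub>R F s w (\<theta> s w))"
            by (simp add: sum_subtractf scaleR_sum_right)
          also have "\<dots> \<le> (\<Sum>s\<in>{k..T}. F s w (\<eta> n s w - \<beta> n w *\<^sub>R \<theta> s w))"
            using elim by (intro sum_mono Fclass_minus_kernel(2)[OF cone_A]) auto
          finally have "?b *\<^sub>R Xn n w \<le> ?b *\<^sub>R (\<Sum>s\<in>{k..T}. F s w (\<eta> n s w - \<beta> n w *\<^sub>R \<theta> s w))"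
            by (intro scaleR_left_mono) auto
          also have "\<dots> = (\<Sum>s\<in>{k..T}. F s w (\<eta>' n s w))"
            using elim(5) by (simp add: \<eta>'_def scaleR_sum_right Fclass_A_scale)
          finally show ?case .
        qed
      qed
      show "\<eta>' n k w $ i' $ j' = 0" if w: "w \<in> space M" and ij': "(i', j') \<notin> J - {p}" for n w i' j'
      proof (cases "(i', j') = p")
        case True
        then show ?thesis unfolding \<eta>'_def ij by (auto simp: B_def \<beta>_def indicator_def)
      next
        case False
        then show ?thesis unfolding \<eta>'_def using co[OF w, of i' j' n] \<theta>J[OF w, of i' j'] ij' by auto
      qed
    qed
  qed
  \<comment> \<open>On \<open>O1\<close> the limit has norm 1 and its nonzero entries lie in
    \<open>J\<close>, so one of them can be eliminated. For empty \<open>J\<close> this says that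
    \<open>O1\<close> is empty, which starts the induction.\<close>
  have O1_sub: "O1 \<subseteq> (\<Union>p\<in>J. B p)"
  proof
    fix w assume w: "w \<in> O1"
    then have wM: "w \<in> space M" using space_H[OF k] by (auto simp: O1_def)
    have "\<theta> k w \<noteq> 0" using \<theta>1[OF wM w] by auto
    then obtain i j where "\<theta> k w $ i $ j \<noteq> 0" by (auto simp: vec_eq_iff)
    then show "w \<in> (\<Union>p\<in>J. B p)" using \<theta>J[OF wM, of i j] w by (auto simp: B_def intro!: bexI[of _ "(i, j)"])
  qed
  have "hedged k (\<lambda>w. indicator (\<Union>p\<in>J. B p) w *\<^sub>R X w)"
    using psubset.hyps hedged_B B_sets by (intro hedged_UN) auto
  moreover have "w \<in> (\<Union>p\<in>J. B p) \<longleftrightarrow> w \<in> O1" for w using O1_sub by (auto simp: B_def)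
  ultimately have "hedged k (\<lambda>w. indicator O1 w *\<^sub>R X w)" by (simp add: indicator_def)
  with hedged_O0 have "hedged k (\<lambda>w. indicator O0 w *\<^sub>R X w + indicator O1 w *\<^sub>R X w)" by (rule hedged_add)
  then show ?case
    by (rule hedged_mono) (intro AE_I2, auto simp: O0_def space_H[OF k] indicator_def)
qed

lemma closed_from: "closed_from k"
proof -
  have step: "closed_from k" if "k \<le> T" "closed_from (Suc k)" for k
    unfolding closed_from_def
  proof (intro allI impI)
    fix Xn X assume hX: "\<forall>n. hedged k (Xn n)" and lim: "AE w in M. (\<lambda>n. Xn n w) \<longlonglongrightarrow> X w"
    have "\<forall>n. \<exists>\<eta>. (\<forall>s\<in>{k..T}. \<eta> s \<in> strat s) \<and> (AE w in M. Xn n w \<le> gain k \<eta> w)"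
      using hX unfolding hedged_def .
    from choice[OF this] obtain \<eta> where \<eta>: "\<forall>n. (\<forall>s\<in>{k..T}. \<eta> n s \<in> strat s) \<and>
        (AE w in M. Xn n w \<le> (\<Sum>s\<in>{k..T}. F s w (\<eta> n s w)))" ..
    show "hedged k X"
      by (rule hedged_limit_coordinates[OF that, of UNIV \<eta> Xn]) (use lim \<eta> in auto)
  qed
  have base: "closed_from k" if "T < k" for k
    unfolding closed_from_def
  proof (intro allI impI)
    fix Xn X assume 1: "\<forall>n. hedged k (Xn n)" and lim: "AE w in M. (\<lambda>n. Xn n w) \<longlonglongrightarrow> X w"
    have "AE w in M. \<forall>n. Xn n w \<le> 0"
      using 1 that by (simp add: hedged_def AE_all_countable)
    with lim have "AE w in M. X w \<le> 0"
    proof eventually_elim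
      case (elim w)
      show ?case unfolding less_eq_vec_def
      proof
        fix i
        have "(\<lambda>n. Xn n w $ i) \<longlonglongrightarrow> X w $ i" using elim(1) by (rule tendsto_vec_nth)
        then show "X w $ i \<le> 0 $ i"
          by (rule LIMSEQ_le_const2) (use elim(2) in \<open>auto simp: less_eq_vec_def\<close>)
      qed
    qed
    then show "hedged k X" using that by (simp add: hedged_def)
  qed
  show ?thesis
  proof (cases "k \<le> Suc T")
    case True
    then show ?thesis
      by (induction rule: inc_induct) (use base[of "Suc T"] step in auto)
  next
    case False
    then show ?thesis by (intro base) auto
  qed
qed

end

section \<open>Exhaustion\<close>

text \<open>The polar cone within the bounded functions. Since \<open>A\<close> may contain
  non-integrable claims, the pairing is tested on its integrable members only.\<close>

definition polar :: "'a measure \<Rightarrow> ('a \<Rightarrow> 'b::euclidean_space) set \<Rightarrow> ('a \<Rightarrow> 'b) set" where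
  "polar M A = {Z. Z \<in> borel_measurable M \<and> (\<exists>C. \<forall>w. norm (Z w) \<le> C) \<and>
     (\<forall>X\<in>A. integrable M X \<longrightarrow> (\<integral>w. Z w \<bullet> X w \<partial>M) \<le> 0)}"

lemma integrable_bounded_inner:
  fixes Z X :: "'a \<Rightarrow> 'b::euclidean_space"
  assumes [measurable]: "Z \<in> borel_measurable M" and C: "AE w in M. norm (Z w) \<le> C" and X: "integrable M X"
  shows "integrable M (\<lambda>w. Z w \<bullet> X w)"
proof (rule Bochner_Integration.integrable_bound[of M "\<lambda>w. C * norm (X w)"])
  have [measurable]: "X \<in> borel_measurable M" using X by auto
  show "(\<lambda>w. Z w \<bullet> X w) \<in> borel_measurable M" by measurable
  show "AE w in M. norm (Z w \<bullet> X w) \<le> norm (C * norm (X w))"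
    using C
  proof eventually_elim
    case (elim w)
    have "\<bar>Z w \<bullet> X w\<bar> \<le> norm (Z w) * norm (X w)" by (rule Cauchy_Schwarz_ineq2)
    also have "\<dots> \<le> C * norm (X w)" using elim by (intro mult_right_mono) auto
    also have "\<dots> \<le> \<bar>C * norm (X w)\<bar>" by simp
    finally show ?case by simp
  qed
qed (use X in auto)

lemma polarD:
  assumes "Z \<in> polar M A"
  shows "Z \<in> borel_measurable M" and "\<exists>C. \<forall>w. norm (Z w) \<le> C"
    and "X \<in> A \<Longrightarrow> integrable M X \<Longrightarrow> (\<integral>w. Z w \<bullet> X w \<partial>M) \<le> 0"
    and "integrable M X \<Longrightarrow> integrable M (\<lambda>w. Z w \<bullet> X w)"
proof -
  show m: "Z \<in> borel_measurable M" and ex: "\<exists>C. \<forall>w. norm (Z w) \<le> C"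
    and "X \<in> A \<Longrightarrow> integrable M X \<Longrightarrow> (\<integral>w. Z w \<bullet> X w \<partial>M) \<le> 0"
    using assms unfolding polar_def by auto
  show "integrable M X \<Longrightarrow> integrable M (\<lambda>w. Z w \<bullet> X w)"
    using ex by (auto intro: integrable_bounded_inner[OF m])
qed

lemma polar_add:
  assumes Z: "Z \<in> polar M A" and Z': "Z' \<in> polar M A"
  shows "(\<lambda>w. Z w + Z' w) \<in> polar M A"
proof -
  obtain C C' where C: "\<And>w. norm (Z w) \<le> C" "\<And>w. norm (Z' w) \<le> C'" using polarD(2)[OF Z] polarD(2)[OF Z'] by auto
  have "norm (Z w + Z' w) \<le> C + C'" for w by (rule norm_triangle_mono[OF C])
  moreover have "(\<integral>w. (Z w + Z' w) \<bullet> X w \<partial>M) \<le> 0" if "X \<in> A" "integrable M X" for X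
    using polarD(3,4)[OF Z] polarD(3,4)[OF Z'] that by (simp add: inner_add_left add_nonpos_nonpos)
  ultimately show ?thesis using polarD(1)[OF Z] polarD(1)[OF Z'] unfolding polar_def by auto
qed

lemma (in sigma_finite_subalgebra) real_cond_exp_nonneg_of_set_integrals:
  assumes f: "integrable M f" and nn: "\<And>B. B \<in> sets F \<Longrightarrow> 0 \<le> (\<integral>w. indicator B w * f w \<partial>M)"
  shows "AE w in M. 0 \<le> real_cond_exp M F f w"
proof -
  let ?g = "real_cond_exp M F f"
  define B where "B = {w \<in> space F. ?g w < 0}"
  have B[measurable]: "B \<in> sets F" unfolding B_def by measurable
  have BM: "B \<in> sets M" using B subalg by (auto simp: subalgebra_def)
  have i: "integrable M (\<lambda>w. indicator B w * ?g w)"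
    using integrable_mult_indicator[OF BM real_cond_exp_int(1)[OF f]] by simp
  have "0 \<le> (\<integral>w. indicator B w * ?g w \<partial>M)"
    using nn[OF B] real_cond_exp_intA[OF f B] by (simp add: set_lebesgue_integral_def)
  moreover have np: "0 \<le> - (indicator B w * ?g w)" for w by (auto simp: B_def indicator_def)
  then have "0 \<le> (\<integral>w. - (indicator B w * ?g w) \<partial>M)" by (intro Bochner_Integration.integral_nonneg)
  ultimately have "(\<integral>w. - (indicator B w * ?g w) \<partial>M) = 0" by simp
  then have "AE w in M. - (indicator B w * ?g w) = 0"
    using integral_nonneg_eq_0_iff_AE[of M "\<lambda>w. - (indicator B w * ?g w)"] i np by simp
  with AE_space show ?thesis
  proof eventually_elim
    case (elim w)
    then show ?case using subalg by (auto simp: B_def indicator_def subalgebra_def not_le)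
  qed
qed

context prob_space
begin

text \<open>The dual element minimizes the probability of the event where its conditional price of \<open>V\<close> fails to
  be positive; if \<open>V\<close> on that event were outside the cone, a separating functional would shrink it further.\<close>

lemma polar_exhaust:
  fixes A :: "('a \<Rightarrow> 'b::euclidean_space) set" and V :: "'a \<Rightarrow> 'b"
  assumes A: "closed_cone M A"
    and G: "subalgebra M G" and V: "integrable M V"
    and nn: "\<And>Z. Z \<in> polar M A \<Longrightarrow> AE w in M. 0 \<le> real_cond_exp M G (\<lambda>w. Z w \<bullet> V w) w"
  shows "\<exists>Z\<in>polar M A. \<exists>B\<in>sets G. (AE w in M. real_cond_exp M G (\<lambda>w. Z w \<bullet> V w) w \<le> 0 \<longrightarrow> w \<in> B) \<and>
      (\<lambda>w. indicator B w *\<^sub>R V w) \<in> A"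
proof -
  interpret G: sigma_finite_subalgebra M G by (rule sigma_finite_sub[OF prob_space_axioms G])
  define q where "q = (\<lambda>Z. real_cond_exp M G (\<lambda>w. Z w \<bullet> V w))"
  define N where "N = (\<lambda>Z. {w \<in> space G. q Z w \<le> 0})"
  have N_sets: "N Z \<in> sets G" for Z unfolding N_def q_def by measurable
  have N_M[measurable]: "N Z \<in> sets M" for Z using N_sets G by (auto simp: subalgebra_def)
  have sp: "space G = space M" using G by (simp add: subalgebra_def)
  have N_iff: "w \<in> N Z \<longleftrightarrow> q Z w \<le> 0" if "w \<in> space M" for Z w using that by (simp add: N_def sp)
  have q_nn: "AE w in M. 0 \<le> q Z w" if "Z \<in> polar M A" for Z unfolding q_def by (rule nn[OF that])
  have q_add: "AE w in M. q (\<lambda>w. Z w + Z' w) w = q Z w + q Z' w" if "Z \<in> polar M A" "Z' \<in> polar M A" for Z Z'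
    unfolding q_def inner_add_left using that V by (intro G.real_cond_exp_add polarD(4)) auto
  have polar0: "(\<lambda>_. 0) \<in> polar M A" by (auto simp: polar_def intro: exI[of _ 0])
  define \<alpha> where "\<alpha> = Inf ((\<lambda>Z. prob (N Z)) ` polar M A)"
  have \<alpha>_le: "\<alpha> \<le> prob (N Z)" if "Z \<in> polar M A" for Z
    unfolding \<alpha>_def by (rule cInf_lower) (use that in \<open>auto intro!: bdd_belowI[of _ 0]\<close>)
  have "\<exists>Z\<in>polar M A. prob (N Z) < \<alpha> + 1 / real (Suc n)" for n
  proof -
    have "Inf ((\<lambda>Z. prob (N Z)) ` polar M A) < \<alpha> + 1 / real (Suc n)" by (simp add: \<alpha>_def)
    from cInf_lessD[OF _ this] show ?thesis using polar0 by auto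
  qed
  then obtain Zn where Zn: "\<And>n. Zn n \<in> polar M A" "\<And>n. prob (N (Zn n)) < \<alpha> + 1 / real (Suc n)" by metis
  obtain C where C: "\<And>n w. norm (Zn n w) \<le> C n" using polarD(2)[OF Zn(1)] by metis
  have C0: "0 \<le> C n" for n using C[of n undefined] norm_ge_zero order_trans by blast
  \<comment> \<open>These coefficients bound the \<open>n\<close>-th term by \<open>(1/2)^n\<close>,
    so the series of dual elements converges uniformly.\<close>
  define c where "c = (\<lambda>n. (1/2)^n / (1 + C n))"
  have c_pos: "0 < c n" for n using C0[of n] by (simp add: c_def add_pos_nonneg)
  \<comment> \<open>General coefficients let the full series, the series without its
    \<open>m\<close>-th term and that term alone be treated at once.\<close>
  define W where "W = (\<lambda>a w. \<Sum>n. a n *\<^sub>R Zn n w)"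
  have term_le: "norm (a n *\<^sub>R Zn n w) \<le> (1/2)^n" if a: "\<And>n. 0 \<le> a n \<and> a n \<le> c n" for a n w
  proof -
    have "norm (a n *\<^sub>R Zn n w) \<le> c n * C n" using a[of n] C[of n w] C0[of n] by (auto intro!: mult_mono)
    also have "\<dots> \<le> c n * (1 + C n)" using c_pos[of n] by (intro mult_left_mono) auto
    also have "\<dots> = (1/2)^n" using C0[of n] by (simp add: c_def add_nonneg_eq_0_iff)
    finally show ?thesis .
  qed
  have geo: "summable (\<lambda>n. (1/2)^n :: real)" "(\<Sum>n. (1/2)^n :: real) = 2"
    by (auto simp: summable_geometric suminf_geometric)
  have W_sum: "summable (\<lambda>n. a n *\<^sub>R Zn n w)" if a: "\<And>n. 0 \<le> a n \<and> a n \<le> c n" for a w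
    by (rule summable_comparison_test[OF _ geo(1)]) (use term_le[OF a] in auto)
  have part_le: "norm (\<Sum>n<k. a n *\<^sub>R Zn n w) \<le> 2" if a: "\<And>n. 0 \<le> a n \<and> a n \<le> c n" for a w k
  proof -
    have "norm (\<Sum>n<k. a n *\<^sub>R Zn n w) \<le> (\<Sum>n<k. (1/2)^n)" using term_le[OF a] by (intro sum_norm_le) auto
    also have "\<dots> \<le> (\<Sum>n. (1/2)^n)" by (rule sum_le_suminf[OF geo(1)]) auto
    finally show ?thesis using geo(2) by simp
  qed
  have W_polar: "W a \<in> polar M A" if a: "\<And>n. 0 \<le> a n \<and> a n \<le> c n" for a
  proof -
    have Wl: "(\<lambda>k. \<Sum>n<k. a n *\<^sub>R Zn n w) \<longlonglongrightarrow> W a w" for w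
      unfolding W_def by (rule summable_LIMSEQ[OF W_sum[OF a]])
    have Wn: "norm (W a w) \<le> 2" for w
      by (rule LIMSEQ_le_const2[OF tendsto_norm[OF Wl]]) (use part_le[OF a] in auto)
    have pm[measurable]: "(\<lambda>w. \<Sum>n<k. a n *\<^sub>R Zn n w) \<in> borel_measurable M" for k
      using polarD(1)[OF Zn(1)] by (intro borel_measurable_sum borel_measurable_scaleR) auto
    have Wm[measurable]: "W a \<in> borel_measurable M" by (rule borel_measurable_LIMSEQ_metric[OF pm Wl])
    have "(\<integral>w. W a w \<bullet> X w \<partial>M) \<le> 0" if X: "X \<in> A" "integrable M X" for X
    proof -
      have [measurable]: "X \<in> borel_measurable M" using X by auto
      have "(\<lambda>k. \<integral>w. (\<Sum>n<k. a n *\<^sub>R Zn n w) \<bullet> X w \<partial>M) \<longlonglongrightarrow> (\<integral>w. W a w \<bullet> X w \<partial>M)"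
      proof (rule integral_dominated_convergence[where w="\<lambda>w. 2 * norm (X w)"])
        show "AE w in M. (\<lambda>k. (\<Sum>n<k. a n *\<^sub>R Zn n w) \<bullet> X w) \<longlonglongrightarrow> W a w \<bullet> X w"
          by (intro AE_I2 tendsto_inner Wl tendsto_const)
        show "AE w in M. norm ((\<Sum>n<k. a n *\<^sub>R Zn n w) \<bullet> X w) \<le> 2 * norm (X w)" for k
        proof (rule AE_I2)
          fix w
          have "norm ((\<Sum>n<k. a n *\<^sub>R Zn n w) \<bullet> X w) \<le> norm (\<Sum>n<k. a n *\<^sub>R Zn n w) * norm (X w)"
            using Cauchy_Schwarz_ineq2 by simp
          also have "\<dots> \<le> 2 * norm (X w)" using part_le[OF a] by (intro mult_right_mono) auto
          finally show "norm ((\<Sum>n<k. a n *\<^sub>R Zn n w) \<bullet> X w) \<le> 2 * norm (X w)" .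
        qed
        show "integrable M (\<lambda>w. 2 * norm (X w))" using X by simp
      qed measurable
      moreover have "(\<integral>w. (\<Sum>n<k. a n *\<^sub>R Zn n w) \<bullet> X w \<partial>M) \<le> 0" for k
      proof -
        have "(\<integral>w. (\<Sum>n<k. a n *\<^sub>R Zn n w) \<bullet> X w \<partial>M) = (\<Sum>n<k. a n * (\<integral>w. Zn n w \<bullet> X w \<partial>M))"
          unfolding inner_sum_left inner_scaleR_left using polarD(4)[OF Zn(1) X(2)]
          by (subst Bochner_Integration.integral_sum) auto
        also have "\<dots> \<le> 0" using polarD(3)[OF Zn(1) X] a by (intro sum_nonpos mult_nonneg_nonpos) auto
        finally show ?thesis .
      qed
      ultimately show ?thesis by (intro LIMSEQ_le_const2) auto
    qed
    then show ?thesis unfolding polar_def using Wn Wm by auto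
  qed
  define Z where "Z = W c"
  have ZP: "Z \<in> polar M A" unfolding Z_def by (rule W_polar) (use c_pos less_imp_le in auto)
  have NZ: "prob (N Z) \<le> prob (N (Zn m))" for m
  proof (rule finite_measure_mono_AE)
    \<comment> \<open>All conditional prices are nonnegative under polar elements, so dropping
      \<open>R\<close> can only lower the price: where it fails to be positive under
      \<open>Z\<close>, it also fails under \<open>Zn m\<close>.\<close>
    define R where "R = W (c(m := 0))"
    have RP: "R \<in> polar M A" unfolding R_def by (rule W_polar) (use c_pos less_imp_le in auto)
    have s2: "(\<lambda>n. ((\<lambda>_. 0)(m := c m)) n *\<^sub>R Zn n w) sums (c m *\<^sub>R Zn m w)" for w
      using sums_single[of m "\<lambda>n. c m *\<^sub>R Zn m w"] by (rule back_subst[where P="\<lambda>f. f sums _"]) auto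
    have "W ((\<lambda>_. 0)(m := c m)) \<in> polar M A" by (rule W_polar) (use c_pos less_imp_le in auto)
    moreover have "W ((\<lambda>_. 0)(m := c m)) = (\<lambda>w. c m *\<^sub>R Zn m w)" using s2 by (simp add: W_def sums_iff fun_eq_iff)
    ultimately have mP: "(\<lambda>w. c m *\<^sub>R Zn m w) \<in> polar M A" by simp
    have Zsplit: "Z = (\<lambda>w. R w + c m *\<^sub>R Zn m w)"
    proof
      fix w
      have s1: "(\<lambda>n. (c(m := 0)) n *\<^sub>R Zn n w) sums R w" unfolding R_def W_def
        by (rule summable_sums[OF W_sum]) (use c_pos less_imp_le in auto)
      have "(\<lambda>n. c n *\<^sub>R Zn n w) sums (R w + c m *\<^sub>R Zn m w)"
        using sums_add[OF s1 s2] by (rule back_subst[where P="\<lambda>f. f sums _"]) auto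
      then show "Z w = R w + c m *\<^sub>R Zn m w" by (simp add: Z_def W_def sums_iff)
    qed
    have "AE w in M. q (\<lambda>w. c m *\<^sub>R Zn m w) w = c m * q (Zn m) w"
      unfolding q_def inner_scaleR_left using polarD(4)[OF Zn(1) V] by (rule G.real_cond_exp_cmult)
    with q_add[OF RP mP] q_nn[OF RP] AE_space
    show "AE w in M. w \<in> N Z \<longrightarrow> w \<in> N (Zn m)"
    proof eventually_elim
      case (elim w)
      have "c m * q (Zn m) w \<le> 0" if "q Z w \<le> 0" using that elim unfolding Zsplit by linarith
      then show ?case using elim c_pos[of m] by (auto simp: N_iff mult_le_0_iff)
    qed
  qed measurable
  have "prob (N Z) \<le> \<alpha>"
  proof (rule field_le_epsilon)
    fix e :: real assume "0 < e"
    then obtain n where "1 / real (Suc n) < e" using nat_approx_posE by blast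
    then show "prob (N Z) \<le> \<alpha> + e" using NZ[of n] Zn(2)[of n] by linarith
  qed
  have "(\<lambda>w. indicator (N Z) w *\<^sub>R V w) \<in> A"
  proof (rule ccontr)
    assume notA: "(\<lambda>w. indicator (N Z) w *\<^sub>R V w) \<notin> A"
    have VN: "integrable M (\<lambda>w. indicator (N Z) w *\<^sub>R V w)" by (rule integrable_mult_indicator[OF N_M V])
    obtain Z' where Z': "Z' \<in> polar M A" and pos: "0 < (\<integral>w. Z' w \<bullet> (indicator (N Z) w *\<^sub>R V w) \<partial>M)"
      using L1_separation[OF A VN notA] unfolding polar_def by blast
    have Z'V: "integrable M (\<lambda>w. Z' w \<bullet> V w)" by (rule polarD(4)[OF Z' V])
    define S where "S = (\<lambda>w. Z w + Z' w)"
    have SP: "S \<in> polar M A" unfolding S_def by (rule polar_add[OF ZP Z'])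
    have sub: "AE w in M. w \<in> N S \<longrightarrow> w \<in> N Z \<and> q Z' w \<le> 0"
      using q_add[OF ZP Z'] q_nn[OF ZP] q_nn[OF Z'] AE_space
      by eventually_elim (auto simp: N_iff S_def)
    \<comment> \<open>Adding \<open>Z'\<close> can only shrink the bad event, and minimality forbids
      a loss of probability. Hence the price under \<open>Z'\<close> is nonpositive on
      \<open>N Z\<close>, against the separation.\<close>
    have "prob (N Z - N S) = 0"
    proof -
      have "prob (N Z - N S) = prob (N Z) - prob (N Z \<inter> N S)"
        by (rule finite_measure_Diff') measurable
      also have "prob (N Z \<inter> N S) = prob (N S)"
        by (rule finite_measure_eq_AE) (use sub in \<open>auto elim!: eventually_mono\<close>)
      finally show ?thesis using \<alpha>_le[OF SP] \<open>prob (N Z) \<le> \<alpha>\<close> measure_nonneg[of M "N Z - N S"] by linarith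
    qed
    then have "AE w in M. w \<notin> N Z - N S" using prob_eq_0[of "N Z - N S"] by simp
    with sub have le: "AE w in M. indicator (N Z) w * q Z' w \<le> 0"
      by eventually_elim (auto simp: indicator_def)
    have "(\<integral>w. Z' w \<bullet> (indicator (N Z) w *\<^sub>R V w) \<partial>M) = (\<integral>w. indicator (N Z) w * q Z' w \<partial>M)"
      using G.real_cond_exp_intA[OF Z'V N_sets, of Z] by (simp add: q_def set_lebesgue_integral_def)
    also have "\<dots> \<le> (\<integral>w. 0 \<partial>M)"
      using le integrable_mult_indicator[OF N_M G.real_cond_exp_int(1)[OF Z'V]] by (intro integral_mono_AE) (auto simp: q_def)
    finally show False using pos by simp
  qed
  moreover have "AE w in M. q Z w \<le> 0 \<longrightarrow> w \<in> N Z" using AE_space by eventually_elim (simp add: N_iff)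
  ultimately show ?thesis using ZP N_sets[of Z] unfolding q_def by blast
qed

text \<open>Every price involved is nonnegative under all polar elements, so a price that is
  positive under one summand stays positive under a sum. The dual elements found for the single
  pairs can therefore be added.\<close>

lemma polar_exhaust_finite:
  fixes A :: "('a \<Rightarrow> 'b::euclidean_space) set" and I :: "('a measure \<times> ('a \<Rightarrow> 'b)) set"
  assumes A: "closed_cone M A"
    and "finite I" and G: "\<And>G V. (G, V) \<in> I \<Longrightarrow> subalgebra M G \<and> integrable M V"
    and nn: "\<And>G V Z. (G, V) \<in> I \<Longrightarrow> Z \<in> polar M A \<Longrightarrow> AE w in M. 0 \<le> real_cond_exp M G (\<lambda>w. Z w \<bullet> V w) w"
  shows "\<exists>Z\<in>polar M A. \<forall>(G, V)\<in>I. \<exists>B\<in>sets G. (AE w in M. real_cond_exp M G (\<lambda>w. Z w \<bullet> V w) w \<le> 0 \<longrightarrow> w \<in> B) \<and>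
      (\<lambda>w. indicator B w *\<^sub>R V w) \<in> A"
  using assms(2-)
proof (induction I)
  case empty
  have "(\<lambda>_. 0) \<in> polar M A" by (auto simp: polar_def intro: exI[of _ 0])
  then show ?case by auto
next
  case (insert p I)
  define P where "P = (\<lambda>Z (G, V). \<exists>B\<in>sets G. (AE w in M. real_cond_exp M G (\<lambda>w. Z w \<bullet> V w) w \<le> 0 \<longrightarrow> w \<in> B) \<and>
      (\<lambda>w. indicator B w *\<^sub>R V w) \<in> A)"
  have add: "P (\<lambda>w. Z w + Z' w) p'" if p': "p' \<in> insert p I" and Z: "Z \<in> polar M A" "Z' \<in> polar M A" and or: "P Z p' \<or> P Z' p'" for p' Z Z'
  proof -
    obtain G V where GV: "p' = (G, V)" by (cases p')
    have V: "integrable M V" and G: "subalgebra M G" using insert.prems(1) p' GV by auto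
    interpret G: sigma_finite_subalgebra M G by (rule sigma_finite_sub[OF prob_space_axioms G])
    have n: "AE w in M. 0 \<le> real_cond_exp M G (\<lambda>w. Z w \<bullet> V w) w" "AE w in M. 0 \<le> real_cond_exp M G (\<lambda>w. Z' w \<bullet> V w) w"
      using insert.prems(2) p' Z GV by auto
    have a: "AE w in M. real_cond_exp M G (\<lambda>w. (Z w + Z' w) \<bullet> V w) w =
      real_cond_exp M G (\<lambda>w. Z w \<bullet> V w) w + real_cond_exp M G (\<lambda>w. Z' w \<bullet> V w) w"
      unfolding inner_add_left using Z V by (intro G.real_cond_exp_add polarD(4)) auto
    obtain Y B where Y: "Y = Z \<or> Y = Z'" and B: "B \<in> sets G" "AE w in M. real_cond_exp M G (\<lambda>w. Y w \<bullet> V w) w \<le> 0 \<longrightarrow> w \<in> B"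
       "(\<lambda>w. indicator B w *\<^sub>R V w) \<in> A"
      using or unfolding P_def GV by auto
    have "AE w in M. real_cond_exp M G (\<lambda>w. (Z w + Z' w) \<bullet> V w) w \<le> 0 \<longrightarrow> w \<in> B"
      using a n B(2)
    proof eventually_elim
      case (elim w)
      then show ?case using Y by auto
    qed
    then show ?thesis unfolding P_def GV using B by auto
  qed
  have "\<exists>Z\<in>polar M A. \<forall>p'\<in>I. P Z p'" unfolding P_def
    by (rule insert.IH) (use insert.prems in auto)
  then obtain Z where Z: "Z \<in> polar M A" "\<And>p'. p' \<in> I \<Longrightarrow> P Z p'" by blast
  obtain G V where p: "p = (G, V)" by (cases p)
  have "\<exists>Z\<in>polar M A. \<exists>B\<in>sets G. (AE w in M. real_cond_exp M G (\<lambda>w. Z w \<bullet> V w) w \<le> 0 \<longrightarrow> w \<in> B) \<and>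
      (\<lambda>w. indicator B w *\<^sub>R V w) \<in> A"
  proof (rule polar_exhaust[OF A])
    show "subalgebra M G" "integrable M V" using insert.prems(1)[of G V] p by auto
    show "AE w in M. 0 \<le> real_cond_exp M G (\<lambda>w. Z w \<bullet> V w) w" if "Z \<in> polar M A" for Z
      using insert.prems(2)[of G V Z] p that by auto
  qed
  then obtain Z' where Z': "Z' \<in> polar M A" "P Z' p" unfolding P_def p by auto
  have "\<forall>p'\<in>insert p I. P (\<lambda>w. Z w + Z' w) p'" using add[OF _ Z(1) Z'(1)] Z(2) Z'(2) by blast
  with polar_add[OF Z(1) Z'(1)] have "\<exists>Z\<in>polar M A. \<forall>p'\<in>insert p I. P Z p'" by (intro bexI[of _ "\<lambda>w. Z w + Z' w"])
  then show ?case unfolding P_def .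
qed

end

section \<open>No-arbitrage conditions and consistent price systems\<close>

text \<open>\<open>Nset\<close> and \<open>Aset\<close> are described by almost sure equalities
  only; completeness supplies the measurability of their members.\<close>

lemma (in complete_measure) borel_measurable_AE_eq:
  fixes X Y :: "'a \<Rightarrow> 'b::topological_space"
  assumes Y: "Y \<in> borel_measurable M" and ae: "AE w in M. X w = Y w"
  shows "X \<in> borel_measurable M"
proof (rule measurableI)
  fix B :: "'b set" assume "B \<in> sets borel"
  then have "Y -` B \<inter> space M \<in> sets M" using Y by (rule measurable_sets[rotated])
  then show "X -` B \<inter> space M \<in> sets M"
    by (rule in_sets_AE[rotated]) (use ae AE_space in \<open>auto elim!: eventually_elim2\<close>)
qed simp

definition units :: "('d::finite) mat set" where
  "units = range (\<lambda>(i, j). emat i j) \<union> range (\<lambda>(i, j). - emat i j)"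

lemma units_iff: "a \<in> units \<longleftrightarrow> (\<exists>i j. a = emat i j \<or> a = - emat i j)"
  by (auto simp: units_def)

lemma finite_units: "finite (units :: ('d::finite) mat set)"
  by (simp add: units_def)

context market
begin

abbreviation "N_t \<equiv> Nset M H Acone F"
abbreviation "N0_t \<equiv> N0set M H Acone F"

lemma NsetI: "\<eta> \<in> strat t \<Longrightarrow> AE w in M. X w = F t w (\<eta> w) \<Longrightarrow> X \<in> N_t t"
  by (auto simp: Nset_def)

lemma NsetE:
  assumes "X \<in> N_t t"
  obtains \<eta> where "\<eta> \<in> strat t" "AE w in M. X w = F t w (\<eta> w)"
  using assms by (auto simp: Nset_def)

lemma Nset_AE_eq:
  assumes "X \<in> N_t t" "AE w in M. Y w = X w"
  shows "Y \<in> N_t t"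
  using assms(1)
proof (rule NsetE)
  fix \<eta> assume \<eta>: "\<eta> \<in> strat t" and X: "AE w in M. X w = F t w (\<eta> w)"
  show ?thesis using X assms(2) by (intro NsetI[OF \<eta>]) (auto elim: eventually_elim2)
qed

lemma N0set_AE_eq: "X \<in> N0_t t \<Longrightarrow> AE w in M. Y w = X w \<Longrightarrow> Y \<in> N0_t t"
  unfolding N0set_def by (auto intro: Nset_AE_eq)

lemma Nset_zero: "t \<le> T \<Longrightarrow> AE w in M. X w = 0 \<Longrightarrow> X \<in> N_t t"
  by (rule NsetI[OF L0_zero]) (use AE_F_class[of t] in \<open>auto elim!: eventually_elim2 simp: Fclass_A_0\<close>)

lemma N0set_zero: "t \<le> T \<Longrightarrow> AE w in M. X w = 0 \<Longrightarrow> X \<in> N0_t t"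
  unfolding N0set_def by (auto intro: Nset_zero)

lemma N0set_minus: "X \<in> N0_t t \<Longrightarrow> (\<lambda>w. - X w) \<in> N0_t t"
  unfolding N0set_def by simp

lemma Nset_measurable:
  assumes "t \<le> T" "X \<in> N_t t"
  shows "X \<in> borel_measurable M"
  using assms(2) F_L0_measurable[OF assms(1)]
  by (auto elim!: NsetE intro: complete_measure.borel_measurable_AE_eq[OF complete_M])

lemma nonneg_orthant_iff: "x \<in> nonneg_orthant \<longleftrightarrow> 0 \<le> x"
  by (simp add: nonneg_orthant_def less_eq_vec_def)

lemma AsetI:
  assumes t: "t \<le> T" and \<xi>: "\<And>s. s \<le> t \<Longrightarrow> \<xi> s \<in> N_t s" and X: "X \<in> borel_measurable M"
    and le: "AE w in M. X w \<le> (\<Sum>s\<le>t. \<xi> s w)"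
  shows "X \<in> Aset M H T Acone F t"
proof -
  define \<zeta> where "\<zeta> = (\<lambda>s. if s \<le> t then \<xi> s else (\<lambda>_. 0))"
  have "\<forall>s\<le>T. \<zeta> s \<in> N_t s" using \<xi> Nset_zero by (auto simp: \<zeta>_def)
  moreover have "(\<lambda>w. (\<Sum>s\<le>t. \<xi> s w) - X w) \<in> L0 M nonneg_orthant M"
  proof -
    have "(\<lambda>w. (\<Sum>s\<le>t. \<xi> s w) - X w) \<in> borel_measurable M"
      using t X by (intro borel_measurable_diff borel_measurable_sum Nset_measurable[OF _ \<xi>]) auto
    then show ?thesis using le by (auto simp: L0_def nonneg_orthant_iff)
  qed
  moreover have "(\<Sum>s\<le>t. \<zeta> s w) = (\<Sum>s\<le>t. \<xi> s w)" for w by (intro sum.cong) (auto simp: \<zeta>_def)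
  ultimately show ?thesis unfolding Aset_def by (auto intro!: exI[of _ \<zeta>] bexI)
qed

lemma AsetE:
  assumes "X \<in> Aset M H T Acone F t" "t \<le> T"
  obtains \<eta> r where "\<And>s. s \<le> T \<Longrightarrow> \<eta> s \<in> strat s" "r \<in> borel_measurable M" "AE w in M. 0 \<le> r w"
    "AE w in M. X w = (\<Sum>s\<le>t. F s w (\<eta> s w)) - r w"
proof -
  obtain \<xi> r where \<xi>: "\<forall>s\<le>T. \<xi> s \<in> N_t s" and r: "r \<in> L0 M nonneg_orthant M"
    and X: "AE w in M. X w = (\<Sum>s\<le>t. \<xi> s w) - r w"
    using assms(1) unfolding Aset_def by blast
  have "\<forall>s. \<exists>\<eta>. s \<le> T \<longrightarrow> \<eta> \<in> strat s \<and> (AE w in M. \<xi> s w = F s w (\<eta> w))"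
    using \<xi> unfolding Nset_def by blast
  then obtain \<eta> where \<eta>: "\<And>s. s \<le> T \<Longrightarrow> \<eta> s \<in> strat s"
    "\<And>s. s \<le> T \<Longrightarrow> AE w in M. \<xi> s w = F s w (\<eta> s w)" by metis
  have "AE w in M. \<forall>s\<in>{..t}. \<xi> s w = F s w (\<eta> s w)" using \<eta>(2) assms(2) by (intro AE_finite_allI) auto
  with X have "AE w in M. X w = (\<Sum>s\<le>t. F s w (\<eta> s w)) - r w"
  proof eventually_elim
    case (elim w)
    then have "(\<Sum>s\<le>t. \<xi> s w) = (\<Sum>s\<le>t. F s w (\<eta> s w))" by (intro sum.cong) auto
    with elim show ?case by simp
  qed
  then show ?thesis using that \<eta>(1) r by (auto simp: L0_def nonneg_orthant_iff)
qed

lemma Aset_iff_hedged: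
  "X \<in> Aset M H T Acone F T \<longleftrightarrow> X \<in> borel_measurable M \<and> hedged 0 X"
proof
  assume "X \<in> Aset M H T Acone F T"
  then obtain \<eta> r where \<eta>: "\<And>s. s \<le> T \<Longrightarrow> \<eta> s \<in> strat s" and r: "r \<in> borel_measurable M" "AE w in M. 0 \<le> r w"
    and X: "AE w in M. X w = (\<Sum>s\<le>T. F s w (\<eta> s w)) - r w"
    by (rule AsetE) auto
  have "(\<lambda>w. (\<Sum>s\<le>T. F s w (\<eta> s w)) - r w) \<in> borel_measurable M"
    using \<eta> r by (intro borel_measurable_diff borel_measurable_sum F_L0_measurable) auto
  then have "X \<in> borel_measurable M" using X by (rule complete_measure.borel_measurable_AE_eq[OF complete_M])
  moreover have "AE w in M. X w \<le> gain 0 \<eta> w"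
    using X r(2) by eventually_elim (simp add: atMost_atLeast0)
  moreover have "\<forall>s\<in>{0..T}. \<eta> s \<in> strat s" using \<eta> by simp
  ultimately show "X \<in> borel_measurable M \<and> hedged 0 X" unfolding hedged_def by blast
next
  assume X: "X \<in> borel_measurable M \<and> hedged 0 X"
  then have "hedged 0 X" by simp
  then obtain \<eta> where \<eta>: "\<And>s. s \<in> {0..T} \<Longrightarrow> \<eta> s \<in> strat s" "AE w in M. X w \<le> gain 0 \<eta> w"
    by (rule hedgedE) blast
  show "X \<in> Aset M H T Acone F T"
    by (rule AsetI[of T "\<lambda>s w. F s w (\<eta> s w)"]) (use X \<eta> in \<open>auto intro!: NsetI simp: atMost_atLeast0\<close>)
qed

lemma hedged_single:
  assumes t: "t \<le> T" and \<eta>: "\<eta> \<in> strat t"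
  shows "hedged 0 (\<lambda>w. F t w (\<eta> w))"
  unfolding hedged_def
proof (intro exI[of _ "(\<lambda>s w. 0)(t := \<eta>)"] conjI ballI)
  show "((\<lambda>s w. 0)(t := \<eta>)) s \<in> strat s" for s using \<eta> L0_zero by simp
  show "AE w in M. F t w (\<eta> w) \<le> (\<Sum>s\<in>{0..T}. F s w (((\<lambda>s w. 0)(t := \<eta>)) s w))"
    using AE_Fclass[of 0]
  proof eventually_elim
    case (elim w)
    have "(\<Sum>s\<in>{0..T}. F s w (((\<lambda>s w. 0)(t := \<eta>)) s w)) = (\<Sum>s\<in>{0..T}. if s = t then F t w (\<eta> w) else 0)"
      using elim by (intro sum.cong) (auto simp: Fclass_A_0)
    then show ?case using t by simp
  qed
qed

lemma HN0D:
  assumes "HN0 M H T Acone F" "t \<le> T" "\<eta> \<in> strat t" "(\<lambda>w. F t w (\<eta> w)) \<in> N0_t t"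
  shows "AE w in M. - \<eta> w \<in> Acone \<and> F t w (- \<eta> w) = - F t w (\<eta> w)"
  using assms unfolding HN0_def by (auto simp: L0_def)

lemma arbitrage_free_of_N0:
  assumes HN0: "HN0 M H T Acone F"
    and N0: "\<And>\<eta>. (\<And>s. s \<le> T \<Longrightarrow> \<eta> s \<in> strat s) \<Longrightarrow> AE w in M. 0 \<le> (\<Sum>s\<le>T. F s w (\<eta> s w)) \<Longrightarrow>
      (AE w in M. (\<Sum>s\<le>T. F s w (\<eta> s w)) = 0) \<and> (\<forall>s\<le>T. (\<lambda>w. F s w (\<eta> s w)) \<in> N0_t s)"
  shows "arbitrage_free_market M H T Acone F"
proof (unfold_locales)
  fix \<eta> assume 1: "\<And>s. s \<le> T \<Longrightarrow> \<eta> s \<in> strat s" and 2: "AE w in M. 0 \<le> (\<Sum>s\<le>T. F s w (\<eta> s w))"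
  then show "(AE w in M. (\<Sum>s\<le>T. F s w (\<eta> s w)) = 0) \<and>
      (\<forall>s\<le>T. AE w in M. - \<eta> s w \<in> Acone \<and> F s w (- \<eta> s w) = - F s w (\<eta> s w))"
    using N0[OF 1 2] HN0D[OF HN0 _ 1] by blast
qed

text \<open>The dominating gains are nonnegative in total, so \<open>NAw\<close> for
  \<open>G\<close> forces their sum to be 0. The gains under \<open>F\<close> are smaller date by
  date and also nonnegative in total; hence both agree at every date, and a strict improvement with
  positive probability is impossible.\<close>

lemma arbitrage_free_of_NAr:
  assumes HN0: "HN0 M H T Acone F" and NAr: "NAr M H T Acone F"
  shows "arbitrage_free_market M H T Acone F"
proof (rule arbitrage_free_of_N0[OF HN0])
  fix \<eta> assume \<eta>: "\<And>s. s \<le> T \<Longrightarrow> \<eta> s \<in> strat s" and nn: "AE w in M. 0 \<le> (\<Sum>s\<le>T. F s w (\<eta> s w))"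
  obtain G where G: "Fseq M T Acone G" and NAw: "NAw M H T Acone G"
    and dom: "\<And>\<eta> t i. \<eta> \<in> adapted M H T Acone \<Longrightarrow> t \<le> T \<Longrightarrow> AE w in M. G t w (\<eta> t w) $ i \<ge> F t w (\<eta> t w) $ i"
    and strict: "\<And>\<eta> t. \<eta> \<in> adapted M H T Acone \<Longrightarrow> t \<le> T \<Longrightarrow> (\<lambda>w. F t w (\<eta> t w)) \<notin> N0_t t \<Longrightarrow>
            \<P>(w in M. \<exists>k. G t w (\<eta> t w) $ k > F t w (\<eta> t w) $ k) > 0"
    using NAr unfolding NAr_def by blast
  interpret G: market M H T Acone G by unfold_locales (fact setting G)+
  have ad: "\<eta> \<in> adapted M H T Acone" using \<eta> by (simp add: adapted_def)
  have le: "AE w in M. \<forall>s\<in>{..T}. F s w (\<eta> s w) \<le> G s w (\<eta> s w)"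
    using dom[OF ad] by (intro AE_finite_allI) (auto simp: less_eq_vec_def AE_all_countable)
  have Gnn: "AE w in M. 0 \<le> (\<Sum>s\<le>T. G s w (\<eta> s w))"
    using le nn by eventually_elim (meson order_trans sum_mono)
  have meas: "(\<lambda>w. \<Sum>s\<le>T. G s w (\<eta> s w)) \<in> borel_measurable M"
    using \<eta> by (intro borel_measurable_sum G.F_L0_measurable) auto
  have "(\<lambda>w. \<Sum>s\<le>T. G s w (\<eta> s w)) \<in> Aset M H T Acone G T"
    by (rule G.AsetI[of T "\<lambda>s w. G s w (\<eta> s w)"]) (use meas \<eta> in \<open>auto intro!: G.NsetI\<close>)
  moreover have "(\<lambda>w. \<Sum>s\<le>T. G s w (\<eta> s w)) \<in> L0 M nonneg_orthant M"
    using meas Gnn by (auto simp: L0_def nonneg_orthant_iff)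
  ultimately have G0: "AE w in M. (\<Sum>s\<le>T. G s w (\<eta> s w)) = 0" using NAw unfolding NAw_def by blast
  have eq: "AE w in M. (\<Sum>s\<le>T. F s w (\<eta> s w)) = 0 \<and> (\<forall>s\<in>{..T}. G s w (\<eta> s w) = F s w (\<eta> s w))"
    using G0 le nn
  proof eventually_elim
    case (elim w)
    have "(\<Sum>s\<le>T. F s w (\<eta> s w)) \<le> (\<Sum>s\<le>T. G s w (\<eta> s w))" using elim by (intro sum_mono) auto
    then have z: "(\<Sum>s\<le>T. F s w (\<eta> s w)) = 0" using elim by (intro antisym) auto
    then have "(\<Sum>s\<le>T. G s w (\<eta> s w) - F s w (\<eta> s w)) = 0" using elim by (simp add: sum_subtractf)
    then have "\<forall>s\<in>{..T}. G s w (\<eta> s w) - F s w (\<eta> s w) = 0"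
      using elim by (subst (asm) sum_nonneg_eq_0_iff) auto
    then show ?case using z by auto
  qed
  have "(\<lambda>w. F s w (\<eta> s w)) \<in> N0_t s" if s: "s \<le> T" for s
  proof (rule ccontr)
    assume "(\<lambda>w. F s w (\<eta> s w)) \<notin> N0_t s"
    from strict[OF ad s this] have pos: "0 < \<P>(w in M. \<exists>k. F s w (\<eta> s w) $ k < G s w (\<eta> s w) $ k)" .
    have "AE w in M. \<not> (\<exists>k. F s w (\<eta> s w) $ k < G s w (\<eta> s w) $ k)"
      using eq by eventually_elim (use s in auto)
    then have "{w \<in> space M. \<exists>k. F s w (\<eta> s w) $ k < G s w (\<eta> s w) $ k} \<in> null_sets M"
      by (subst (asm) complete_measure.AE_iff_null_sets[OF complete_M]) simp
    then show False using pos by (simp add: measure_def null_setsD1)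
  qed
  with eq show "(AE w in M. (\<Sum>s\<le>T. F s w (\<eta> s w)) = 0) \<and> (\<forall>s\<le>T. (\<lambda>w. F s w (\<eta> s w)) \<in> N0_t s)"
    by (auto elim!: eventually_mono)
qed

text \<open>Backward recursion over the dates: if the sum up to \<open>t + 1\<close> is nonnegative,
  the sum up to \<open>t\<close> is the negative of the last gain plus a nonnegative remainder.
  \<open>NAs\<close> puts it into the reversible claims of date \<open>t + 1\<close>, and
  \<open>EF\<close> makes it 0.\<close>

lemma arbitrage_free_of_NAs_EF:
  assumes HN0: "HN0 M H T Acone F" and NAs: "NAs M H T Acone F" and EF: "EF M H T Acone F"
  shows "arbitrage_free_market M H T Acone F"
proof (rule arbitrage_free_of_N0[OF HN0])
  fix \<eta> assume \<eta>: "\<And>s. s \<le> T \<Longrightarrow> \<eta> s \<in> strat s" and nn: "AE w in M. 0 \<le> (\<Sum>s\<le>T. F s w (\<eta> s w))"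
  have Fm: "(\<lambda>w. F s w (\<eta> s w)) \<in> borel_measurable M" if "s \<le> T" for s using F_L0_measurable \<eta> that by auto
  have null: "AE w in M. X w = 0"
    if t: "t \<le> T" and X: "X \<in> Aset M H T Acone F t" and Y: "Y \<in> N_t t" and r: "r \<in> borel_measurable M" "AE w in M. 0 \<le> r w"
      and eq: "AE w in M. X w = - Y w + r w" for t X Y r
  proof -
    have "r \<in> L0 M nonneg_orthant M" using r by (auto simp: L0_def nonneg_orthant_iff)
    then have "X \<in> N0_t t" using NAs t X Y eq unfolding NAs_def by blast
    then show ?thesis using EF t unfolding EF_def by blast
  qed
  \<comment> \<open>The case \<open>Y = 0\<close>, in which the nonnegative gain is its own
    remainder.\<close>
  have pos0: "AE w in M. F t w (\<eta> t w) = 0" if t: "t \<le> T" and p: "AE w in M. 0 \<le> F t w (\<eta> t w)" for t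
  proof (rule null[OF t])
    show "(\<lambda>w. F t w (\<eta> t w)) \<in> Aset M H T Acone F t"
    proof (rule AsetI[OF t, of "\<lambda>s. if s = t then (\<lambda>w. F t w (\<eta> t w)) else (\<lambda>_. 0)"])
      show "(if s = t then (\<lambda>w. F t w (\<eta> t w)) else (\<lambda>_. 0)) \<in> N_t s" if "s \<le> t" for s
        using that t NsetI[OF \<eta>[of t]] Nset_zero by auto
      have "(\<Sum>s\<le>t. (if s = t then (\<lambda>w. F t w (\<eta> t w)) else (\<lambda>_. 0)) w) = F t w (\<eta> t w)" for w
      proof -
        have "(\<Sum>s\<le>t. (if s = t then (\<lambda>w. F t w (\<eta> t w)) else (\<lambda>_. 0)) w) = (\<Sum>s\<le>t. if s = t then F t w (\<eta> t w) else 0)"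
          by (intro sum.cong) auto
        then show ?thesis by simp
      qed
      then show "AE w in M. F t w (\<eta> t w) \<le> (\<Sum>s\<le>t. (if s = t then (\<lambda>w. F t w (\<eta> t w)) else (\<lambda>_. 0)) w)"
        by simp
    qed (rule Fm[OF t])
    show "(\<lambda>_. 0) \<in> N_t t" using t by (intro Nset_zero) auto
    show "AE w in M. F t w (\<eta> t w) = - 0 + F t w (\<eta> t w)" by simp
  qed (use p Fm[OF t] in auto)
  have all0: "t \<le> T \<Longrightarrow> AE w in M. 0 \<le> (\<Sum>s\<le>t. F s w (\<eta> s w)) \<Longrightarrow> \<forall>s\<le>t. AE w in M. F s w (\<eta> s w) = 0" for t
  proof (induction t)
    case 0
    then show ?case using pos0[of 0] by simp
  next
    case (Suc t)
    have X0: "AE w in M. (\<Sum>s\<le>t. F s w (\<eta> s w)) = 0"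
    proof (rule null[OF Suc.prems(1)])
      show "(\<lambda>w. \<Sum>s\<le>t. F s w (\<eta> s w)) \<in> Aset M H T Acone F (Suc t)"
      proof (rule AsetI[OF Suc.prems(1), of "\<lambda>s. if s \<le> t then (\<lambda>w. F s w (\<eta> s w)) else (\<lambda>_. 0)"])
        show "(if s \<le> t then (\<lambda>w. F s w (\<eta> s w)) else (\<lambda>_. 0)) \<in> N_t s" if "s \<le> Suc t" for s
          using that Suc.prems(1) NsetI[OF \<eta>[of s]] Nset_zero by auto
        show "(\<lambda>w. \<Sum>s\<le>t. F s w (\<eta> s w)) \<in> borel_measurable M"
          using Suc.prems(1) by (intro borel_measurable_sum Fm) auto
        show "AE w in M. (\<Sum>s\<le>t. F s w (\<eta> s w)) \<le> (\<Sum>s\<le>Suc t. (if s \<le> t then (\<lambda>w. F s w (\<eta> s w)) else (\<lambda>_. 0)) w)"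
          by (auto intro!: AE_I2 eq_refl sum.cong)
      qed
      show "(\<lambda>w. F (Suc t) w (\<eta> (Suc t) w)) \<in> N_t (Suc t)" using \<eta> Suc.prems(1) by (intro NsetI) auto
      show "(\<lambda>w. \<Sum>s\<le>Suc t. F s w (\<eta> s w)) \<in> borel_measurable M"
        using Suc.prems(1) by (intro borel_measurable_sum Fm) auto
    qed (use Suc.prems in auto)
    then have IH: "\<forall>s\<le>t. AE w in M. F s w (\<eta> s w) = 0"
      using Suc.prems(1) by (intro Suc.IH) (auto elim!: eventually_mono)
    have "AE w in M. 0 \<le> F (Suc t) w (\<eta> (Suc t) w)"
      using Suc.prems(2) X0 by eventually_elim simp
    then have "AE w in M. F (Suc t) w (\<eta> (Suc t) w) = 0" by (rule pos0[OF Suc.prems(1)])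
    with IH show ?case by (auto simp: le_Suc_eq)
  qed
  note z = all0[OF order_refl nn]
  have "AE w in M. \<forall>s\<in>{..T}. F s w (\<eta> s w) = 0" using z by (intro AE_finite_allI) auto
  then have "AE w in M. (\<Sum>s\<le>T. F s w (\<eta> s w)) = 0" by eventually_elim simp
  with z show "(AE w in M. (\<Sum>s\<le>T. F s w (\<eta> s w)) = 0) \<and> (\<forall>s\<le>T. (\<lambda>w. F s w (\<eta> s w)) \<in> N0_t s)"
    by (auto intro: N0set_zero)
qed

text \<open>In general \<open>F\<close> is only superadditive. For reversible strategies the
  opposite inequality follows by adding \<open>- \<eta>\<close> to \<open>\<eta> + \<theta>\<close>,
  so \<open>F\<close> is additive on them.\<close>

lemma N0set_add:
  assumes HN0: "HN0 M H T Acone F" and t: "t \<le> T" and X: "X \<in> N0_t t" and Y: "Y \<in> N0_t t"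
  shows "(\<lambda>w. X w + Y w) \<in> N0_t t"
proof -
  have *: "(\<lambda>w. X w + Y w) \<in> N_t t" if X: "X \<in> N0_t t" and Y: "Y \<in> N0_t t" for X Y
  proof -
    obtain \<eta> where \<eta>: "\<eta> \<in> strat t" "AE w in M. X w = F t w (\<eta> w)" using X by (auto simp: N0set_def elim: NsetE)
    obtain \<theta> where \<theta>: "\<theta> \<in> strat t" "AE w in M. Y w = F t w (\<theta> w)" using Y by (auto simp: N0set_def elim: NsetE)
    have "(\<lambda>w. F t w (\<eta> w)) \<in> N0_t t" by (rule N0set_AE_eq[OF X]) (use \<eta>(2) in \<open>auto elim: eventually_mono\<close>)
    note kX = HN0D[OF HN0 t \<eta>(1) this]
    have "(\<lambda>w. F t w (\<theta> w)) \<in> N0_t t" by (rule N0set_AE_eq[OF Y]) (use \<theta>(2) in \<open>auto elim: eventually_mono\<close>)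
    note kY = HN0D[OF HN0 t \<theta>(1) this]
    have "AE w in M. X w + Y w = F t w (\<eta> w + \<theta> w)"
      using \<eta>(2) \<theta>(2) kX kY L0_AE[OF \<eta>(1)] L0_AE[OF \<theta>(1)] AE_F_class[OF t]
    proof eventually_elim
      case (elim w)
      have 1: "F t w (\<eta> w) + F t w (\<theta> w) \<le> F t w (\<eta> w + \<theta> w)" using elim by (intro Fclass_add) auto
      have "F t w (- \<eta> w) + F t w (\<eta> w + \<theta> w) \<le> F t w (- \<eta> w + (\<eta> w + \<theta> w))"
        using elim by (intro Fclass_add[of _ Acone] convex_cone_plus[OF cone_A]) auto
      then have "F t w (\<eta> w + \<theta> w) \<le> F t w (\<eta> w) + F t w (\<theta> w)" using elim by (simp add: algebra_simps)
      with 1 show ?case using elim by simp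
    qed
    then show ?thesis by (rule NsetI[OF L0_add[OF \<eta>(1) \<theta>(1)]])
  qed
  show ?thesis using *[OF X Y] *[OF N0set_minus[OF X] N0set_minus[OF Y]] by (simp add: N0set_def)
qed

lemma N0set_sum:
  assumes "HN0 M H T Acone F" "t \<le> T" "finite I" "\<And>i. i \<in> I \<Longrightarrow> X i \<in> N0_t t"
  shows "(\<lambda>w. \<Sum>i\<in>I. X i w) \<in> N0_t t"
  using assms(3,4)
proof induction
  case empty
  then show ?case using N0set_zero[OF assms(2), of "\<lambda>_. 0"] by simp
next
  case (insert i I)
  then show ?case using N0set_add[OF assms(1,2), of "X i" "\<lambda>w. \<Sum>i\<in>I. X i w"] by simp
qed

lemma HA_units:
  assumes "HA M T Acone F" "t \<le> T" "a \<in> units" "a \<notin> Acone"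
  shows "AE w in M. F t w a = 0"
proof -
  obtain i j \<delta> where "\<delta> \<in> {-1, 1::real}" "a = \<delta> *\<^sub>R emat i j"
    using assms(3) unfolding units_iff by (metis insertI1 insertI2 scaleR_minus1_left scaleR_one)
  then show ?thesis using assms unfolding HA_def by blast
qed

lemma HA_decomp:
  assumes "HA M T Acone F" "t \<le> T" "\<eta> \<in> borel_measurable M"
  shows "AE w in M. F t w (\<eta> w) =
          (\<Sum>i\<in>UNIV. \<Sum>j\<in>UNIV. max (\<eta> w $ i $ j) 0 *\<^sub>R F t w (emat i j)
                               + max (- (\<eta> w $ i $ j)) 0 *\<^sub>R F t w (- emat i j))"
  using assms unfolding HA_def by (auto simp: L0_def)

lemma Cond_I_units:
  assumes "Cond_I M T F" "t \<le> T" "a \<in> units"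
  shows "integrable M (\<lambda>w. F t w a)"
  using assms unfolding Cond_I_def units_iff by auto

end

lemma (in arbitrage_free_market) closed_in_prob_Aset: "closed_in_prob M (Aset M H T Acone F T)"
  unfolding closed_in_prob_def
proof (intro allI impI)
  fix X Y
  assume as: "(\<forall>n. X n \<in> Aset M H T Acone F T) \<and> Y \<in> borel_measurable M \<and>
      (\<forall>e>0. (\<lambda>n. \<P>(w in M. dist (X n w) (Y w) > e)) \<longlonglongrightarrow> 0)"
  have Xm[measurable]: "X n \<in> borel_measurable M" and Xh: "hedged 0 (X n)" for n using as by (auto simp: Aset_iff_hedged)
  have [measurable]: "Y \<in> borel_measurable M" using as by simp
  have lim: "(\<lambda>n. \<P>(w in M. e < dist (X n w) (Y w))) \<longlonglongrightarrow> 0" if "0 < e" for e using as that by simp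
  \<comment> \<open>Truncating the distance at 1 turns convergence in probability into convergence
    in mean, which yields an almost surely convergent subsequence.\<close>
  define u where "u = (\<lambda>n w. min 1 (dist (X n w) (Y w)))"
  have [measurable]: "u n \<in> borel_measurable M" for n unfolding u_def by measurable
  have ui: "integrable M (u n)" for n by (rule integrable_const_bound[of _ 1]) (auto simp: u_def)
  have "(\<lambda>n. \<integral>w. norm (u n w) \<partial>M) \<longlonglongrightarrow> 0"
  proof (rule LIMSEQ_I)
    fix e :: real assume e: "0 < e"
    then have "\<forall>\<^sub>F n in sequentially. dist (\<P>(w in M. e/2 < dist (X n w) (Y w))) 0 < e/2"
      by (intro tendstoD[OF lim]) auto
    then obtain n0 where n0: "\<And>n. n \<ge> n0 \<Longrightarrow> \<P>(w in M. e/2 < dist (X n w) (Y w)) < e/2"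
      by (auto simp: eventually_sequentially)
    have "norm ((\<integral>w. norm (u n w) \<partial>M) - 0) < e" if n: "n \<ge> n0" for n
    proof -
      let ?E = "{w \<in> space M. e/2 < dist (X n w) (Y w)}"
      have E[measurable]: "?E \<in> sets M" by measurable
      then have iE: "integrable M (indicator ?E :: 'a \<Rightarrow> real)" by (intro integrable_real_indicator) (auto simp: emeasure_eq_measure)
      have "(\<integral>w. norm (u n w) \<partial>M) \<le> (\<integral>w. e/2 + indicator ?E w \<partial>M)"
      proof (rule integral_mono)
        show "norm (u n w) \<le> e/2 + indicator ?E w" if "w \<in> space M" for w
          using that e by (auto simp: u_def indicator_def)
      qed (use ui iE in auto)
      also have "\<dots> = (\<integral>w. e/2 \<partial>M) + (\<integral>w. indicator ?E w \<partial>M)"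
        by (rule Bochner_Integration.integral_add[OF _ iE]) simp
      also have "\<dots> = e/2 + prob ?E" using E by (simp add: prob_space)
      also have "\<dots> < e" using n0[OF n] by simp
      finally show ?thesis by (simp add: integral_nonneg_AE)
    qed
    then show "\<exists>no. \<forall>n\<ge>no. norm ((\<integral>w. norm (u n w) \<partial>M) - 0) < e" by blast
  qed
  from tendsto_L1_AE_subseq[OF ui this] obtain r where "AE w in M. (\<lambda>n. u (r n) w) \<longlonglongrightarrow> 0" by blast
  then have "AE w in M. (\<lambda>n. X (r n) w) \<longlonglongrightarrow> Y w"
  proof eventually_elim
    case (elim w)
    have "\<forall>\<^sub>F n in sequentially. u (r n) w < 1" using order_tendstoD(2)[OF elim] by simp
    then have "\<forall>\<^sub>F n in sequentially. u (r n) w = dist (X (r n) w) (Y w)"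
      by eventually_elim (auto simp: u_def)
    then have "(\<lambda>n. dist (X (r n) w) (Y w)) \<longlonglongrightarrow> 0" using elim by (rule Lim_transform_eventually[rotated])
    then show ?case by (subst tendsto_dist_iff)
  qed
  then have "hedged 0 Y" by (rule closed_fromD[OF closed_from Xh])
  then show "Y \<in> Aset M H T Acone F T" by (simp add: Aset_iff_hedged)
qed

section \<open>Existence of a consistent price system\<close>

context market
begin

lemma entry_measurable:
  "f \<in> borel_measurable G \<Longrightarrow> (\<lambda>w. (f w :: 'd mat) $ i $ j) \<in> borel_measurable G"
  by (rule borel_measurable_continuous_on[of "\<lambda>x. x $ i $ j"]) (intro continuous_intros)

lemma Fbar_measurable:
  assumes "\<eta> \<in> borel_measurable (H t)"
  shows "Fbar M H F t \<eta> Z \<in> borel_measurable (H t)"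
  unfolding Fbar_def using entry_measurable[OF assms]
  by (intro borel_measurable_sum borel_measurable_add borel_measurable_times borel_measurable_max
      borel_measurable_uminus borel_measurable_cond_exp) auto

end

lemma (in market) cond_exp_unit_eq_0:
  fixes Z :: "'a \<Rightarrow> real^'d"
  assumes HA: "HA M T Acone F" and t: "t \<le> T" and a: "a \<in> units" "a \<notin> Acone"
    and i: "integrable M (\<lambda>w. Z w \<bullet> F t w a)"
  shows "AE w in M. real_cond_exp M (H t) (\<lambda>w. Z w \<bullet> F t w a) w = 0"
proof -
  interpret G: sigma_finite_subalgebra M "H t" by (rule sigma_finite_sub[OF prob_space_axioms sub[OF t]])
  have "AE w in M. Z w \<bullet> F t w a = 0" using HA_units[OF HA t a] by eventually_elim simp
  then have "AE w in M. real_cond_exp M (H t) (\<lambda>w. Z w \<bullet> F t w a) w = real_cond_exp M (H t) (\<lambda>_. 0) w"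
    using i by (intro G.real_cond_exp_cong) auto
  moreover have "AE w in M. real_cond_exp M (H t) (\<lambda>_. 0) w = (0::real)" by (rule G.real_cond_exp_F_meas) auto
  ultimately show ?thesis by eventually_elim simp
qed

context arbitrage_free_market
begin

text \<open>Adding \<open>\<kappa>\<close> to a strategy that hedges
  \<open>- F t w (\<kappa> w)\<close> gives a nonnegative total gain, so the sum
  \<open>?\<rho>\<close> of the two exchanges at date \<open>t\<close> is reversible. Writing
  \<open>- \<kappa>\<close> as \<open>\<eta> t\<close> minus this sum places it in the cone, and
  superadditivity bounds \<open>F t w (- \<kappa> w)\<close> from both sides by
  \<open>- F t w (\<kappa> w)\<close>.\<close>

lemma kernel_of_hedged_minus:
  assumes t: "t \<le> T" and \<kappa>: "\<kappa> \<in> strat t" and h: "hedged 0 (\<lambda>w. - F t w (\<kappa> w))"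
  shows "AE w in M. - \<kappa> w \<in> Acone \<and> F t w (- \<kappa> w) = - F t w (\<kappa> w)"
proof -
  obtain \<eta> where \<eta>: "\<And>s. s \<in> {0..T} \<Longrightarrow> \<eta> s \<in> strat s"
    and d: "AE w in M. - F t w (\<kappa> w) \<le> gain 0 \<eta> w"
    using h by (rule hedgedE) blast
  have \<eta>t: "\<eta> t \<in> strat t" using t by (intro \<eta>) auto
  define \<theta> where "\<theta> = \<eta>(t := \<lambda>w. \<eta> t w + \<kappa> w)"
  have \<theta>: "\<theta> s \<in> strat s" if "s \<in> {0..T}" for s
    using \<eta>[OF that] L0_add[OF \<eta>t \<kappa>] by (simp add: \<theta>_def)
  have split: "gain 0 \<theta> w = gain 0 \<eta> w - F t w (\<eta> t w) + F t w (\<eta> t w + \<kappa> w)" for w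
  proof -
    have r: "(\<Sum>s\<in>{0..T}. f s) = f t + (\<Sum>s\<in>{0..T} - {t}. f s)" for f :: "nat \<Rightarrow> real^'d"
      using t by (intro sum.remove) auto
    have e1: "F t w (\<theta> t w) = F t w (\<eta> t w + \<kappa> w)" by (simp add: \<theta>_def)
    have e2: "(\<Sum>s\<in>{0..T} - {t}. F s w (\<theta> s w)) = (\<Sum>s\<in>{0..T} - {t}. F s w (\<eta> s w))"
      by (intro sum.cong) (auto simp: \<theta>_def)
    show ?thesis unfolding r[of "\<lambda>s. F s w (\<theta> s w)"] r[of "\<lambda>s. F s w (\<eta> s w)"] e1 e2 by simp
  qed
  have nn: "AE w in M. 0 \<le> gain 0 \<theta> w"
    using d AE_F_class[OF t] L0_AE[OF \<eta>t] L0_AE[OF \<kappa>]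
  proof eventually_elim
    case (elim w)
    have "F t w (\<eta> t w) + F t w (\<kappa> w) \<le> F t w (\<eta> t w + \<kappa> w)" using elim by (intro Fclass_add) auto
    from add_mono[OF elim(1) this] show ?case unfolding split by (simp add: algebra_simps)
  qed
  have z: "AE w in M. gain 0 \<theta> w = 0" by (rule kernel_from(1)[OF \<theta> nn])
  have k: "AE w in M. - \<theta> t w \<in> Acone \<and> F t w (- \<theta> t w) = - F t w (\<theta> t w)"
    by (rule kernel_from(2)[OF \<theta> nn]) (use t in auto)
  show ?thesis
    using z k d AE_F_class[OF t] L0_AE[OF \<eta>t] L0_AE[OF \<kappa>]
  proof eventually_elim
    case (elim w)
    let ?\<rho> = "\<eta> t w + \<kappa> w"
    have \<rho>: "- ?\<rho> \<in> Acone" "F t w (- ?\<rho>) = - F t w ?\<rho>" using elim(2) by (auto simp: \<theta>_def)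
    have eq: "- \<kappa> w = \<eta> t w + - ?\<rho>" by simp
    have mem: "- \<kappa> w \<in> Acone" unfolding eq using elim \<rho> by (intro convex_cone_plus[OF cone_A]) auto
    have "F t w ?\<rho> \<le> F t w (\<eta> t w) + F t w (\<kappa> w)"
    proof -
      have "F t w ?\<rho> = F t w (\<eta> t w) - gain 0 \<eta> w" using elim(1) unfolding split by (simp add: algebra_simps)
      also have "\<dots> \<le> F t w (\<eta> t w) - (- F t w (\<kappa> w))" using elim(3) by (intro diff_mono) auto
      finally show ?thesis by simp
    qed
    moreover have "F t w (\<eta> t w) + F t w (- ?\<rho>) \<le> F t w (- \<kappa> w)"
      unfolding eq using elim \<rho> by (intro Fclass_add) auto
    ultimately have 1: "- F t w (\<kappa> w) \<le> F t w (- \<kappa> w)" unfolding \<rho>(2) by (simp add: le_diff_eq diff_le_eq algebra_simps less_eq_vec_def) (smt (verit))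
    have "F t w (\<kappa> w) + F t w (- \<kappa> w) \<le> F t w (\<kappa> w + - \<kappa> w)" using elim mem by (intro Fclass_add) auto
    then have 2: "F t w (- \<kappa> w) \<le> - F t w (\<kappa> w)" using elim by (simp add: Fclass_A_0 le_minus_iff add_eq_0_iff less_eq_vec_def) (smt (verit))
    show ?case using mem antisym[OF 2 1] by simp
  qed
qed

lemma Dset_nonempty:
  assumes HN0: "HN0 M H T Acone F" and HA: "HA M T Acone F" and I: "Cond_I M T F"
  shows "Dset M H T Acone F \<noteq> {}"
proof -
  define A where "A = {X. hedged 0 X}"
  \<comment> \<open>The unit vectors, paired over the full sigma-algebra, are responsible for strict
    positivity of the components of \<open>Z\<close>.\<close>
  define K1 where "K1 = (\<lambda>i. (M, \<lambda>_::'a. axis i (1::real) :: real^'d)) ` UNIV"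
  \<comment> \<open>The minus sign makes the prices nonnegative under polar elements, as exhaustion
    requires. For units outside the cone \<open>HA\<close> already gives gain 0.\<close>
  define K2 where "K2 = (\<lambda>(t, a). (H t, \<lambda>w. - F t w a)) ` ({..T} \<times> (units \<inter> Acone))"
  have subM: "subalgebra M M" by (simp add: subalgebra_def)
  have A_cone: "closed_cone M A"
    unfolding closed_cone_def
  proof (intro conjI ballI allI impI)
    show "(\<lambda>_. 0) \<in> A" using hedged_zero by (simp add: A_def)
    show "(\<lambda>w. a *\<^sub>R X w + b *\<^sub>R X' w) \<in> A" if "X \<in> A" "X' \<in> A" "0 \<le> a" "0 \<le> b" for X X' a b
      using that hedged_add[OF hedged_scale[of 0 X "\<lambda>_. a"] hedged_scale[of 0 X' "\<lambda>_. b"]] by (simp add: A_def)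
    show "X \<in> A" if "\<forall>n::nat. Xn n \<in> A" "AE w in M. (\<lambda>n. Xn n w) \<longlonglongrightarrow> X w" for Xn X
      using that closed_fromD[OF closed_from, of 0 Xn X] by (simp add: A_def)
  qed
  have ind_meas: "(indicator B :: 'a \<Rightarrow> real) \<in> borel_measurable (H t)" if "B \<in> sets (H t)" for B t using that by simp
  have unit_meas: "(\<lambda>w. indicator B w *\<^sub>R a) \<in> strat t" if "B \<in> sets (H t)" "a \<in> Acone" for B a t
    using that by (intro L0_scale L0_const ind_meas) auto
  have Fscale: "AE w in M. F t w (v w *\<^sub>R a) = v w *\<^sub>R F t w a" if "t \<le> T" "\<And>w. 0 \<le> v w" for t a and v :: "'a \<Rightarrow> real"
    using AE_F_class[OF that(1)] by eventually_elim (use that in \<open>simp add: Fclass_A_scale\<close>)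
  have p_nonpos: "0 \<le> (\<integral>w. indicator B w * (Z w \<bullet> (- F t w a)) \<partial>M)"
    if Z: "Z \<in> polar M A" and t: "t \<le> T" and a: "a \<in> units" "a \<in> Acone" and B: "B \<in> sets (H t)" for Z t a B
  proof -
    have "hedged 0 (\<lambda>w. F t w (indicator B w *\<^sub>R a))" by (rule hedged_single[OF t unit_meas[OF B a(2)]])
    then have "(\<lambda>w. indicator B w *\<^sub>R F t w a) \<in> A"
      unfolding A_def mem_Collect_eq by (rule hedged_mono) (use Fscale[OF t, of "indicator B" a] in \<open>auto elim: eventually_mono\<close>)
    moreover have "integrable M (\<lambda>w. indicator B w *\<^sub>R F t w a)"
      using B sub[OF t] by (intro integrable_mult_indicator Cond_I_units[OF I t a(1)]) (auto simp: subalgebra_def)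
    ultimately have "(\<integral>w. Z w \<bullet> (indicator B w *\<^sub>R F t w a) \<partial>M) \<le> 0" by (rule polarD(3)[OF Z])
    then show ?thesis by simp
  qed
  have "\<exists>Z\<in>polar M A. \<forall>(G, V)\<in>K1 \<union> K2. \<exists>B\<in>sets G. (AE w in M. real_cond_exp M G (\<lambda>w. Z w \<bullet> V w) w \<le> 0 \<longrightarrow> w \<in> B) \<and>
      (\<lambda>w. indicator B w *\<^sub>R V w) \<in> A"
  proof (rule polar_exhaust_finite[OF A_cone])
    show "finite (K1 \<union> K2)" using finite_units by (auto simp: K1_def K2_def)
    show "subalgebra M G \<and> integrable M V" if "(G, V) \<in> K1 \<union> K2" for G V
      using that Cond_I_units[OF I] sub subM by (auto simp: K1_def K2_def)
    show "AE w in M. 0 \<le> real_cond_exp M G (\<lambda>w. Z w \<bullet> V w) w" if GV: "(G, V) \<in> K1 \<union> K2" and Z: "Z \<in> polar M A" for G V Z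
    proof -
      have G: "subalgebra M G" and V: "integrable M V"
        using GV Cond_I_units[OF I] sub subM by (auto simp: K1_def K2_def)
      interpret G: sigma_finite_subalgebra M G by (rule sigma_finite_sub[OF prob_space_axioms G])
      show ?thesis
      proof (rule G.real_cond_exp_nonneg_of_set_integrals)
        show "integrable M (\<lambda>w. Z w \<bullet> V w)" by (rule polarD(4)[OF Z V])
        fix B assume B: "B \<in> sets G"
        show "0 \<le> (\<integral>w. indicator B w * (Z w \<bullet> V w) \<partial>M)"
        proof (cases "(G, V) \<in> K1")
          case True
          then obtain i where i: "G = M" "V = (\<lambda>_. axis i 1)" by (auto simp: K1_def)
          have "(\<lambda>w. - (indicator B w *\<^sub>R V w)) \<in> A"
            unfolding A_def mem_Collect_eq
            by (rule hedged_mono[OF hedged_zero]) (auto simp: i less_eq_vec_def axis_def indicator_def)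
          moreover have "integrable M (\<lambda>w. - (indicator B w *\<^sub>R V w))"
            using B i V by (intro Bochner_Integration.integrable_minus integrable_mult_indicator) auto
          ultimately have "(\<integral>w. Z w \<bullet> (- (indicator B w *\<^sub>R V w)) \<partial>M) \<le> 0" by (rule polarD(3)[OF Z])
          then show ?thesis by simp
        next
          case False
          then obtain t a where "t \<le> T" "a \<in> units" "a \<in> Acone" "G = H t" "V = (\<lambda>w. - F t w a)"
            using GV by (auto simp: K2_def)
          then show ?thesis using p_nonpos[OF Z, of t a B] B by simp
        qed
      qed
    qed
  qed
  then obtain Z where Z: "Z \<in> polar M A" and
    ex: "\<And>G V. (G, V) \<in> K1 \<union> K2 \<Longrightarrow> \<exists>B\<in>sets G. (AE w in M. real_cond_exp M G (\<lambda>w. Z w \<bullet> V w) w \<le> 0 \<longrightarrow> w \<in> B) \<and>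
      (\<lambda>w. indicator B w *\<^sub>R V w) \<in> A"
    by blast
  have Zm[measurable]: "Z \<in> borel_measurable M" by (rule polarD(1)[OF Z])
  obtain C where C: "\<And>w. norm (Z w) \<le> C" using polarD(2)[OF Z] by blast
  \<comment> \<open>\<open>B\<close> covers the event where the component fails to be positive, and
    its indicator in direction \<open>i\<close> can be hedged from nothing. By the kernel property
    such a gain is 0, so \<open>B\<close> is null.\<close>
  have Zpos: "AE w in M. 0 < Z w $ i" for i
  proof -
    have "(M, \<lambda>_. axis i 1) \<in> K1 \<union> K2" by (simp add: K1_def)
    from ex[OF this] obtain B where B: "B \<in> sets M"
      "AE w in M. real_cond_exp M M (\<lambda>w. Z w \<bullet> axis i 1) w \<le> 0 \<longrightarrow> w \<in> B"
      "(\<lambda>w. indicator B w *\<^sub>R axis i 1) \<in> A" by blast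
    from B(3) obtain \<eta> where \<eta>: "\<And>s. s \<in> {0..T} \<Longrightarrow> \<eta> s \<in> strat s"
      and d: "AE w in M. indicator B w *\<^sub>R axis i 1 \<le> gain 0 \<eta> w"
      unfolding A_def mem_Collect_eq by (rule hedgedE) blast
    have nnB: "0 \<le> indicator B w *\<^sub>R (axis i 1 :: real^'d)" for w by (auto simp: less_eq_vec_def axis_def indicator_def)
    have nn: "AE w in M. 0 \<le> gain 0 \<eta> w" using d by eventually_elim (meson nnB order_trans)
    have "AE w in M. gain 0 \<eta> w = 0" by (rule kernel_from(1)[OF \<eta> nn])
    with d have notB: "AE w in M. w \<notin> B"
    proof eventually_elim
      case (elim w)
      then have "indicator B w *\<^sub>R axis i 1 \<le> (0 :: real^'d)" by simp
      then have "(indicator B w *\<^sub>R (axis i 1 :: real^'d)) $ i \<le> 0 $ i" unfolding less_eq_vec_def by blast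
      then show ?case by (cases "w \<in> B") (simp_all add: axis_def)
    qed
    interpret MM: sigma_finite_subalgebra M M by (rule sigma_finite_sub[OF prob_space_axioms subM])
    have "AE w in M. real_cond_exp M M (\<lambda>w. Z w \<bullet> axis i 1) w = Z w \<bullet> axis i 1"
      by (rule MM.real_cond_exp_F_meas) (auto intro: polarD(4)[OF Z])
    with notB B(2) show ?thesis by eventually_elim (auto simp: inner_axis not_le)
  qed
  define p where "p = (\<lambda>t a. real_cond_exp M (H t) (\<lambda>w. Z w \<bullet> F t w a))"
  have p_le: "AE w in M. p t a w \<le> 0" if t: "t \<le> T" and a: "a \<in> units" for t a
  proof -
    interpret G: sigma_finite_subalgebra M "H t" by (rule sigma_finite_sub[OF prob_space_axioms sub[OF t]])
    have i: "integrable M (\<lambda>w. Z w \<bullet> F t w a)" by (rule polarD(4)[OF Z Cond_I_units[OF I t a]])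
    show ?thesis
    proof (cases "a \<in> Acone")
      case True
      have "AE w in M. 0 \<le> real_cond_exp M (H t) (\<lambda>w. Z w \<bullet> (- F t w a)) w"
        by (rule G.real_cond_exp_nonneg_of_set_integrals) (use i p_nonpos[OF Z t a True] in auto)
      moreover have "AE w in M. real_cond_exp M (H t) (\<lambda>w. (-1) * (Z w \<bullet> F t w a)) w = (-1) * p t a w"
        unfolding p_def using i by (rule G.real_cond_exp_cmult)
      ultimately show ?thesis by eventually_elim simp
    next
      case False
      show ?thesis using cond_exp_unit_eq_0[OF HA t a False i] unfolding p_def by eventually_elim simp
    qed
  qed
  \<comment> \<open>Where \<open>v\<close> is positive the price vanishes, so \<open>v\<close> is
    carried by the event \<open>B\<close> on which the unit exchange is reversible; undoing it there
    undoes the whole exchange.\<close>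
  have N0_term: "(\<lambda>w. F t w (v w *\<^sub>R a)) \<in> N0_t t"
    if t: "t \<le> T" and a: "a \<in> units" and v: "v \<in> borel_measurable (H t)" "\<And>w. 0 \<le> v w"
      and wp: "AE w in M. 0 < v w \<longrightarrow> p t a w = 0" for t a v
  proof (cases "a \<in> Acone")
    case False
    have "AE w in M. F t w (v w *\<^sub>R a) = v w *\<^sub>R F t w a" by (rule Fscale[OF t v(2)])
    with HA_units[OF HA t a False] have "AE w in M. F t w (v w *\<^sub>R a) = 0" by eventually_elim simp
    then show ?thesis by (rule N0set_zero[OF t])
  next
    case True
    interpret G: sigma_finite_subalgebra M "H t" by (rule sigma_finite_sub[OF prob_space_axioms sub[OF t]])
    have i: "integrable M (\<lambda>w. Z w \<bullet> F t w a)" by (rule polarD(4)[OF Z Cond_I_units[OF I t a]])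
    have "(H t, \<lambda>w. - F t w a) \<in> K1 \<union> K2" using t a True by (auto simp: K2_def)
    from ex[OF this] obtain B where B: "B \<in> sets (H t)"
      "AE w in M. real_cond_exp M (H t) (\<lambda>w. Z w \<bullet> - F t w a) w \<le> 0 \<longrightarrow> w \<in> B"
      "(\<lambda>w. indicator B w *\<^sub>R - F t w a) \<in> A" by blast
    let ?\<kappa> = "\<lambda>w. indicator B w *\<^sub>R a"
    have FB: "AE w in M. F t w (indicator B w *\<^sub>R a) = indicator B w *\<^sub>R F t w a" by (rule Fscale[OF t]) simp
    have "hedged 0 (\<lambda>w. - F t w (?\<kappa> w))"
      using B(3) unfolding A_def mem_Collect_eq by (rule hedged_mono) (use FB in \<open>auto elim: eventually_mono\<close>)
    note ker = kernel_of_hedged_minus[OF t unit_meas[OF B(1) True] this]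
    have "AE w in M. real_cond_exp M (H t) (\<lambda>w. (-1) * (Z w \<bullet> F t w a)) w = (-1) * p t a w"
      unfolding p_def using i by (rule G.real_cond_exp_cmult)
    with B(2) wp have wB: "AE w in M. v w * indicator B w = v w"
    proof eventually_elim
      case (elim w)
      show ?case
      proof (cases "0 < v w")
        case True
        then show ?thesis using elim by simp
      next
        case False
        then have "v w = 0" using v(2)[of w] by simp
        then show ?thesis by simp
      qed
    qed
    have mk: "(\<lambda>w. - ?\<kappa> w) \<in> strat t"
    proof -
      have "AE w in M. - ?\<kappa> w \<in> Acone" using ker by eventually_elim simp
      then show ?thesis using L0_measurable[OF unit_meas[OF B(1) True]] by (simp add: L0_def)
    qed
    have 1: "(\<lambda>w. F t w (v w *\<^sub>R a)) \<in> N_t t"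
      by (rule NsetI[OF L0_scale[OF v(1) _ L0_const[OF True]]]) (use v in auto)
    have 2: "(\<lambda>w. - F t w (v w *\<^sub>R a)) \<in> N_t t"
    proof (rule NsetI[OF L0_scale[OF v(1) _ mk]])
      show "AE w in M. - F t w (v w *\<^sub>R a) = F t w (v w *\<^sub>R - (indicator B w *\<^sub>R a))"
        using wB ker AE_F_class[OF t] FB
      proof eventually_elim
        case (elim w)
        have "F t w (v w *\<^sub>R - (indicator B w *\<^sub>R a)) = v w *\<^sub>R F t w (- (indicator B w *\<^sub>R a))"
          using elim(3) v(2) by (simp only: Fclass_A_scale)
        also have "\<dots> = - ((v w * indicator B w) *\<^sub>R F t w a)" using elim(2,4) by simp
        also have "\<dots> = - F t w (v w *\<^sub>R a)" unfolding elim(1) using elim(3) v(2) by (simp only: Fclass_A_scale)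
        finally show ?case by simp
      qed
    qed (use v in auto)
    show ?thesis using 1 2 by (simp add: N0set_def)
  qed
  have u1: "emat i j \<in> units" "- emat i j \<in> units" for i j :: 'd by (auto simp: units_iff)
  have Dset_conditions: "(AE w in M. Fbar M H F t \<eta> Z w \<le> 0) \<and>
      (\<lambda>w. if Fbar M H F t \<eta> Z w = 0 then F t w (\<eta> w) else 0) \<in> N0_t t"
    if t: "t \<le> T" and \<eta>: "\<eta> \<in> strat t" for t \<eta>
  proof -
    have pall: "AE w in M. \<forall>i\<in>UNIV. \<forall>j\<in>UNIV. p t (emat i j) w \<le> 0 \<and> p t (- emat i j) w \<le> 0"
      using p_le[OF t] u1 by (intro AE_finite_allI) auto
    have Fb: "Fbar M H F t \<eta> Z w = (\<Sum>i\<in>UNIV. \<Sum>j\<in>UNIV. max (\<eta> w $ i $ j) 0 * p t (emat i j) w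
        + max (- (\<eta> w $ i $ j)) 0 * p t (- emat i j) w)" for w
      by (simp add: Fbar_def p_def)
    have 1: "AE w in M. Fbar M H F t \<eta> Z w \<le> 0"
      using pall
    proof eventually_elim
      case (elim w)
      then show ?case unfolding Fb by (intro sum_nonpos add_nonpos_nonpos mult_nonneg_nonpos) auto
    qed
    define D where "D = {w \<in> space (H t). Fbar M H F t \<eta> Z w = 0}"
    have \<eta>m: "\<eta> \<in> borel_measurable (H t)" by (rule L0_measurable[OF \<eta>])
    have D_sets: "D \<in> sets (H t)" unfolding D_def using Fbar_measurable[OF \<eta>m, of Z] by measurable
    define wp where "wp = (\<lambda>i j w. indicator D w * max (\<eta> w $ i $ j) 0)"
    define wm where "wm = (\<lambda>i j w. indicator D w * max (- (\<eta> w $ i $ j)) 0)"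
    have wm_meas: "wp i j \<in> borel_measurable (H t)" "wm i j \<in> borel_measurable (H t)" for i j
      unfolding wp_def wm_def using entry_measurable[OF \<eta>m] D_sets
      by (auto intro!: borel_measurable_times borel_measurable_max borel_measurable_uminus)
    have w_nn: "0 \<le> wp i j w" "0 \<le> wm i j w" for i j w by (auto simp: wp_def wm_def)
    have "AE w in M. \<forall>i\<in>UNIV. \<forall>j\<in>UNIV. (0 < wp i j w \<longrightarrow> p t (emat i j) w = 0) \<and> (0 < wm i j w \<longrightarrow> p t (- emat i j) w = 0)"
      using pall
    proof eventually_elim
      case (elim w)
      let ?f = "\<lambda>i j. - (max (\<eta> w $ i $ j) 0 * p t (emat i j) w)" and ?g = "\<lambda>i j. - (max (- (\<eta> w $ i $ j)) 0 * p t (- emat i j) w)"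
      have fg: "0 \<le> ?f i j" "0 \<le> ?g i j" for i j using elim by (auto intro!: mult_nonneg_nonpos)
      \<comment> \<open>A vanishing sum of terms of one sign vanishes termwise, so on
        \<open>D\<close> every unit actually traded has conditional price 0.\<close>
      have zero: "?f i j = 0 \<and> ?g i j = 0" if "w \<in> D" for i j
      proof -
        define h where "h = (\<lambda>i j. ?f i j + ?g i j)"
        have h_nn: "0 \<le> h i j" for i j unfolding h_def by (rule add_nonneg_nonneg[OF fg])
        have "(\<Sum>i\<in>UNIV. \<Sum>j\<in>UNIV. h i j) = - Fbar M H F t \<eta> Z w"
          unfolding Fb h_def by (simp add: sum_negf[symmetric])
        also have "\<dots> = 0" using that by (simp add: D_def)
        finally have "\<forall>i\<in>UNIV. (\<Sum>j\<in>UNIV. h i j) = 0"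
          by (subst (asm) sum_nonneg_eq_0_iff) (auto intro!: sum_nonneg h_nn)
        then have "(\<Sum>j\<in>UNIV. h i j) = 0" by blast
        then have "\<forall>j\<in>UNIV. h i j = 0" by (subst (asm) sum_nonneg_eq_0_iff) (auto intro!: h_nn)
        then have "?f i j + ?g i j = 0" unfolding h_def by blast
        then show ?thesis using fg[of i j] by linarith
      qed
      show ?case
      proof (intro ballI conjI impI)
        fix i j assume "0 < wp i j w"
        then have "w \<in> D" "max (\<eta> w $ i $ j) 0 \<noteq> 0" by (cases "w \<in> D"; simp add: wp_def)+
        then show "p t (emat i j) w = 0" using zero[OF \<open>w \<in> D\<close>, of i j] unfolding neg_equal_0_iff_equal mult_eq_0_iff by blast
      next
        fix i j assume "0 < wm i j w"
        then have "w \<in> D" "max (- (\<eta> w $ i $ j)) 0 \<noteq> 0" by (cases "w \<in> D"; simp add: wm_def)+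
        then show "p t (- emat i j) w = 0" using zero[OF \<open>w \<in> D\<close>, of i j] unfolding neg_equal_0_iff_equal mult_eq_0_iff by blast
      qed
    qed
    then have wz: "AE w in M. 0 < wp i j w \<longrightarrow> p t (emat i j) w = 0" "AE w in M. 0 < wm i j w \<longrightarrow> p t (- emat i j) w = 0" for i j
      by (auto elim!: eventually_mono)
    have "(\<lambda>w. \<Sum>i\<in>UNIV. \<Sum>j\<in>UNIV. F t w (wp i j w *\<^sub>R emat i j) + F t w (wm i j w *\<^sub>R - emat i j)) \<in> N0_t t"
      by (intro N0set_sum[OF HN0 t] N0set_add[OF HN0 t] N0_term[OF t] u1 wm_meas w_nn wz) auto
    moreover have "AE w in M. (if Fbar M H F t \<eta> Z w = 0 then F t w (\<eta> w) else 0) =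
        (\<Sum>i\<in>UNIV. \<Sum>j\<in>UNIV. F t w (wp i j w *\<^sub>R emat i j) + F t w (wm i j w *\<^sub>R - emat i j))"
      using HA_decomp[OF HA t measurable_H_M[OF \<eta>m t]] AE_F_class[OF t] AE_space
    proof eventually_elim
      case (elim w)
      have "(if Fbar M H F t \<eta> Z w = 0 then F t w (\<eta> w) else 0) = indicator D w *\<^sub>R F t w (\<eta> w)"
        using elim(3) by (simp add: D_def space_H[OF t])
      also have "\<dots> = (\<Sum>i\<in>UNIV. \<Sum>j\<in>UNIV. wp i j w *\<^sub>R F t w (emat i j) + wm i j w *\<^sub>R F t w (- emat i j))"
        unfolding elim(1) wp_def wm_def by (simp add: scaleR_sum_right scaleR_add_right)
      also have "\<dots> = (\<Sum>i\<in>UNIV. \<Sum>j\<in>UNIV. F t w (wp i j w *\<^sub>R emat i j) + F t w (wm i j w *\<^sub>R - emat i j))"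
        using elim(2) w_nn by (simp only: Fclass_A_scale)
      finally show ?case .
    qed
    ultimately have "(\<lambda>w. if Fbar M H F t \<eta> Z w = 0 then F t w (\<eta> w) else 0) \<in> N0_t t" by (rule N0set_AE_eq)
    with 1 show ?thesis by simp
  qed
  have "Z \<in> Dset M H T Acone F"
    unfolding Dset_def using Zm C Zpos Dset_conditions by (auto simp: adapted_def)
  then show ?thesis by blast
qed

end

section \<open>Consequences of the existence of a consistent price system\<close>

lemma has_cond_exp_cong_right:
  assumes prob: "prob_space M" and sub: "subalgebra M G"
    and U: "has_cond_exp M G U u" and v: "v \<in> borel_measurable G" and ae: "AE w in M. u w = v w"
  shows "has_cond_exp M G U v"
proof -
  obtain h where h: "cond_exp_weight M G U u h" and m: "U \<in> borel_measurable M"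
    using U unfolding has_cond_exp_def by blast
  have "AE w in M. real_cond_exp M G (\<lambda>w. h w * U w) w = h w * v w"
    using cond_exp_weightD(5)[OF h] ae by eventually_elim simp
  then have "cond_exp_weight M G U v h" using h by (simp add: cond_exp_weight_def)
  then show ?thesis unfolding has_cond_exp_def using m v by blast
qed

lemma (in prob_space) nonneg_sum_has_cond_exp:
  fixes U u :: "nat \<Rightarrow> 'a \<Rightarrow> real"
  assumes G: "\<And>i. subalgebra M (G i)" "\<And>i j. i \<le> j \<Longrightarrow> sets (G i) \<subseteq> sets (G j)"
    and U: "\<And>i. i < m \<Longrightarrow> has_cond_exp M (G i) (U i) (u i)"
    and u: "\<And>i. i < m \<Longrightarrow> AE w in M. u i w \<le> 0"
    and nn: "AE w in M. 0 \<le> (\<Sum>i<m. U i w)"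
  shows "AE w in M. (\<Sum>i<m. U i w) = 0" and "j < m \<Longrightarrow> AE w in M. u j w = 0"
proof -
  have nn': "AE w in M. - 0 \<le> (\<Sum>i<m. U i w)" using nn by simp
  have 1: "integrable M (\<lambda>w. \<Sum>i<m. U i w) \<and> (\<integral>w. (\<Sum>i<m. U i w) \<partial>M) \<le> 0"
    by (rule sum_has_cond_exp_nonpos[where G=G and W="\<lambda>_. 0", OF G U u _ nn']) auto
  then have 2: "(\<integral>w. (\<Sum>i<m. U i w) \<partial>M) = 0" using integral_nonneg_AE[OF nn] by simp
  then show "AE w in M. (\<Sum>i<m. U i w) = 0" using integral_nonneg_eq_0_iff_AE[OF conjunct1[OF 1] nn] by simp
  show "AE w in M. u j w = 0" if "j < m"
    by (rule sum_has_cond_exp_eq_0[where G=G and W="\<lambda>_. 0", OF G U u _ nn' 2 that]) auto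
qed

lemma inner_nonneg_vec: "0 \<le> z \<Longrightarrow> 0 \<le> x \<Longrightarrow> 0 \<le> z \<bullet> (x :: real^'n)"
  by (simp add: inner_vec_def less_eq_vec_def sum_nonneg)

lemma inner_pos_eq_0_iff:
  fixes x z :: "real^'n"
  assumes "\<And>i. 0 < z $ i" "0 \<le> x" "z \<bullet> x = 0"
  shows "x = 0"
proof -
  have "\<forall>i\<in>UNIV. z $ i * x $ i = 0"
    using assms by (subst sum_nonneg_eq_0_iff[symmetric]) (auto simp: inner_vec_def less_eq_vec_def less_imp_le)
  then show ?thesis using assms(1) by (auto simp: vec_eq_iff) (metis less_irrefl)
qed

lemma emat_nth: "emat i j $ k $ l = (if k = i then (if l = j then 1 else 0) else 0)"
  by (simp add: emat_def)

lemma sum_sum_delta: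
  fixes c :: "'b::comm_monoid_add"
  shows "(\<Sum>k\<in>(UNIV :: 'i::finite set). \<Sum>l\<in>(UNIV :: 'j::finite set). if k = i then (if l = j then c else 0) else 0) = c"
proof -
  have "(\<Sum>l\<in>(UNIV :: 'j set). if k = i then (if l = j then c else 0) else 0) = (if k = i then c else 0)" for k
    by simp
  then show ?thesis by simp
qed

context market
begin

definition piece :: "nat \<Rightarrow> 'a \<Rightarrow> 'd \<Rightarrow> 'd \<Rightarrow> real \<Rightarrow> real^'d" where
  "piece t w i j x = max x 0 *\<^sub>R F t w (emat i j) + max (- x) 0 *\<^sub>R F t w (- emat i j)"

lemma HA_piece:
  assumes "HA M T Acone F" "t \<le> T" "\<eta> \<in> borel_measurable M"
  shows "AE w in M. F t w (\<eta> w) = (\<Sum>i\<in>UNIV. \<Sum>j\<in>UNIV. piece t w i j (\<eta> w $ i $ j))"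
  using HA_decomp[OF assms] unfolding piece_def .

text \<open>If both units or neither lie in the cone, superadditivity or \<open>HA\<close> suffices.
  If only one does, the other has value 0. Removing the entry from \<open>a\<close> or
  \<open>a'\<close> by a multiple of the admissible unit then leaves \<open>F\<close> unchanged,
  while superadditivity adds that multiple of the unit's value, which must therefore be
  nonpositive.\<close>

lemma piece_nonpos:
  assumes HA: "HA M T Acone F" and t: "t \<le> T"
    and a: "a \<in> Acone" "a $ i $ j < 0" and a': "a' \<in> Acone" "0 < a' $ i $ j"
  shows "AE w in M. F t w (emat i j) + F t w (- emat i j) \<le> 0"
proof -
  have u: "emat i j \<in> units" "- emat i j \<in> units" by (auto simp: units_iff)
  have shift: "AE w in M. F t w (b + x *\<^sub>R emat i j) = F t w b - piece t w i j (b $ i $ j) + piece t w i j (b $ i $ j + x)" for b x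
  proof -
    have "AE w in M. F t w b = (\<Sum>i\<in>UNIV. \<Sum>j\<in>UNIV. piece t w i j (b $ i $ j))" by (rule HA_piece[OF HA t]) simp
    moreover have "AE w in M. F t w (b + x *\<^sub>R emat i j) = (\<Sum>k\<in>UNIV. \<Sum>l\<in>UNIV. piece t w k l ((b + x *\<^sub>R emat i j) $ k $ l))"
      by (rule HA_piece[OF HA t]) simp
    ultimately show ?thesis
    proof eventually_elim
      case (elim w)
      have "F t w (b + x *\<^sub>R emat i j) - F t w b =
        (\<Sum>k\<in>UNIV. \<Sum>l\<in>UNIV. piece t w k l ((b + x *\<^sub>R emat i j) $ k $ l) - piece t w k l (b $ k $ l))"
        unfolding elim by (simp add: sum_subtractf)
      also have "\<dots> = (\<Sum>k\<in>UNIV. \<Sum>l\<in>UNIV. if k = i then (if l = j then piece t w i j (b $ i $ j + x) - piece t w i j (b $ i $ j) else 0) else 0)"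
        by (intro sum.cong refl) (auto simp: emat_nth)
      also have "\<dots> = piece t w i j (b $ i $ j + x) - piece t w i j (b $ i $ j)" by (rule sum_sum_delta)
      finally show ?case by (simp add: algebra_simps)
    qed
  qed
  consider "emat i j \<in> Acone" "- emat i j \<in> Acone" | "emat i j \<notin> Acone" "- emat i j \<notin> Acone"
    | "emat i j \<notin> Acone" "- emat i j \<in> Acone" | "emat i j \<in> Acone" "- emat i j \<notin> Acone" by blast
  then show ?thesis
  proof cases
    case 1
    show ?thesis using AE_F_class[OF t]
    proof eventually_elim
      case (elim w)
      show ?case using Fclass_add[OF elim 1] Fclass_A_0[OF elim] by simp
    qed
  next
    case 2
    show ?thesis using HA_units[OF HA t u(1) 2(1)] HA_units[OF HA t u(2) 2(2)] by eventually_elim simp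
  next
    case 3
    show ?thesis using HA_units[OF HA t u(1) 3(1)] AE_F_class[OF t] shift[of a' "- (a' $ i $ j)"]
    proof eventually_elim
      case (elim w)
      let ?x = "a' $ i $ j"
      have "1 *\<^sub>R F t w a' + ?x *\<^sub>R F t w (- emat i j) \<le> F t w (1 *\<^sub>R a' + ?x *\<^sub>R (- emat i j))"
        using elim a' 3 by (intro Fclass_superadd) auto
      moreover have "F t w (a' - ?x *\<^sub>R emat i j) = F t w a'"
        using elim a' by (simp add: piece_def)
      ultimately have "?x *\<^sub>R F t w (- emat i j) \<le> 0" by simp
      then show ?case using a'(2) elim by (simp add: less_eq_vec_def mult_le_0_iff)
    qed
  next
    case 4
    show ?thesis using HA_units[OF HA t u(2) 4(2)] AE_F_class[OF t] shift[of a "- (a $ i $ j)"]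
    proof eventually_elim
      case (elim w)
      let ?x = "- (a $ i $ j)"
      have "1 *\<^sub>R F t w a + ?x *\<^sub>R F t w (emat i j) \<le> F t w (1 *\<^sub>R a + ?x *\<^sub>R emat i j)"
        using elim a 4 by (intro Fclass_superadd) auto
      moreover have "F t w (a + ?x *\<^sub>R emat i j) = F t w a"
        using elim a by (simp add: piece_def)
      ultimately have "?x *\<^sub>R F t w (emat i j) \<le> 0" by simp
      then show ?case using a(2) elim by (auto simp: less_eq_vec_def zero_le_mult_iff)
    qed
  qed
qed

end

section \<open>No-arbitrage derived from a given price system\<close>

locale priced_market = market M H T Acone F
  for M :: "'a measure" and H :: "nat \<Rightarrow> 'a measure" and T :: nat
    and Acone :: "('d::finite) mat set" and F :: "nat \<Rightarrow> 'a \<Rightarrow> 'd mat \<Rightarrow> real^'d" +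
  fixes Z :: "'a \<Rightarrow> real^'d"
  assumes HN0: "HN0 M H T Acone F" and HA: "HA M T Acone F" and I: "Cond_I M T F"
    and Z: "Z \<in> Dset M H T Acone F"
begin

lemma Z_measurable[measurable]: "Z \<in> borel_measurable M" using Z by (simp add: Dset_def)

lemma Z_pos: "AE w in M. \<forall>i. 0 < Z w $ i" using Z by (simp add: Dset_def AE_all_countable)

lemma Z_inner_integrable: "integrable M X \<Longrightarrow> integrable M (\<lambda>w. Z w \<bullet> X w)"
  using Z by (auto simp: Dset_def intro: integrable_bounded_inner)

lemma Dset_conditions:
  assumes t: "t \<le> T" and \<eta>: "\<eta> \<in> strat t"
  shows "AE w in M. Fbar M H F t \<eta> Z w \<le> 0"
    and "AE w in M. Fbar M H F t \<eta> Z w = 0 \<Longrightarrow> (\<lambda>w. F t w (\<eta> w)) \<in> N0_t t"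
proof -
  have ad: "(\<lambda>s. if s = t then \<eta> else (\<lambda>_. 0)) \<in> adapted M H T Acone"
    using \<eta> L0_zero by (auto simp: adapted_def)
  have D: "\<forall>\<eta>\<in>adapted M H T Acone. \<forall>t\<le>T. (AE w in M. Fbar M H F t (\<eta> t) Z w \<le> 0) \<and>
      (\<lambda>w. if Fbar M H F t (\<eta> t) Z w = 0 then F t w (\<eta> t w) else 0) \<in> N0_t t"
    using Z unfolding Dset_def mem_Collect_eq by (elim conjE)
  note D' = D[rule_format, OF ad t, unfolded if_P[OF refl]]
  from D' have D1: "AE w in M. Fbar M H F t \<eta> Z w \<le> 0" by (rule conjunct1)
  from D' have D2: "(\<lambda>w. if Fbar M H F t \<eta> Z w = 0 then F t w (\<eta> w) else 0) \<in> N0_t t" by (rule conjunct2)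
  show "AE w in M. Fbar M H F t \<eta> Z w \<le> 0" by (rule D1)
  show "(\<lambda>w. F t w (\<eta> w)) \<in> N0_t t" if "AE w in M. Fbar M H F t \<eta> Z w = 0"
    by (rule N0set_AE_eq[OF D2]) (use that in \<open>auto elim: eventually_mono\<close>)
qed

definition price :: "nat \<Rightarrow> 'd mat \<Rightarrow> 'a \<Rightarrow> real" where
  "price t a = real_cond_exp M (H t) (\<lambda>w. Z w \<bullet> F t w a)"

lemma price_measurable[measurable]: "price t a \<in> borel_measurable (H t)" unfolding price_def by simp

lemma has_cond_exp_price:
  assumes "t \<le> T" "a \<in> units"
  shows "has_cond_exp M (H t) (\<lambda>w. Z w \<bullet> F t w a) (price t a)"
  unfolding price_def
  by (intro has_cond_exp_integrable[OF prob_space_axioms sub] Z_inner_integrable Cond_I_units[OF I] assms)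

lemma units_mem: "emat i j \<in> units" "- emat i j \<in> units" by (auto simp: units_iff)

text \<open>Inside the cone this is (D1) for the constant strategy \<open>a\<close>; outside it the
  price is 0 by \<open>HA\<close>.\<close>

lemma price_nonpos:
  assumes t: "t \<le> T" and a: "a \<in> units"
  shows "AE w in M. price t a w \<le> 0"
proof (cases "a \<in> Acone")
  case True
  obtain i j where ij: "a = emat i j \<or> a = - emat i j" using a by (auto simp: units_iff)
  have D1: "AE w in M. Fbar M H F t (\<lambda>_. a) Z w \<le> 0" by (rule Dset_conditions(1)[OF t L0_const[OF True]])
  have Fb: "Fbar M H F t (\<lambda>_. a) Z w = (\<Sum>k\<in>UNIV. \<Sum>l\<in>UNIV. max (a $ k $ l) 0 * price t (emat k l) w + max (- (a $ k $ l)) 0 * price t (- emat k l) w)" for w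
    by (simp add: Fbar_def price_def)
  have "Fbar M H F t (\<lambda>_. a) Z w = price t a w" for w
  proof -
    have "Fbar M H F t (\<lambda>_. a) Z w = (\<Sum>k\<in>UNIV. \<Sum>l\<in>UNIV. if k = i then (if l = j then price t a w else 0) else 0)"
      unfolding Fb using ij by (intro sum.cong refl) (auto simp: emat_nth)
    then show ?thesis by (simp only: sum_sum_delta)
  qed
  then show ?thesis using D1 by simp
next
  case False
  show ?thesis
    using cond_exp_unit_eq_0[OF HA t a False Z_inner_integrable[OF Cond_I_units[OF I t a]]]
    unfolding price_def by eventually_elim simp
qed

text \<open>For unbounded strategies \<open>Z \<bullet> F\<close> may fail to be integrable; the
  formula \<open>Fbar\<close> is its conditional expectation in the generalized sense.\<close>

lemma has_cond_exp_Fbar: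
  assumes t: "t \<le> T" and \<eta>: "\<eta> \<in> borel_measurable (H t)"
  shows "has_cond_exp M (H t) (\<lambda>w. Z w \<bullet> F t w (\<eta> w)) (Fbar M H F t \<eta> Z)"
proof (rule has_cond_exp_cong[OF prob_space_axioms sub[OF t]])
  have m: "(\<lambda>w. max (\<eta> w $ i $ j) 0) \<in> borel_measurable (H t)" "(\<lambda>w. max (- (\<eta> w $ i $ j)) 0) \<in> borel_measurable (H t)" for i j
    using entry_measurable[OF \<eta>] by (auto intro!: borel_measurable_max borel_measurable_uminus)
  show "has_cond_exp M (H t) (\<lambda>w. \<Sum>i\<in>UNIV. \<Sum>j\<in>UNIV. max (\<eta> w $ i $ j) 0 * (Z w \<bullet> F t w (emat i j))
      + max (- (\<eta> w $ i $ j)) 0 * (Z w \<bullet> F t w (- emat i j))) (Fbar M H F t \<eta> Z)"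
    unfolding Fbar_def price_def[symmetric]
    by (intro has_cond_exp_sum[OF prob_space_axioms sub[OF t]] has_cond_exp_add[OF prob_space_axioms sub[OF t]]
        has_cond_exp_mult[OF prob_space_axioms sub[OF t]] has_cond_exp_price t units_mem m) auto
  show "(\<lambda>w. Z w \<bullet> F t w (\<eta> w)) \<in> borel_measurable M" using F_measurable[OF t measurable_H_M[OF \<eta> t]] by measurable
  show "AE w in M. Z w \<bullet> F t w (\<eta> w) = (\<Sum>i\<in>UNIV. \<Sum>j\<in>UNIV. max (\<eta> w $ i $ j) 0 * (Z w \<bullet> F t w (emat i j))
      + max (- (\<eta> w $ i $ j)) 0 * (Z w \<bullet> F t w (- emat i j)))"
    using HA_decomp[OF HA t measurable_H_M[OF \<eta> t]]
  proof eventually_elim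
    case (elim w)
    show ?case unfolding elim by (simp add: inner_sum_right inner_add_right)
  qed
qed

text \<open>The lemmas on sums ask for a filtration over all naturals; freezing the index at
  \<open>t\<close> also makes room for a second exchange at date \<open>t\<close>.\<close>

lemma clip_subalgebra: "t \<le> T \<Longrightarrow> subalgebra M (H (min i t))"
  and clip_mono: "t \<le> T \<Longrightarrow> i \<le> j \<Longrightarrow> sets (H (min i t)) \<subseteq> sets (H (min j t))"
  using sub sub_mono[of "min i t" "min j t"] by (auto simp: subalgebra_def)

text \<open>Equating the two forms of \<open>X\<close> shows that the gains up to \<open>t\<close>,
  together with a second exchange \<open>\<theta>\<close> at date \<open>t\<close>, equal
  \<open>r + r'\<close> and are thus nonnegative. Under \<open>Z\<close> their sum must vanish, and
  so must the conditional price of \<open>\<theta>\<close>; (D2) then makes its gain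
  reversible.\<close>

lemma NAs: "NAs M H T Acone F"
  unfolding NAs_def
proof (intro allI impI, elim conjE bexE)
  fix t X Y r' assume t: "t \<le> T" and X: "X \<in> Aset M H T Acone F t" and Y: "Y \<in> N_t t"
    and r': "r' \<in> L0 M nonneg_orthant M" and XY: "AE w in M. X w = - Y w + r' w"
  obtain \<eta> r where \<eta>: "\<And>s. s \<le> T \<Longrightarrow> \<eta> s \<in> strat s" and r: "r \<in> borel_measurable M" "AE w in M. 0 \<le> r w"
    and X': "AE w in M. X w = (\<Sum>s\<le>t. F s w (\<eta> s w)) - r w"
    using X t by (rule AsetE) blast
  obtain \<theta> where \<theta>: "\<theta> \<in> strat t" and Y': "AE w in M. Y w = F t w (\<theta> w)" using Y by (rule NsetE)
  have r'0: "AE w in M. 0 \<le> r' w" using r' by (simp add: L0_def nonneg_orthant_iff)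
  \<comment> \<open>Index \<open>t + 1\<close> carries the extra exchange \<open>\<theta>\<close>,
    which \<open>min i t\<close> places at date \<open>t\<close> as well.\<close>
  define V where "V = (\<lambda>i. if i \<le> t then \<eta> i else \<theta>)"
  have V: "V i \<in> L0 M Acone (H (min i t))" for i using \<eta>[of i] \<theta> t by (auto simp: V_def min_def)
  define U where "U = (\<lambda>i w. Z w \<bullet> F (min i t) w (V i w))"
  have sumU: "(\<Sum>i<Suc (Suc t). U i w) = Z w \<bullet> ((\<Sum>s\<le>t. F s w (\<eta> s w)) + F t w (\<theta> w))" for w
  proof -
    have "(\<Sum>i<Suc t. U i w) = (\<Sum>s\<le>t. Z w \<bullet> F s w (\<eta> s w))"
      unfolding lessThan_Suc_atMost by (intro sum.cong) (auto simp: U_def V_def)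
    moreover have "U (Suc t) w = Z w \<bullet> F t w (\<theta> w)" by (simp add: U_def V_def)
    ultimately show ?thesis by (simp add: inner_add_right inner_sum_right)
  qed
  have R: "AE w in M. (\<Sum>s\<le>t. F s w (\<eta> s w)) + F t w (\<theta> w) = r w + r' w"
    using X' XY Y' by eventually_elim (simp add: algebra_simps)
  have nn: "AE w in M. 0 \<le> (\<Sum>i<Suc (Suc t). U i w)"
    using R r(2) r'0 Z_pos
  proof eventually_elim
    case (elim w)
    show ?case unfolding sumU elim(1) using elim
      by (intro inner_nonneg_vec add_nonneg_nonneg) (auto simp: less_eq_vec_def less_imp_le)
  qed
  have U: "has_cond_exp M (H (min i t)) (U i) (Fbar M H F (min i t) (V i) Z)" for i
    unfolding U_def using t by (intro has_cond_exp_Fbar L0_measurable V) auto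
  have u: "AE w in M. Fbar M H F (min i t) (V i) Z w \<le> 0" for i using t by (intro Dset_conditions(1) V) auto
  have z1: "AE w in M. (\<Sum>i<Suc (Suc t). U i w) = 0"
    by (rule nonneg_sum_has_cond_exp(1)[where G="\<lambda>i. H (min i t)", OF clip_subalgebra[OF t] clip_mono[OF t] U u nn]) auto
  have "AE w in M. Fbar M H F (min (Suc t) t) (V (Suc t)) Z w = 0"
    by (rule nonneg_sum_has_cond_exp(2)[where G="\<lambda>i. H (min i t)", OF clip_subalgebra[OF t] clip_mono[OF t] U u nn]) auto
  then have "(\<lambda>w. F t w (\<theta> w)) \<in> N0_t t" by (intro Dset_conditions(2)[OF t \<theta>]) (simp add: V_def)
  then have "(\<lambda>w. - F t w (\<theta> w)) \<in> N0_t t" by (rule N0set_minus)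
  moreover have "AE w in M. X w = - F t w (\<theta> w)"
    using z1 R r(2) r'0 Z_pos XY Y'
  proof eventually_elim
    case (elim w)
    have "r w + r' w = 0"
      by (rule inner_pos_eq_0_iff[of "Z w"]) (use elim(1-5) in \<open>auto simp only: sumU intro: add_nonneg_nonneg\<close>)
    then have "r' w = 0" using elim(3,4) by (simp add: add_nonneg_eq_0_iff)
    then show ?case using elim by simp
  qed
  ultimately show "X \<in> N0_t t" by (rule N0set_AE_eq)
qed

text \<open>The transaction costs of the dominating market vanish altogether: its exchange function is linear,
  with a rate \<open>g\<close> in direction \<open>(i, j)\<close> lying between the bid and the ask price of \<open>F\<close> and having
  conditional price \<open>0\<close> under \<open>Z\<close>.\<close>

lemma fair_rate:
  assumes t: "t \<le> T"
  shows "\<exists>g\<in>borel_measurable M. has_cond_exp M (H t) (\<lambda>w. Z w \<bullet> g w) (\<lambda>_. 0) \<and>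
    (AE w in M. \<forall>a\<in>Acone. piece t w i j (a $ i $ j) \<le> a $ i $ j *\<^sub>R g w)"
proof -
  let ?e = "emat i j"
  let ?c = "\<lambda>w. F t w ?e" and ?d = "\<lambda>w. F t w (- ?e)"
  let ?p = "price t ?e" and ?m = "price t (- ?e)"
  note hadd = has_cond_exp_add[OF prob_space_axioms sub[OF t]]
    and hmult = has_cond_exp_mult[OF prob_space_axioms sub[OF t]]
    and hright = has_cond_exp_cong_right[OF prob_space_axioms sub[OF t]]
  have hp: "has_cond_exp M (H t) (\<lambda>w. Z w \<bullet> ?c w) ?p" and hm: "has_cond_exp M (H t) (\<lambda>w. Z w \<bullet> ?d w) ?m"
    by (intro has_cond_exp_price t units_mem)+
  have cm[measurable]: "?c \<in> borel_measurable M" "?d \<in> borel_measurable M"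
    by (intro borel_measurable_integrable Cond_I_units[OF I t] units_mem)+
  have np: "AE w in M. ?p w \<le> 0" "AE w in M. ?m w \<le> 0" by (intro price_nonpos t units_mem)+
  define one where "one = (\<chi> k. 1 :: real^'d)"
  define q where "q = real_cond_exp M (H t) (\<lambda>w. Z w \<bullet> one)"
  have q_m[measurable]: "q \<in> borel_measurable (H t)" unfolding q_def by simp
  have hq: "has_cond_exp M (H t) (\<lambda>w. Z w \<bullet> one) q"
    unfolding q_def by (intro has_cond_exp_integrable[OF prob_space_axioms sub[OF t]] Z_inner_integrable) auto
  have q_pos: "AE w in M. 0 < q w"
  proof -
    interpret G: sigma_finite_subalgebra M "H t" by (rule sigma_finite_sub[OF prob_space_axioms sub[OF t]])
    have "AE w in M. 0 < Z w \<bullet> one"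
      using Z_pos by eventually_elim (auto simp: inner_vec_def one_def intro!: sum_pos)
    then show ?thesis unfolding q_def by (intro G.real_cond_exp_gr_c Z_inner_integrable) auto
  qed
  \<comment> \<open>When the entry has only one sign, any rate above the unit's value dominates.
    Raising all components by the unit's price, taken relative to the price \<open>q\<close> of
    \<open>one\<close>, brings the conditional price to 0.\<close>
  have dom: "\<exists>g\<in>borel_measurable M. has_cond_exp M (H t) (\<lambda>w. Z w \<bullet> g w) (\<lambda>_. 0) \<and> (AE w in M. F t w a \<le> g w)"
    if a: "a \<in> units" for a
  proof -
    define g where "g = (\<lambda>w. F t w a - (price t a w / q w) *\<^sub>R one)"
    have [measurable]: "price t a \<in> borel_measurable M" "q \<in> borel_measurable M" by (intro measurable_H_M[OF _ t] price_measurable q_m)+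
    have [measurable]: "(\<lambda>w. F t w a) \<in> borel_measurable M" by (intro borel_measurable_integrable Cond_I_units[OF I t a])
    have "g \<in> borel_measurable M" unfolding g_def by measurable
    moreover have "has_cond_exp M (H t) (\<lambda>w. Z w \<bullet> g w) (\<lambda>_. 0)"
    proof (rule hright)
      have "has_cond_exp M (H t) (\<lambda>w. Z w \<bullet> F t w a + (- (price t a w / q w)) * (Z w \<bullet> one)) (\<lambda>w. price t a w + (- (price t a w / q w)) * q w)"
        by (intro hadd hmult has_cond_exp_price[OF t a] hq) measurable
      then show "has_cond_exp M (H t) (\<lambda>w. Z w \<bullet> g w) (\<lambda>w. price t a w + (- (price t a w / q w)) * q w)"
        by (simp add: g_def inner_diff_right)
      show "AE w in M. price t a w + (- (price t a w / q w)) * q w = 0" using q_pos by eventually_elim simp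
    qed simp
    moreover have "AE w in M. F t w a \<le> g w"
      using price_nonpos[OF t a] q_pos
    proof eventually_elim
      case (elim w)
      then have "price t a w / q w \<le> 0" by (simp add: divide_nonpos_pos)
      then show ?case by (simp add: g_def less_eq_vec_def one_def)
    qed
    ultimately show ?thesis by blast
  qed
  consider "AE w in M. ?c w + ?d w \<le> 0" | "\<forall>a\<in>Acone. 0 \<le> a $ i $ j" | "\<forall>a\<in>Acone. a $ i $ j \<le> 0"
    using piece_nonpos[OF HA t, of _ i j] by (meson not_le)
  then show ?thesis
  proof cases
    case 1
    \<comment> \<open>\<open>g = (1 - l) c - l d\<close> lies between \<open>c\<close> and
      \<open>- d\<close>, and this \<open>l\<close> solves \<open>(1 - l) p - l m = 0\<close>. If
      the denominator is 0, both nonpositive prices vanish, and the value 0 of the quotient serves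
      as well.\<close>
    define l where "l = (\<lambda>w. ?p w / (?p w + ?m w))"
    have l_m: "l \<in> borel_measurable (H t)" unfolding l_def by measurable
    have lM[measurable]: "l \<in> borel_measurable M" by (rule measurable_H_M[OF l_m t])
    have l01: "AE w in M. 0 \<le> l w \<and> l w \<le> 1"
      using np by eventually_elim (auto simp: l_def divide_nonpos_nonpos divide_le_eq_1)
    define g where "g = (\<lambda>w. ?c w - l w *\<^sub>R (?c w + ?d w))"
    have "g \<in> borel_measurable M" unfolding g_def by measurable
    moreover have "has_cond_exp M (H t) (\<lambda>w. Z w \<bullet> g w) (\<lambda>_. 0)"
    proof (rule hright)
      have "has_cond_exp M (H t) (\<lambda>w. Z w \<bullet> ?c w + (- l w) * (Z w \<bullet> ?c w + Z w \<bullet> ?d w)) (\<lambda>w. ?p w + (- l w) * (?p w + ?m w))"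
        using l_m by (intro hadd hmult hp hm) auto
      then show "has_cond_exp M (H t) (\<lambda>w. Z w \<bullet> g w) (\<lambda>w. ?p w + (- l w) * (?p w + ?m w))"
        by (simp add: g_def inner_diff_right inner_add_right)
      show "AE w in M. ?p w + (- l w) * (?p w + ?m w) = 0"
        using np by eventually_elim (auto simp: l_def add_nonpos_eq_0_iff)
    qed simp
    moreover have "AE w in M. \<forall>a\<in>Acone. piece t w i j (a $ i $ j) \<le> a $ i $ j *\<^sub>R g w"
      using 1 l01
    proof eventually_elim
      case (elim w)
      have cg: "?c w \<le> g w" "?d w \<le> - g w"
      proof -
        have "l w *\<^sub>R (?c w + ?d w) \<le> 0" using elim by (intro scaleR_nonneg_nonpos) auto
        then show "?c w \<le> g w" by (simp add: g_def)
        have "0 \<le> (1 - l w) *\<^sub>R (- (?c w + ?d w))" using elim by (intro scaleR_nonneg_nonneg) (auto simp: minus_add[symmetric] simp del: minus_add_distrib)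
        then show "?d w \<le> - g w" by (simp add: g_def algebra_simps less_eq_vec_def)
      qed
      have "piece t w i j x \<le> x *\<^sub>R g w" for x
      proof (cases "0 \<le> x")
        case True
        then show ?thesis using scaleR_left_mono[OF cg(1) True] by (simp add: piece_def)
      next
        case False
        then show ?thesis using scaleR_left_mono[OF cg(2), of "- x"] by (simp add: piece_def)
      qed
      then show ?case by simp
    qed
    ultimately show ?thesis by blast
  next
    case 2
    obtain g where g: "g \<in> borel_measurable M" "has_cond_exp M (H t) (\<lambda>w. Z w \<bullet> g w) (\<lambda>_. 0)" "AE w in M. F t w ?e \<le> g w"
      using dom[OF units_mem(1)] by blast
    have "AE w in M. \<forall>a\<in>Acone. piece t w i j (a $ i $ j) \<le> a $ i $ j *\<^sub>R g w"
      using g(3) by eventually_elim (use 2 in \<open>auto simp: piece_def intro: scaleR_left_mono\<close>)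
    then show ?thesis using g by blast
  next
    case 3
    obtain g where g: "g \<in> borel_measurable M" "has_cond_exp M (H t) (\<lambda>w. Z w \<bullet> g w) (\<lambda>_. 0)" "AE w in M. F t w (- ?e) \<le> g w"
      using dom[OF units_mem(2)] by blast
    have "has_cond_exp M (H t) (\<lambda>w. (-1) * (Z w \<bullet> g w)) (\<lambda>w. (-1) * 0)" by (intro hmult g) simp
    then have "has_cond_exp M (H t) (\<lambda>w. Z w \<bullet> - g w) (\<lambda>_. 0)" by simp
    moreover have "AE w in M. \<forall>a\<in>Acone. piece t w i j (a $ i $ j) \<le> a $ i $ j *\<^sub>R - g w"
      using g(3)
    proof eventually_elim
      case (elim w)
      show ?case
      proof
        fix a assume "a \<in> Acone"
        then have "0 \<le> - (a $ i $ j)" using 3 by simp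
        then show "piece t w i j (a $ i $ j) \<le> a $ i $ j *\<^sub>R - g w"
          using scaleR_left_mono[OF elim, of "- (a $ i $ j)"] by (simp add: piece_def)
      qed
    qed
    ultimately show ?thesis using g(1) by (intro bexI[of _ "\<lambda>w. - g w"]) auto
  qed
qed

text \<open>The rates of \<open>fair_rate\<close> make every strategy under \<open>G\<close> have
  conditional price 0. If \<open>G\<close> exceeded \<open>F\<close> only on a null event, the gain
  under \<open>F\<close> would have price 0 too and be reversible by (D2). A nonnegative total gain
  under \<open>G\<close> vanishes, since its pairing with the positive \<open>Z\<close>
  does.\<close>

lemma NAr: "NAr M H T Acone F"
proof -
  define good where "good = (\<lambda>t i j g. g \<in> borel_measurable M \<and> has_cond_exp M (H t) (\<lambda>w. Z w \<bullet> g w) (\<lambda>_. 0) \<and>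
    (AE w in M. \<forall>a\<in>Acone. piece t w i j (a $ i $ j) \<le> a $ i $ j *\<^sub>R g w))"
  define g where "g = (\<lambda>t i j. SOME g. good t i j g)"
  have "good t i j (g t i j)" if "t \<le> T" for t i j
  proof -
    have "\<exists>g. good t i j g" using fair_rate[OF that, of i j] unfolding good_def by blast
    then show ?thesis unfolding g_def by (rule someI_ex)
  qed
  then have g_m: "\<And>t i j. t \<le> T \<Longrightarrow> g t i j \<in> borel_measurable M"
    and g_ce: "\<And>t i j. t \<le> T \<Longrightarrow> has_cond_exp M (H t) (\<lambda>w. Z w \<bullet> g t i j w) (\<lambda>_. 0)"
    and g_ge: "\<And>t i j. t \<le> T \<Longrightarrow> AE w in M. \<forall>a\<in>Acone. piece t w i j (a $ i $ j) \<le> a $ i $ j *\<^sub>R g t i j w"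
    unfolding good_def by simp_all
  define G where "G = (\<lambda>t w (a :: 'd mat). \<Sum>i\<in>UNIV. \<Sum>j\<in>UNIV. a $ i $ j *\<^sub>R g t i j w)"
  have G_class: "G t w \<in> Fclass Acone" for t w
  proof -
    have "continuous_on UNIV (G t w)" unfolding G_def by (intro continuous_intros)
    moreover have "G t w (l *\<^sub>R a) = l *\<^sub>R G t w a" for l a
      by (simp add: G_def scaleR_sum_right)
    moreover have "G t w (a + b) = G t w a + G t w b" for a b
      by (simp add: G_def scaleR_add_left sum.distrib)
    ultimately show ?thesis by (simp add: Fclass_def)
  qed
  have G_Fseq: "Fseq M T Acone G"
    unfolding Fseq_def
  proof (intro allI impI conjI)
    fix t assume t: "t \<le> T"
    have 1: "(\<lambda>p. snd p $ i $ j) \<in> borel_measurable (M \<Otimes>\<^sub>M borel)" for i j :: 'd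
      by (rule borel_measurable_continuous_on[of "\<lambda>x. x $ i $ j"]) (auto intro!: continuous_intros)
    have 2: "(\<lambda>p. g t i j (fst p)) \<in> borel_measurable (M \<Otimes>\<^sub>M borel)" for i j
      by (rule measurable_compose[OF measurable_fst g_m[OF t]])
    show "(\<lambda>p. G t (fst p) (snd p)) \<in> borel_measurable (M \<Otimes>\<^sub>M borel)"
      unfolding G_def using 1 2 by (intro borel_measurable_sum borel_measurable_scaleR)
    show "AE w in M. G t w \<in> Fclass Acone" using G_class by simp
  qed
  interpret G: market M H T Acone G by unfold_locales (fact setting G_Fseq)+
  have G_ce: "has_cond_exp M (H t) (\<lambda>w. Z w \<bullet> G t w (\<eta> w)) (\<lambda>_. 0)" if t: "t \<le> T" and \<eta>: "\<eta> \<in> borel_measurable (H t)" for t \<eta>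
  proof -
    have "has_cond_exp M (H t) (\<lambda>w. \<Sum>i\<in>UNIV. \<Sum>j\<in>UNIV. \<eta> w $ i $ j * (Z w \<bullet> g t i j w)) (\<lambda>w. \<Sum>i\<in>UNIV. \<Sum>j\<in>UNIV. \<eta> w $ i $ j * 0)"
      by (intro has_cond_exp_sum[OF prob_space_axioms sub[OF t]] has_cond_exp_mult[OF prob_space_axioms sub[OF t]] g_ce t entry_measurable[OF \<eta>]) auto
    then show ?thesis by (simp add: G_def inner_sum_right)
  qed
  have dom: "AE w in M. F t w (\<eta> w) \<le> G t w (\<eta> w)" if t: "t \<le> T" and \<eta>: "\<eta> \<in> strat t" for t \<eta>
  proof -
    have "AE w in M. \<forall>i\<in>UNIV. \<forall>j\<in>UNIV. \<forall>a\<in>Acone. piece t w i j (a $ i $ j) \<le> a $ i $ j *\<^sub>R g t i j w"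
      by (rule AE_finite_allI[OF finite], rule AE_finite_allI[OF finite], rule g_ge[OF t])
    with HA_piece[OF HA t measurable_H_M[OF L0_measurable[OF \<eta>] t]] L0_AE[OF \<eta>] show ?thesis
    proof eventually_elim
      case (elim w)
      show ?case unfolding elim(1) G_def using elim by (intro sum_mono) auto
    qed
  qed
  have strict: "\<P>(w in M. \<exists>k. G t w (\<eta> w) $ k > F t w (\<eta> w) $ k) > 0"
    if t: "t \<le> T" and \<eta>: "\<eta> \<in> strat t" and n: "(\<lambda>w. F t w (\<eta> w)) \<notin> N0_t t" for t \<eta>
  proof (rule ccontr)
    let ?E = "{w \<in> space M. \<exists>k. G t w (\<eta> w) $ k > F t w (\<eta> w) $ k}"
    have vm: "(\<lambda>w. X w $ k) \<in> borel_measurable M" if "X \<in> borel_measurable M" for X :: "'a \<Rightarrow> real^'d" and k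
      by (rule borel_measurable_continuous_on[OF _ that]) (intro continuous_intros)
    note [measurable] = vm[OF F_L0_measurable[OF t \<eta>]] vm[OF G.F_L0_measurable[OF t \<eta>]]
    have "{w \<in> space M. G t w (\<eta> w) $ k > F t w (\<eta> w) $ k} \<in> sets M" for k by measurable
    moreover have "?E = (\<Union>k\<in>UNIV. {w \<in> space M. G t w (\<eta> w) $ k > F t w (\<eta> w) $ k})" by auto
    ultimately have E: "?E \<in> sets M" by auto
    assume "\<not> 0 < prob ?E"
    then have "prob ?E = 0" using measure_nonneg[of M ?E] by linarith
    then have "AE w in M. w \<notin> ?E" using prob_eq_0[OF E] by simp
    with dom[OF t \<eta>] AE_space have eq: "AE w in M. Z w \<bullet> F t w (\<eta> w) = Z w \<bullet> G t w (\<eta> w)"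
    proof eventually_elim
      case (elim w)
      have "F t w (\<eta> w) = G t w (\<eta> w)" using elim by (intro antisym) (auto simp: less_eq_vec_def not_less)
      then show ?case by simp
    qed
    have "has_cond_exp M (H t) (\<lambda>w. Z w \<bullet> F t w (\<eta> w)) (\<lambda>_. 0)"
      using F_L0_measurable[OF t \<eta>]
      by (intro has_cond_exp_cong[OF prob_space_axioms sub[OF t] G_ce[OF t L0_measurable[OF \<eta>]] _ eq]) measurable
    from has_cond_exp_unique[OF prob_space_axioms sub[OF t] has_cond_exp_Fbar[OF t L0_measurable[OF \<eta>]] this]
    have "(\<lambda>w. F t w (\<eta> w)) \<in> N0_t t" by (rule Dset_conditions(2)[OF t \<eta>])
    with n show False by simp
  qed
  have NAw: "NAw M H T Acone G"
    unfolding NAw_def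
  proof (intro ballI impI)
    fix X assume X: "X \<in> Aset M H T Acone G T" and X0: "X \<in> L0 M nonneg_orthant M"
    obtain \<eta> r where \<eta>: "\<And>s. s \<le> T \<Longrightarrow> \<eta> s \<in> strat s" and r: "r \<in> borel_measurable M" "AE w in M. 0 \<le> r w"
      and X': "AE w in M. X w = (\<Sum>s\<le>T. G s w (\<eta> s w)) - r w"
      using X order_refl by (rule G.AsetE) blast
    have X0': "AE w in M. 0 \<le> X w" using X0 by (simp add: L0_def nonneg_orthant_iff)
    define U where "U = (\<lambda>i w. Z w \<bullet> G (min i T) w (\<eta> (min i T) w))"
    have sumU: "(\<Sum>i<Suc T. U i w) = Z w \<bullet> (\<Sum>s\<le>T. G s w (\<eta> s w))" for w
      unfolding lessThan_Suc_atMost inner_sum_right by (intro sum.cong) (auto simp: U_def)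
    have R: "AE w in M. (\<Sum>s\<le>T. G s w (\<eta> s w)) = X w + r w" using X' by eventually_elim simp
    have nn: "AE w in M. 0 \<le> (\<Sum>i<Suc T. U i w)"
      using R r(2) X0' Z_pos
    proof eventually_elim
      case (elim w)
      show ?case unfolding sumU elim(1) using elim
        by (intro inner_nonneg_vec add_nonneg_nonneg) (auto simp: less_eq_vec_def less_imp_le)
    qed
    have U: "has_cond_exp M (H (min i T)) (U i) (\<lambda>_. 0)" for i
      unfolding U_def by (intro G_ce L0_measurable \<eta>) auto
    have "AE w in M. (\<Sum>i<Suc T. U i w) = 0"
      by (rule nonneg_sum_has_cond_exp(1)[where G="\<lambda>i. H (min i T)", OF clip_subalgebra[OF order_refl] clip_mono[OF order_refl] U _ nn]) auto
    then show "AE w in M. X w = 0"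
      using R r(2) X0' Z_pos
    proof eventually_elim
      case (elim w)
      have "X w + r w = 0" by (rule inner_pos_eq_0_iff[of "Z w"]) (use elim in \<open>auto simp only: sumU intro: add_nonneg_nonneg\<close>)
      then show ?case using elim(3,4) by (simp add: add_nonneg_eq_0_iff)
    qed
  qed
  show ?thesis unfolding NAr_def
  proof (intro exI[of _ G] conjI ballI allI impI G_Fseq NAw)
    fix \<eta> t i assume \<eta>: "\<eta> \<in> adapted M H T Acone" and t: "t \<le> T"
    then have L: "\<eta> t \<in> strat t" by (simp add: adapted_def)
    show "AE w in M. F t w (\<eta> t w) $ i \<le> G t w (\<eta> t w) $ i"
      using dom[OF t L] by eventually_elim (simp add: less_eq_vec_def)
    assume "(\<lambda>w. F t w (\<eta> t w)) \<notin> N0_t t"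
    then show "0 < \<P>(w in M. \<exists>k. F t w (\<eta> t w) $ k < G t w (\<eta> t w) $ k)" by (rule strict[OF t L])
  qed
qed

end

theorem mainTheorem7:
  fixes M :: "'a measure" and H :: "nat \<Rightarrow> 'a measure" and T :: nat
    and Acone :: "('d::finite) mat set" and F :: "nat \<Rightarrow> 'a \<Rightarrow> 'd mat \<Rightarrow> real^'d"
  assumes "setting M H T Acone"
    and "Fseq M T Acone F"
    and "HN0 M H T Acone F"
    and "HA M T Acone F"
    and "Cond_I M T F"
  shows "((NAr M H T Acone F \<or> (NAs M H T Acone F \<and> EF M H T Acone F)) \<longrightarrow>
            Dset M H T Acone F \<noteq> {} \<and> closed_in_prob M (Aset M H T Acone F T))
       \<and> (Dset M H T Acone F \<noteq> {} \<longrightarrow> NAs M H T Acone F \<and> NAr M H T Acone F)"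
proof -
  interpret market M H T Acone F by unfold_locales (fact assms)+
  have "Dset M H T Acone F \<noteq> {} \<and> closed_in_prob M (Aset M H T Acone F T)"
    if "NAr M H T Acone F \<or> (NAs M H T Acone F \<and> EF M H T Acone F)"
  proof -
    interpret arbitrage_free_market M H T Acone F
      using that arbitrage_free_of_NAr[OF assms(3)] arbitrage_free_of_NAs_EF[OF assms(3)] by blast
    show ?thesis using Dset_nonempty[OF assms(3-5)] closed_in_prob_Aset by blast
  qed
  moreover have "NAs M H T Acone F \<and> NAr M H T Acone F" if Z: "Z \<in> Dset M H T Acone F" for Z
  proof -
    interpret priced_market M H T Acone F Z by unfold_locales (fact assms Z)+
    show ?thesis using NAs NAr by blast
  qed
  ultimately show ?thesis by blast
qed

end
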